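(* Fix integers $L\ge2$ and $r\ge1$. Consider the leaf-decorated chains $\alpha_{L,\mathbf q}$ with the concentrated decoration $\mathbf q=(Lr,0,\dots,0)\in\mathbb N_0^L$ and with the balanced decoration $\mathbf q=(r,\dots,r)\in\mathbb N_0^L$. These two shapes have the same $v,d,|U|,|V|,s,h$, and the same functions $\sigma,\nu$ (as functions of $n$) for their equal-size typed coefficient tensors. Nevertheless, the ratio of their globally injective expected norms (concentrated over balanced) is $$\frac{\mathbb E\|M_{\alpha_{L,(Lr,0,\dots,0)}}\|}{\mathbb E\|M_{\alpha_{L,(r,\dots,r)}}\|}=\Theta_{L,r}\big((\log n)^{(L-1)r/2}\big).$$ For $L=2,r=1$, both trees have six vertices and five edges; their expected norms are of order $n^{5/2}\log n$ and $n^{5/2}\sqrt{\log n}$, respectively.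
   Context: Leaf-decorated chain: for $L\ge1$ and $\mathbf q=(q_1,\dots,q_L)\in\mathbb N_0^L$, the shape $\alpha_{L,\mathbf q}$ consists of the path $x_0-x_1-\cdots-x_L-x_{L+1}$, with boundaries $U=(x_0)$ and $V=(x_{L+1})$, together with $q_j$ distinct leaves attached to $x_j$ for each $j$. Write $Q=\sum_jq_j$, $v=L+2+Q$ (number of vertices), $d=L+1+Q$ (number of edges). $h$ is the number of isolated vertices outside $U\cup V$, and $s$ the minimum size of a vertex set (boundary vertices allowed) meeting every $U$–$V$ path. Globally injective graph matrix: with i.i.d. uniform signs $\xi_{\{i,j\}}$ over unordered pairs $\{i,j\}\subseteq[n]$, $M_\alpha$ is the $n\times n$ matrix $$M_\alpha[i,j]=\sum_{\substack{\phi:W\hookrightarrow[n]\\ \phi(x_0)=i,\ \phi(x_{L+1})=j}}\ \prod_{\{x,y\}\in E}\xi_{\{\phi(x),\phi(y)\}},$$ summing over injective maps on the vertex set $W$ ($E$ the edge set), with value $0$ if there is none; $\|\cdot\|$ is the operator norm. Equal-size typed coefficient tensor $\mathcal A$ of a shape $\alpha_{L,\mathbf q}$: each vertex $x$ has its own label set of size $n$. $\mathcal A$ has one noise axis of size $n^2$ for each edge $\{x,y\}$ (indexed by a pair of labels, one for $x$ and one for $y$) and two matrix axes of size $n$ (a row axis indexed by a label of $x_0$ and a column axis indexed by a label of $x_{L+1}$). Its entry is $1$ if all labels assigned to the same vertex by the different axes agree and $0$ otherwise. For a partition of the axes into row and column sides, the flattening is the matrix with the corresponding product index sets. $\sigma(\mathcal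 A)$ is the largest operator norm of a flattening with the two matrix axes on opposite sides; $\nu(\mathcal A)$ is the largest operator norm of a flattening with both matrix axes on the column side and a nonempty set of noise axes on the row side. *)

theory Defs
  imports
    "HOL-Probability.Probability"
    "HOL-Probability.Product_PMF"
    "HOL-Library.Landau_Symbols"
begin

section \<open>Operator norm of a finite real matrix\<close>

text \<open>
  The matrices below have sizes that vary with \<open>n\<close>, so they are given by explicit finite index
  sets instead of index types. For index types this is the operator norm of the library, see
  \<open>op_norm_eq_onorm\<close>.
\<close>

definition op_norm :: "'i set \<Rightarrow> 'j set \<Rightarrow> ('i \<Rightarrow> 'j \<Rightarrow> real) \<Rightarrow> real" where
  "op_norm I J M = (SUP x\<in>{x. L2_set x J \<le> 1}. L2_set (\<lambda>i. \<Sum>j\<in>J. M i j * x j) I)"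

lemma op_norm_eq_onorm:
  fixes A :: "real ^ 'm ^ 'n"
  shows "op_norm UNIV UNIV (\<lambda>i j. A $ i $ j) = onorm ((*v) A)"
proof -
  have N: "norm x = L2_set (\<lambda>i. x $ i) UNIV" for x :: "real ^ 'k"
    by (simp add: norm_vec_def L2_set_def)
  have E: "(\<lambda>i. \<Sum>j\<in>UNIV. A $ i $ j * x j) = (\<lambda>i. (A *v (\<chi> j. x j)) $ i)" for x
    by (simp add: matrix_vector_mult_def fun_eq_iff)
  have bl: "bounded_linear ((*v) A)"
    by (rule matrix_vector_mul_bounded_linear)
  have eq: "op_norm UNIV UNIV (\<lambda>i j. A $ i $ j) = (SUP x\<in>{x. norm x \<le> 1}. norm (A *v x))"
  proof -
    have im: "{x :: real ^ 'm. norm x \<le> 1} = vec_lambda ` {x. L2_set x UNIV \<le> 1}"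
    proof (intro equalityI subsetI)
      fix x :: "real ^ 'm" assume "x \<in> {x. norm x \<le> 1}"
      then show "x \<in> vec_lambda ` {x. L2_set x UNIV \<le> 1}"
        by (intro image_eqI[of _ _ "vec_nth x"]) (auto simp: N)
    qed (auto simp: N vec_lambda_inverse)
    show ?thesis
      unfolding op_norm_def im image_image by (simp only: E N)
  qed
  show ?thesis unfolding eq
  proof (rule antisym)
    show "(SUP x\<in>{x. norm x \<le> 1}. norm (A *v x)) \<le> onorm ((*v) A)"
    proof (rule cSUP_least)
      fix x :: "real ^ 'm" assume "x \<in> {x. norm x \<le> 1}"
      then have "onorm ((*v) A) * norm x \<le> onorm ((*v) A) * 1"
        by (intro mult_left_mono onorm_pos_le[OF bl]) auto
      then show "norm (A *v x) \<le> onorm ((*v) A)"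
        using onorm[OF bl, of x] by simp
    qed (auto intro: exI[of _ 0])
    have bdd: "bdd_above ((\<lambda>x. norm (A *v x)) ` {x. norm x \<le> 1})"
    proof (rule bdd_aboveI2)
      fix x :: "real ^ 'm" assume "x \<in> {x. norm x \<le> 1}"
      then have "onorm ((*v) A) * norm x \<le> onorm ((*v) A) * 1"
        by (intro mult_left_mono onorm_pos_le[OF bl]) auto
      then show "norm (A *v x) \<le> onorm ((*v) A)"
        using onorm[OF bl, of x] by simp
    qed
    show "onorm ((*v) A) \<le> (SUP x\<in>{x. norm x \<le> 1}. norm (A *v x))"
      unfolding onorm_def
    proof (rule cSUP_least)
      fix x :: "real ^ 'm"
      have "norm (A *v x) / norm x = norm (A *v (x /\<^sub>R norm x))"
        by (simp add: matrix_vector_mult_scaleR divide_inverse_commute)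
      also have "\<dots> \<le> (SUP x\<in>{x. norm x \<le> 1}. norm (A *v x))"
        by (rule cSUP_upper[OF _ bdd]) (simp add: divide_simps)
      finally show "norm (A *v x) / norm x \<le> (SUP x\<in>{x. norm x \<le> 1}. norm (A *v x))" .
    qed simp
  qed
qed


section \<open>Shapes\<close>

record 'a shape =
  verts :: "'a set"
  edges :: "'a set set"
  left_bd :: "'a list"
  right_bd :: "'a list"

definition boundary_path :: "'a shape \<Rightarrow> 'a list \<Rightarrow> bool" where
  "boundary_path \<alpha> p \<longleftrightarrow>
     p \<noteq> [] \<and> set p \<subseteq> verts \<alpha> \<and> distinct p \<and> successively (\<lambda>x y. {x, y} \<in> edges \<alpha>) p \<and>
     hd p \<in> set (left_bd \<alpha>) \<and> last p \<in> set (right_bd \<alpha>)"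

definition is_tree :: "'a shape \<Rightarrow> bool" where
  "is_tree \<alpha> \<longleftrightarrow>
     (\<forall>x\<in>verts \<alpha>. \<forall>y\<in>verts \<alpha>. (x, y) \<in> {(a, b). {a, b} \<in> edges \<alpha>}\<^sup>*) \<and>
     (\<nexists>c. 3 \<le> length c \<and> distinct c \<and> successively (\<lambda>x y. {x, y} \<in> edges \<alpha>) c \<and>
          {last c, hd c} \<in> edges \<alpha>)"

definition min_separator :: "'a shape \<Rightarrow> nat" where
  "min_separator \<alpha> =
     Min (card ` {S. S \<subseteq> verts \<alpha> \<and> (\<forall>p. boundary_path \<alpha> p \<longrightarrow> set p \<inter> S \<noteq> {})})"

definition num_isolated :: "'a shape \<Rightarrow> nat" where
  "num_isolated \<alpha> =
     card {x \<in> verts \<alpha> - (set (left_bd \<alpha>) \<union> set (right_bd \<alpha>)). \<forall>e \<in> edges \<alpha>. x \<notin> e}"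


section \<open>Leaf-decorated chains\<close>

datatype chain_vertex = Spine nat | Leaf nat nat

text \<open>A decoration in \<open>\<nat>\<^sup>L\<close> is a function of which only the values at \<open>1, \<dots>, L\<close> are used.\<close>

definition chain :: "nat \<Rightarrow> (nat \<Rightarrow> nat) \<Rightarrow> chain_vertex shape" where
  "chain L q = \<lparr>
     verts = {Spine i |i. i \<le> L + 1} \<union> {Leaf j k |j k. 1 \<le> j \<and> j \<le> L \<and> k < q j},
     edges = {{Spine i, Spine (i + 1)} |i. i \<le> L} \<union>
             {{Spine j, Leaf j k} |j k. 1 \<le> j \<and> j \<le> L \<and> k < q j},
     left_bd = [Spine 0],
     right_bd = [Spine (L + 1)]\<rparr>"

definition concentrated :: "nat \<Rightarrow> nat \<Rightarrow> nat \<Rightarrow> nat" where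
  "concentrated L r j = (if j = 1 then L * r else 0)"

definition balanced :: "nat \<Rightarrow> nat \<Rightarrow> nat" where
  "balanced r j = r"

lemma card_verts_chain: "card (verts (chain L q)) = L + 2 + (\<Sum>j=1..L. q j)"
proof -
  let ?S = "Spine ` {..L + 1}"
  let ?T = "(\<lambda>(j, k). Leaf j k) ` (SIGMA j:{1..L}. {..<q j})"
  have "verts (chain L q) = ?S \<union> ?T"
    by (auto simp: chain_def image_iff)
  moreover have "card (?S \<union> ?T) = card ?S + card ?T"
    by (rule card_Un_disjoint) auto
  moreover have "card ?S = L + 2"
    by (subst card_image) (auto simp: inj_on_def)
  moreover have "card ?T = (\<Sum>j=1..L. q j)"
    by (subst card_image) (auto simp: inj_on_def)
  ultimately show ?thesis by simp
qed

lemma card_edges_chain: "card (edges (chain L q)) = L + 1 + (\<Sum>j=1..L. q j)"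
proof -
  let ?S = "(\<lambda>i. {Spine i, Spine (i + 1)}) ` {..L}"
  let ?T = "(\<lambda>(j, k). {Spine j, Leaf j k}) ` (SIGMA j:{1..L}. {..<q j})"
  have "edges (chain L q) = ?S \<union> ?T"
    by (auto simp: chain_def image_iff)
  moreover have "card (?S \<union> ?T) = card ?S + card ?T"
    by (rule card_Un_disjoint) (auto simp: doubleton_eq_iff)
  moreover have "card ?S = L + 1"
    by (subst card_image) (auto simp: inj_on_def doubleton_eq_iff)
  moreover have "card ?T = (\<Sum>j=1..L. q j)"
    by (subst card_image) (auto simp: inj_on_def doubleton_eq_iff)
  ultimately show ?thesis by simp
qed


section \<open>Globally injective graph matrices\<close>

definition random_signs :: "nat \<Rightarrow> (nat set \<Rightarrow> real) pmf" where
  "random_signs n = Pi_pmf {e. e \<subseteq> {1..n} \<and> card e = 2} 0 (\<lambda>_. pmf_of_set {-1, 1})"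

text \<open>
  Maps on the vertex set are represented by extensional functions (\<open>\<rightarrow>\<^sub>E\<close>), so that each is counted
  once. Row and column are single labels, so this is meant for shapes whose two boundaries have
  length one.
\<close>

definition graph_matrix :: "'a shape \<Rightarrow> nat \<Rightarrow> (nat set \<Rightarrow> real) \<Rightarrow> nat \<Rightarrow> nat \<Rightarrow> real" where
  "graph_matrix \<alpha> n \<xi> i j =
     (\<Sum>\<phi> | \<phi> \<in> verts \<alpha> \<rightarrow>\<^sub>E {1..n} \<and> inj_on \<phi> (verts \<alpha>) \<and>
           map \<phi> (left_bd \<alpha>) = [i] \<and> map \<phi> (right_bd \<alpha>) = [j].
        \<Prod>e\<in>edges \<alpha>. \<xi> (\<phi> ` e))"

definition expected_norm :: "'a shape \<Rightarrow> nat \<Rightarrow> real" where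
  "expected_norm \<alpha> n =
     measure_pmf.expectation (random_signs n)
       (\<lambda>\<xi>. op_norm {1..n} {1..n} (graph_matrix \<alpha> n \<xi>))"


section \<open>The equal-size typed coefficient tensor\<close>

datatype 'a axis = Noise "'a set" | Row_Axis | Col_Axis

definition axes :: "'a shape \<Rightarrow> 'a axis set" where
  "axes \<alpha> = Noise ` edges \<alpha> \<union> {Row_Axis, Col_Axis}"

fun axis_verts :: "'a shape \<Rightarrow> 'a axis \<Rightarrow> 'a set" where
  "axis_verts \<alpha> (Noise e) = e"
| "axis_verts \<alpha> Row_Axis = set (left_bd \<alpha>)"
| "axis_verts \<alpha> Col_Axis = set (right_bd \<alpha>)"

text \<open>
  An index of an axis assigns a label to each vertex of that axis: a function on the two endpoints
  for a noise axis (\<open>n\<^sup>2\<close> indices), a function on the single boundary vertex for a matrix axis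
  (\<open>n\<close> indices). Labels attached to distinct vertices are never compared, so \<open>{1..n}\<close> can serve as
  the label set of every vertex.
\<close>

definition axis_index :: "'a shape \<Rightarrow> nat \<Rightarrow> 'a axis \<Rightarrow> ('a \<Rightarrow> nat) set" where
  "axis_index \<alpha> n a = axis_verts \<alpha> a \<rightarrow>\<^sub>E {1..n}"

definition coeff_tensor :: "'a shape \<Rightarrow> ('a axis \<Rightarrow> 'a \<Rightarrow> nat) \<Rightarrow> real" where
  "coeff_tensor \<alpha> \<iota> =
     (if \<forall>a\<in>axes \<alpha>. \<forall>b\<in>axes \<alpha>. \<forall>x\<in>axis_verts \<alpha> a \<inter> axis_verts \<alpha> b. \<iota> a x = \<iota> b x
      then 1 else 0)"

text \<open>Operator norm of the flattening with row side \<open>R\<close> and column side \<open>axes \<alpha> - R\<close>.\<close>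

definition flattening_norm :: "'a shape \<Rightarrow> nat \<Rightarrow> 'a axis set \<Rightarrow> real" where
  "flattening_norm \<alpha> n R =
     op_norm (PiE R (axis_index \<alpha> n)) (PiE (axes \<alpha> - R) (axis_index \<alpha> n))
       (\<lambda>\<rho> \<gamma>. coeff_tensor \<alpha> (\<lambda>a. if a \<in> R then \<rho> a else \<gamma> a))"

definition tensor_sigma :: "'a shape \<Rightarrow> nat \<Rightarrow> real" where
  "tensor_sigma \<alpha> n =
     Max (flattening_norm \<alpha> n ` {R. R \<subseteq> axes \<alpha> \<and> (Row_Axis \<in> R \<longleftrightarrow> Col_Axis \<notin> R)})"

definition tensor_nu :: "'a shape \<Rightarrow> nat \<Rightarrow> real" where
  "tensor_nu \<alpha> n =
     Max (flattening_norm \<alpha> n `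
       {R. R \<subseteq> axes \<alpha> \<and> Row_Axis \<notin> R \<and> Col_Axis \<notin> R \<and> R \<noteq> {}})"

end

theory Submission
  imports Defs "HOL-Real_Asymp.Real_Asymp"
begin

text \<open>
  For a chain with most leaves at \<open>x\<^sub>1\<close> the expected norm has order \<open>n\<close> to the power \<open>(v - 1)/2\<close> times
  \<open>log n\<close> to the power \<open>q\<^sub>1/2\<close>, so only the largest number of leaves at one vertex matters.

  Upper bound: averaging over all colourings of the labels by the vertices of the shape reduces the
  injective matrix to products \<open>A\<^sub>0 D\<^sub>1 A\<^sub>1 \<dots> D\<^sub>L A\<^sub>L\<close> of independent sign matrices \<open>A\<^sub>j\<close> and diagonal
  matrices \<open>D\<^sub>j\<close>, whose entries are products of \<open>q\<^sub>j\<close> independent sums of signs. A Chevet type inequality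
  for \<open>Y A D\<close> pairs the largest entry of \<open>D\<close> with the Frobenius norm of \<open>Y\<close>, and the operator norm of \<open>Y\<close>
  only with moments of \<open>D\<close>. The Frobenius norms carry no logarithm, so the logarithms of different
  \<open>D\<^sub>j\<close> never multiply.

  Lower bound: random signs attached to pairs of colours extract the product from the injective
  matrix. Flipping the signs of the entries of \<open>D\<^sub>1\<close> isolates the rank-one term of a large entry, and
  some entry is of order \<open>n log n\<close> to the power \<open>q\<^sub>1/2\<close> because a sum of \<open>n\<close> signs exceeds a small
  multiple of the square root of \<open>n log n\<close> with probability at least a small negative power of \<open>n\<close>.
\<close>

section \<open>Averages over signs\<close>

text \<open>Bounding the norm of the product by the product of the norms would cost
  \<open>sqrt (ln n)\<close> once for every leaf of the chain. What avoids this is a trade: the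
  Frobenius norm of the part already built is typically larger than its operator norm by a factor
  \<open>sqrt n\<close>, but it is controlled by second moments alone, and this
  \<open>sqrt n\<close> is exactly what the next sign matrix contributes to the operator norm
  anyway. So the new logarithm multiplies a quantity free of logarithms, and the recursion adds old
  and new logarithms instead of multiplying them.

  All randomness is a uniform average over finitely many sign patterns; conditioning, independence
  and Jensen become statements about finite sums.

  The tensor parameters are blind to the decoration for a simple reason. Flattenings are 0/1
  matrices, and in a connected shape the two sides of a proper flattening share a vertex. The Schur
  test then bounds the norm by \<open>n\<close> to the power \<open>(v - 1)/2\<close>, with equality
  when exactly one vertex is shared, and both \<sigma> and \<nu> admit such a flattening.\<close>

text \<open>As \<open>\<xi>\<close> supplies the coordinates outside \<open>J\<close>, the operators \<open>sign_avg J\<close> are commuting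
  conditional expectations.\<close>

definition sign_avg :: "'i set \<Rightarrow> (('i \<Rightarrow> real) \<Rightarrow> real) \<Rightarrow> ('i \<Rightarrow> real) \<Rightarrow> real" where
  "sign_avg J f \<xi> =
     (\<Sum>A\<in>Pow J. f (\<lambda>i. if i \<in> J then (if i \<in> A then 1 else -1) else \<xi> i)) / 2 ^ card J"

text \<open>Together with \<open>is_sign\<close> this describes the points at which
  \<open>sign_avg J\<close> evaluates its argument: signs on \<open>J\<close>, the base point
  elsewhere. The congruence and monotonicity rules supply exactly these two facts.\<close>

definition agree_off :: "'i set \<Rightarrow> ('i \<Rightarrow> real) \<Rightarrow> ('i \<Rightarrow> real) \<Rightarrow> bool" where
  "agree_off J \<xi> \<xi>' \<longleftrightarrow> (\<forall>i. i \<notin> J \<longrightarrow> \<xi> i = \<xi>' i)"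

definition is_sign :: "'i set \<Rightarrow> ('i \<Rightarrow> real) \<Rightarrow> bool" where
  "is_sign J \<xi> \<longleftrightarrow> (\<forall>i\<in>J. \<xi> i = 1 \<or> \<xi> i = -1)"

lemma sign_avg_empty [simp]: "sign_avg {} f \<xi> = f \<xi>"
  by (simp add: sign_avg_def)

lemma sign_avg_insert:
  assumes "finite J" "i \<notin> J"
  shows "sign_avg (insert i J) f \<xi> =
    (sign_avg J (\<lambda>\<xi>. f (\<xi>(i := 1))) \<xi> + sign_avg J (\<lambda>\<xi>. f (\<xi>(i := -1))) \<xi>) / 2"
proof -
  let ?g = "\<lambda>J A j. if j \<in> J then (if j \<in> A then 1 else -1) else \<xi> j"
  have "(\<Sum>A\<in>Pow (insert i J). f (?g (insert i J) A)) =
      (\<Sum>A\<in>Pow J. f (?g (insert i J) A)) + (\<Sum>A\<in>insert i ` Pow J. f (?g (insert i J) A))"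
    unfolding Pow_insert using assms by (intro sum.union_disjoint) auto
  also have "(\<Sum>A\<in>insert i ` Pow J. f (?g (insert i J) A)) =
      (\<Sum>A\<in>Pow J. f (?g (insert i J) (insert i A)))"
    using assms(2) by (subst sum.reindex) (auto simp: inj_on_def)
  also have "\<dots> = (\<Sum>A\<in>Pow J. f ((?g J A)(i := 1)))"
    using assms(2) by (intro sum.cong arg_cong[of _ _ f]) (auto simp: fun_eq_iff)
  also have "(\<Sum>A\<in>Pow J. f (?g (insert i J) A)) = (\<Sum>A\<in>Pow J. f ((?g J A)(i := -1)))"
    using assms(2) by (intro sum.cong arg_cong[of _ _ f]) (auto simp: fun_eq_iff)
  finally show ?thesis
    using assms by (simp add: sign_avg_def field_simps del: fun_upd_apply insert_iff)
qed

lemma sign_avg_add: "sign_avg J (\<lambda>\<xi>. f \<xi> + g \<xi>) \<xi> = sign_avg J f \<xi> + sign_avg J g \<xi>"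
  by (simp add: sign_avg_def sum.distrib add_divide_distrib)

lemma sign_avg_cmult: "sign_avg J (\<lambda>\<xi>. c * f \<xi>) \<xi> = c * sign_avg J f \<xi>"
  by (simp add: sign_avg_def sum_distrib_left)

lemma sign_avg_cmult_right: "sign_avg J (\<lambda>\<xi>. f \<xi> * c) \<xi> = sign_avg J f \<xi> * c"
  by (simp add: sign_avg_def sum_distrib_right)

lemma sign_avg_sum: "sign_avg J (\<lambda>\<xi>. \<Sum>x\<in>X. f x \<xi>) \<xi> = (\<Sum>x\<in>X. sign_avg J (f x) \<xi>)"
  unfolding sign_avg_def by (subst sum.swap) (simp add: sum_divide_distrib)

lemma sign_avg_cong:
  assumes "\<And>\<xi>'. is_sign J \<xi>' \<Longrightarrow> agree_off J \<xi> \<xi>' \<Longrightarrow> f \<xi>' = g \<xi>'"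
  shows "sign_avg J f \<xi> = sign_avg J g \<xi>"
  unfolding sign_avg_def
  by (intro arg_cong2[of _ _ _ _ "(/)"] sum.cong refl assms)
     (auto simp: is_sign_def agree_off_def)

lemma sign_avg_mono:
  assumes "\<And>\<xi>'. is_sign J \<xi>' \<Longrightarrow> agree_off J \<xi> \<xi>' \<Longrightarrow> f \<xi>' \<le> g \<xi>'"
  shows "sign_avg J f \<xi> \<le> sign_avg J g \<xi>"
  unfolding sign_avg_def
  by (intro divide_right_mono sum_mono assms)
     (auto simp: is_sign_def agree_off_def)

lemma sign_avg_const [simp]: "finite J \<Longrightarrow> sign_avg J (\<lambda>_. c) \<xi> = c"
  by (simp add: sign_avg_def card_Pow)

text \<open>Taking out what is known: a factor that does not read the coordinates in
  \<open>J\<close> is constant under the average over \<open>J\<close>.\<close>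

lemma sign_avg_factor:
  assumes "\<And>\<xi>'. agree_off J \<xi> \<xi>' \<Longrightarrow> f \<xi>' = f \<xi>"
  shows "sign_avg J (\<lambda>\<xi>. f \<xi> * g \<xi>) \<xi> = f \<xi> * sign_avg J g \<xi>"
proof -
  have "sign_avg J (\<lambda>\<xi>. f \<xi> * g \<xi>) \<xi> = sign_avg J (\<lambda>\<xi>'. f \<xi> * g \<xi>') \<xi>"
    using assms by (intro sign_avg_cong) auto
  then show ?thesis by (simp add: sign_avg_cmult)
qed

lemma sign_avg_indep:
  assumes "finite J" "\<And>\<xi>'. agree_off J \<xi> \<xi>' \<Longrightarrow> f \<xi>' = f \<xi>"
  shows "sign_avg J f \<xi> = f \<xi>"
  using sign_avg_factor[of J \<xi> f "\<lambda>_. 1"] assms by simp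

lemma sign_avg_nonneg:
  assumes "\<And>\<xi>'. is_sign J \<xi>' \<Longrightarrow> agree_off J \<xi> \<xi>' \<Longrightarrow> 0 \<le> f \<xi>'"
  shows "0 \<le> sign_avg J f \<xi>"
  using sign_avg_mono[of J \<xi> "\<lambda>_. 0" f] assms by (simp add: sign_avg_def)

lemma sign_avg_upd:
  assumes "i \<notin> J"
  shows "sign_avg J f (\<xi>(i := c)) = sign_avg J (\<lambda>\<xi>. f (\<xi>(i := c))) \<xi>"
  unfolding sign_avg_def using assms
  by (intro arg_cong2[of _ _ _ _ "(/)"] sum.cong refl arg_cong[of _ _ f]) (auto simp: fun_eq_iff)

text \<open>The tower property: one group of signs is averaged while the others are held
  fixed.\<close>

lemma sign_avg_Un:
  assumes "finite J" "finite K" "J \<inter> K = {}"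
  shows "sign_avg (J \<union> K) f \<xi> = sign_avg J (sign_avg K f) \<xi>"
  using assms(1,3)
proof (induction J arbitrary: f \<xi> rule: finite_induct)
  case (insert i J)
  have "sign_avg (insert i J \<union> K) f \<xi> =
      (sign_avg (J \<union> K) (\<lambda>\<xi>. f (\<xi>(i := 1))) \<xi> + sign_avg (J \<union> K) (\<lambda>\<xi>. f (\<xi>(i := -1))) \<xi>) / 2"
    using insert assms(2) by (simp add: sign_avg_insert)
  then show ?case
    using insert assms(2) by (simp add: sign_avg_insert sign_avg_upd)
qed simp

text \<open>A deterministic flip permutes the points of the average. The isolation of single terms
  in the lower bound rests on this invariance; the condition \<open>s i = 1\<close> off
  \<open>J\<close> keeps the base point in place.\<close>

lemma sign_avg_flip:
  assumes "finite J" "\<And>i. i \<in> J \<Longrightarrow> s i = 1 \<or> s i = -1" "\<And>i. i \<notin> J \<Longrightarrow> s i = 1"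
  shows "sign_avg J (\<lambda>\<xi>. f (\<lambda>i. s i * \<xi> i)) \<xi> = sign_avg J f \<xi>"
  using assms
proof (induction J arbitrary: f s \<xi> rule: finite_induct)
  case empty
  then show ?case by simp
next
  case (insert i J)
  let ?s = "s(i := 1)"
  have upd: "(\<lambda>j. s j * ((\<xi>::'a \<Rightarrow> real)(i := c)) j) = (\<lambda>j. ?s j * \<xi> j)(i := s i * c)" for \<xi> c
    by (auto simp: fun_eq_iff)
  have IH: "sign_avg J (\<lambda>\<xi>. f ((\<lambda>j. ?s j * \<xi> j)(i := c))) \<xi> = sign_avg J (\<lambda>\<xi>. f (\<xi>(i := c))) \<xi>" for c
    using insert.IH[of ?s "\<lambda>\<xi>. f (\<xi>(i := c))"] insert.hyps insert.prems by force
  from insert.prems(1)[of i] show ?case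
    unfolding sign_avg_insert[OF insert.hyps(1,2)] upd IH by auto
qed

text \<open>Nonnegativity of the variance.\<close>

lemma sign_avg_le_sqrt:
  assumes "finite J"
  shows "(sign_avg J f \<xi>)\<^sup>2 \<le> sign_avg J (\<lambda>\<xi>. (f \<xi>)\<^sup>2) \<xi>"
proof -
  let ?m = "sign_avg J f \<xi>"
  have "0 \<le> sign_avg J (\<lambda>\<xi>. (f \<xi> - ?m)\<^sup>2) \<xi>"
    by (intro sign_avg_nonneg) auto
  also have "\<dots> = sign_avg J (\<lambda>\<xi>. (f \<xi>)\<^sup>2 + ((- 2 * ?m) * f \<xi> + ?m\<^sup>2)) \<xi>"
    by (intro sign_avg_cong) (auto simp: power2_eq_square algebra_simps)
  also have "\<dots> = sign_avg J (\<lambda>\<xi>. (f \<xi>)\<^sup>2) \<xi> - ?m\<^sup>2"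
    using assms by (simp only: sign_avg_add sign_avg_cmult sign_avg_const)
      (simp add: power2_eq_square)
  finally show ?thesis by simp
qed

lemma sign_avg_sqrt_le:
  assumes "finite J" "\<And>\<xi>. 0 \<le> f \<xi>"
  shows "sign_avg J (\<lambda>\<xi>. sqrt (f \<xi>)) \<xi> \<le> sqrt (sign_avg J f \<xi>)"
  using sign_avg_le_sqrt[OF assms(1), of "\<lambda>\<xi>. sqrt (f \<xi>)" \<xi>] assms(2)
  by (intro real_le_rsqrt) simp

text \<open>Jensen, from the tangent of \<open>exp\<close> at the mean.\<close>

lemma exp_sign_avg_le:
  assumes "finite J"
  shows "exp (sign_avg J f \<xi>) \<le> sign_avg J (\<lambda>\<xi>. exp (f \<xi>)) \<xi>"
proof -
  let ?m = "sign_avg J f \<xi>"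
  have "exp ?m = sign_avg J (\<lambda>\<xi>. exp ?m * (1 + (f \<xi> + - ?m))) \<xi>"
    using assms by (simp only: sign_avg_add sign_avg_cmult sign_avg_const) simp
  also have "\<dots> \<le> sign_avg J (\<lambda>\<xi>. exp ?m * exp (f \<xi> + - ?m)) \<xi>"
    by (intro sign_avg_mono mult_left_mono exp_ge_add_one_self) auto
  also have "\<dots> = sign_avg J (\<lambda>\<xi>. exp (f \<xi>)) \<xi>"
    by (intro sign_avg_cong) (simp flip: exp_add)
  finally show ?thesis .
qed

lemma sign_avg_power_le:
  assumes "finite J" "\<And>\<xi>. 0 \<le> f \<xi>" "p \<ge> 1"
  shows "(sign_avg J f \<xi>) ^ p \<le> sign_avg J (\<lambda>\<xi>. f \<xi> ^ p) \<xi>"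
proof -
  let ?m = "sign_avg J f \<xi>"
  have m0: "0 \<le> ?m" using assms(2) by (intro sign_avg_nonneg) auto
  \<comment> \<open>The tangent of the power function at \<open>m\<close>: Bernoulli's inequality
    for \<open>x / m - 1\<close>, scaled by \<open>m ^ p\<close>. Taken at the mean and averaged, it
    is Jensen's inequality.\<close>
  have tangent: "m ^ p + real p * m ^ (p - 1) * (x - m) \<le> x ^ p" if "0 \<le> m" "0 \<le> x" for m x :: real
  proof (cases "m = 0")
    case True
    then show ?thesis using that assms(3) by (cases "p = 1") (auto simp: power_0_left)
  next
    case False
    then have m: "m > 0" using that by simp
    have "1 + real p * (x / m - 1) \<le> (1 + (x / m - 1)) ^ p"
      using that m by (intro Bernoulli_inequality) simp
    then have "m ^ p * (1 + real p * (x / m - 1)) \<le> m ^ p * (x / m) ^ p"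
      using m by (intro mult_left_mono) auto
    also have "m ^ p * (x / m) ^ p = x ^ p"
      using m by (simp add: power_divide)
    also have "m ^ p * (1 + real p * (x / m - 1)) = m ^ p + real p * m ^ (p - 1) * (x - m)"
      using m assms(3) by (cases p) (auto simp: field_simps)
    finally show ?thesis .
  qed
  have "?m ^ p = sign_avg J (\<lambda>\<xi>. ?m ^ p + (real p * ?m ^ (p - 1)) * (f \<xi> + - ?m)) \<xi>"
    using assms(1) by (simp only: sign_avg_add sign_avg_cmult sign_avg_const) simp
  also have "\<dots> \<le> sign_avg J (\<lambda>\<xi>. f \<xi> ^ p) \<xi>"
    using tangent[OF m0 assms(2)] by (intro sign_avg_mono) simp
  finally show ?thesis .
qed

section \<open>Operator norms\<close>

text \<open>The squared Frobenius norm. Without the square root, an average over signs passes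
  through the double sum.\<close>

definition frob2 :: "'i set \<Rightarrow> 'j set \<Rightarrow> ('i \<Rightarrow> 'j \<Rightarrow> real) \<Rightarrow> real" where
  "frob2 I J M = (\<Sum>i\<in>I. \<Sum>j\<in>J. (M i j)\<^sup>2)"

lemma L2_set_power2: "(L2_set f A)\<^sup>2 = (\<Sum>i\<in>A. (f i)\<^sup>2)"
  by (simp add: L2_set_def sum_nonneg)

lemma abs_sum_mult_le_L2: "\<bar>\<Sum>i\<in>A. f i * g i\<bar> \<le> L2_set f A * L2_set g A"
  using sum_abs[of "\<lambda>i. f i * g i" A] L2_set_mult_ineq[of f g A] by (simp add: abs_mult)

lemma L2_set_cmult: "L2_set (\<lambda>i. c * f i) A = \<bar>c\<bar> * L2_set f A"
  by (simp add: L2_set_def power_mult_distrib real_sqrt_mult flip: sum_distrib_left)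

lemma L2_set_sum_le: "L2_set (\<lambda>i. \<Sum>k\<in>K. f k i) A \<le> (\<Sum>k\<in>K. L2_set (f k) A)"
proof (induction K rule: infinite_finite_induct)
  case (insert k K)
  then show ?case
    using L2_set_triangle_ineq[of "f k" "\<lambda>i. \<Sum>k\<in>K. f k i" A] by simp
qed (auto simp: L2_set_0')

lemma frob2_nonneg [simp]: "0 \<le> frob2 I J M"
  by (simp add: frob2_def sum_nonneg)

lemma L2_set_mv_le_frob: "L2_set (\<lambda>i. \<Sum>j\<in>J. M i j * x j) I \<le> sqrt (frob2 I J M) * L2_set x J"
proof -
  have "(\<Sum>i\<in>I. (\<Sum>j\<in>J. M i j * x j)\<^sup>2) \<le> (\<Sum>i\<in>I. (\<Sum>j\<in>J. (M i j)\<^sup>2) * (L2_set x J)\<^sup>2)"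
  proof (intro sum_mono)
    fix i
    have "(\<Sum>j\<in>J. M i j * x j)\<^sup>2 \<le> (L2_set (M i) J * L2_set x J)\<^sup>2"
      using abs_sum_mult_le_L2[of "M i" x J] by (simp add: abs_le_square_iff[symmetric])
    then show "(\<Sum>j\<in>J. M i j * x j)\<^sup>2 \<le> (\<Sum>j\<in>J. (M i j)\<^sup>2) * (L2_set x J)\<^sup>2"
      by (simp add: power_mult_distrib L2_set_power2)
  qed
  also have "\<dots> = frob2 I J M * (L2_set x J)\<^sup>2"
    by (simp add: frob2_def sum_distrib_right)
  finally have "L2_set (\<lambda>i. \<Sum>j\<in>J. M i j * x j) I \<le> sqrt (frob2 I J M * (L2_set x J)\<^sup>2)"
    unfolding L2_set_def[of _ I] by (rule real_sqrt_le_mono)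
  then show ?thesis by (simp add: real_sqrt_mult)
qed

lemma bdd_above_op_norm:
  "bdd_above ((\<lambda>x. L2_set (\<lambda>i. \<Sum>j\<in>J. M i j * x j) I) ` {x. L2_set x J \<le> 1})"
proof (rule bdd_aboveI2)
  fix x assume x: "x \<in> {x. L2_set x J \<le> 1}"
  have "sqrt (frob2 I J M) * L2_set x J \<le> sqrt (frob2 I J M) * 1"
    using x by (intro mult_left_mono) auto
  then show "L2_set (\<lambda>i. \<Sum>j\<in>J. M i j * x j) I \<le> sqrt (frob2 I J M)"
    using L2_set_mv_le_frob[where J=J and M=M and x=x and I=I] by simp
qed

lemma op_norm_nonneg [simp]: "0 \<le> op_norm I J M"
proof -
  have "L2_set (\<lambda>i. \<Sum>j\<in>J. M i j * 0) I \<le> op_norm I J M"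
    unfolding op_norm_def
    by (rule cSUP_upper2[OF bdd_above_op_norm, of "\<lambda>_. 0"]) (auto simp: L2_set_0')
  then show ?thesis by (simp add: L2_set_0')
qed

lemma op_norm_bound: "finite J \<Longrightarrow> L2_set (\<lambda>i. \<Sum>j\<in>J. M i j * x j) I \<le> op_norm I J M * L2_set x J"
proof (cases "L2_set x J = 0")
  case True
  assume "finite J"
  with True have "\<forall>j\<in>J. x j = 0" by (simp add: L2_set_eq_0_iff)
  then have "L2_set (\<lambda>i. \<Sum>j\<in>J. M i j * x j) I = 0"
    by (intro L2_set_0') auto
  then show ?thesis using True by simp
next
  case False
  define c where "c = L2_set x J"
  have c: "c > 0" using False L2_set_nonneg[of x J] by (simp add: c_def del: L2_set_nonneg)
  have "L2_set (\<lambda>j. (1 / c) * x j) J = 1"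
    using c by (subst L2_set_cmult) (simp add: c_def)
  then have "L2_set (\<lambda>i. \<Sum>j\<in>J. M i j * ((1 / c) * x j)) I \<le> op_norm I J M"
    unfolding op_norm_def by (intro cSUP_upper[OF _ bdd_above_op_norm]) simp
  also have "(\<lambda>i. \<Sum>j\<in>J. M i j * ((1 / c) * x j)) = (\<lambda>i. (1 / c) * (\<Sum>j\<in>J. M i j * x j))"
    by (simp add: sum_distrib_left mult_ac)
  also have "L2_set \<dots> I = (1 / c) * L2_set (\<lambda>i. \<Sum>j\<in>J. M i j * x j) I"
    using c by (subst L2_set_cmult) simp
  finally show ?thesis using c by (simp add: c_def field_simps)
qed

lemma op_norm_leI:
  assumes "\<And>x. L2_set (\<lambda>i. \<Sum>j\<in>J. M i j * x j) I \<le> c * L2_set x J" "0 \<le> c"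
  shows "op_norm I J M \<le> c"
  unfolding op_norm_def
proof (rule cSUP_least)
  show "{x. L2_set x J \<le> 1} \<noteq> {}" by (auto intro: exI[of _ "\<lambda>_. 0"] simp: L2_set_0')
  fix x assume "x \<in> {x. L2_set x J \<le> 1}"
  then have "c * L2_set x J \<le> c * 1" using assms(2) by (intro mult_left_mono) auto
  then show "L2_set (\<lambda>i. \<Sum>j\<in>J. M i j * x j) I \<le> c" using assms(1)[of x] by simp
qed

lemma op_norm_le_frob: "op_norm I J M \<le> sqrt (frob2 I J M)"
  by (rule op_norm_leI) (auto simp: L2_set_mv_le_frob)

lemma op_norm_cong:
  assumes "\<And>i j. i \<in> I \<Longrightarrow> j \<in> J \<Longrightarrow> M i j = N i j"
  shows "op_norm I J M = op_norm I J N"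
  unfolding op_norm_def using assms
  by (intro arg_cong[of _ _ Sup] image_cong refl L2_set_cong sum.cong) auto

lemma op_norm_cmult_le:
  assumes "finite J"
  shows "op_norm I J (\<lambda>i j. c * M i j) \<le> \<bar>c\<bar> * op_norm I J M"
proof (rule op_norm_leI)
  fix x
  have "L2_set (\<lambda>i. \<Sum>j\<in>J. c * M i j * x j) I = \<bar>c\<bar> * L2_set (\<lambda>i. \<Sum>j\<in>J. M i j * x j) I"
    by (subst L2_set_cmult[symmetric]) (simp add: sum_distrib_left mult_ac)
  also have "\<dots> \<le> \<bar>c\<bar> * (op_norm I J M * L2_set x J)"
    using assms by (intro mult_left_mono op_norm_bound) auto
  finally show "L2_set (\<lambda>i. \<Sum>j\<in>J. c * M i j * x j) I \<le> \<bar>c\<bar> * op_norm I J M * L2_set x J"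
    by (simp add: mult_ac)
qed auto

lemma op_norm_sum_le:
  assumes "finite J"
  shows "op_norm I J (\<lambda>i j. \<Sum>k\<in>K. M k i j) \<le> (\<Sum>k\<in>K. op_norm I J (M k))"
proof (rule op_norm_leI)
  fix x
  have "L2_set (\<lambda>i. \<Sum>j\<in>J. (\<Sum>k\<in>K. M k i j) * x j) I =
      L2_set (\<lambda>i. \<Sum>k\<in>K. \<Sum>j\<in>J. M k i j * x j) I"
    by (subst sum.swap) (simp add: sum_distrib_right)
  also have "\<dots> \<le> (\<Sum>k\<in>K. L2_set (\<lambda>i. \<Sum>j\<in>J. M k i j * x j) I)"
    by (rule L2_set_sum_le)
  also have "\<dots> \<le> (\<Sum>k\<in>K. op_norm I J (M k) * L2_set x J)"
    using assms by (intro sum_mono op_norm_bound)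
  finally show "L2_set (\<lambda>i. \<Sum>j\<in>J. (\<Sum>k\<in>K. M k i j) * x j) I \<le> (\<Sum>k\<in>K. op_norm I J (M k)) * L2_set x J"
    by (simp add: sum_distrib_right)
qed (simp add: sum_nonneg)

lemma op_norm_submatrix_le:
  assumes "finite J" "finite I" "I' \<subseteq> I" "J' \<subseteq> J"
  shows "op_norm I' J' M \<le> op_norm I J M"
proof (rule op_norm_leI)
  fix x :: "_ \<Rightarrow> real"
  let ?x = "\<lambda>j. if j \<in> J' then x j else 0"
  have fin: "finite J'" "finite I'" using assms finite_subset by auto
  have s: "(\<Sum>j\<in>J. M i j * ?x j) = (\<Sum>j\<in>J'. M i j * x j)" for i
    using assms by (intro sum.mono_neutral_cong_right) auto
  have "L2_set (\<lambda>i. \<Sum>j\<in>J'. M i j * x j) I' \<le> L2_set (\<lambda>i. \<Sum>j\<in>J'. M i j * x j) I"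
    unfolding L2_set_def using assms by (intro real_sqrt_le_mono sum_mono2) auto
  also have "\<dots> \<le> op_norm I J M * L2_set ?x J"
    using op_norm_bound[OF assms(1), where M=M and I=I and x="?x"] by (simp add: s)
  also have "L2_set ?x J = L2_set x J'"
    unfolding L2_set_def using assms
    by (intro arg_cong[of _ _ sqrt] sum.mono_neutral_cong_right) auto
  finally show "L2_set (\<lambda>i. \<Sum>j\<in>J'. M i j * x j) I' \<le> op_norm I J M * L2_set x J'" .
qed auto

lemma op_norm_extend_le:
  assumes "finite J" "finite I" "I' \<subseteq> I" "J' \<subseteq> J"
    and "\<And>i j. i \<in> I \<Longrightarrow> j \<in> J \<Longrightarrow> i \<notin> I' \<or> j \<notin> J' \<Longrightarrow> M i j = 0"
  shows "op_norm I J M \<le> op_norm I' J' M"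
proof (rule op_norm_leI)
  fix x
  have "L2_set (\<lambda>i. \<Sum>j\<in>J. M i j * x j) I = L2_set (\<lambda>i. \<Sum>j\<in>J'. M i j * x j) I"
    using assms by (intro L2_set_cong refl sum.mono_neutral_right) auto
  also have "\<dots> = L2_set (\<lambda>i. \<Sum>j\<in>J'. M i j * x j) I'"
    unfolding L2_set_def using assms
    by (intro arg_cong[of _ _ sqrt] sum.mono_neutral_right) (auto intro!: sum.neutral)
  also have "\<dots> \<le> op_norm I' J' M * L2_set x J'"
    using assms finite_subset by (intro op_norm_bound) auto
  also have "L2_set x J' \<le> L2_set x J"
    unfolding L2_set_def using assms by (intro real_sqrt_le_mono sum_mono2) auto
  finally show "L2_set (\<lambda>i. \<Sum>j\<in>J. M i j * x j) I \<le> op_norm I' J' M * L2_set x J"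
    by (simp add: mult_left_mono)
qed auto

section \<open>Exponential moments of a quadratic form in signs\<close>

text \<open>The Taylor terms compare one by one, because
  \<open>2 ^ n * fact n \<le> fact (2 * n)\<close>.\<close>

lemma cosh_le_exp_half_square: "cosh (x::real) \<le> exp (x\<^sup>2 / 2)"
proof -
  have "(\<lambda>n. if even n then x ^ n /\<^sub>R fact n else 0) sums cosh x"
    by (rule cosh_converges)
  \<comment> \<open>Grouping the terms in pairs discards the vanishing odd ones.\<close>
  then have "(\<lambda>n. \<Sum>k\<in>{n * 2..<n * 2 + 2}. if even k then x ^ k /\<^sub>R fact k else 0) sums cosh x"
    by (rule sums_group) simp
  moreover have "(\<Sum>k\<in>{n * 2..<n * 2 + 2}. if even k then x ^ k /\<^sub>R fact k else 0)
      = x ^ (2 * n) /\<^sub>R fact (2 * n)" for n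
  proof -
    have "{n * 2..<n * 2 + 2} = {2 * n, Suc (2 * n)}" by auto
    then show ?thesis by simp
  qed
  ultimately have c: "(\<lambda>n. x ^ (2 * n) /\<^sub>R fact (2 * n)) sums cosh x" by simp
  have e: "(\<lambda>n. (x\<^sup>2 / 2) ^ n /\<^sub>R fact n) sums exp (x\<^sup>2 / 2)"
    by (rule exp_converges)
  have "x ^ (2 * n) /\<^sub>R fact (2 * n) \<le> (x\<^sup>2 / 2) ^ n /\<^sub>R fact n" for n
  proof -
    have "2 ^ n * fact n \<le> (fact (2 * n) :: real)"
    proof (induction n)
      case (Suc n)
      have "2 ^ Suc n * fact (Suc n) = (2 * real (Suc n)) * (2 ^ n * fact n :: real)" by simp
      also have "\<dots> \<le> (2 * real (Suc n)) * fact (2 * n)"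
        using Suc by (intro mult_left_mono) auto
      also have "\<dots> \<le> (real (2 * n + 2) * real (2 * n + 1)) * fact (2 * n)"
        by (intro mult_right_mono) (auto simp: field_simps)
      also have "\<dots> = fact (2 * Suc n)" by (simp add: field_simps)
      finally show ?case .
    qed simp
    then have "x ^ (2 * n) / fact (2 * n) \<le> x ^ (2 * n) / (2 ^ n * fact n)"
      by (intro divide_left_mono) (auto simp: power_mult)
    moreover have "(x\<^sup>2 / 2) ^ n / fact n = x ^ (2 * n) / (2 ^ n * fact n)"
      by (simp add: power_divide power_mult)
    ultimately show ?thesis by (simp only: real_scaleR_def divide_inverse_commute[symmetric])
  qed
  then show ?thesis by (rule sums_le[OF _ c e])
qed

definition quad_form :: "'i set \<Rightarrow> ('i \<Rightarrow> 'i \<Rightarrow> real) \<Rightarrow> ('i \<Rightarrow> real) \<Rightarrow> real" where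
  "quad_form J K x = (\<Sum>s\<in>J. \<Sum>t\<in>J. K s t * x s * x t)"

lemma quad_form_insert:
  assumes "finite J" "i \<notin> J" "\<And>s. s \<in> J \<Longrightarrow> K s i = K i s"
  shows "quad_form (insert i J) K x =
    K i i * (x i)\<^sup>2 + 2 * x i * (\<Sum>t\<in>J. K i t * x t) + quad_form J K x"
proof -
  have "quad_form (insert i J) K x =
      K i i * x i * x i + (\<Sum>t\<in>J. K i t * x i * x t) +
      ((\<Sum>s\<in>J. K s i * x s * x i) + quad_form J K x)"
    using assms(1,2) by (simp add: quad_form_def sum.distrib)
  also have "(\<Sum>s\<in>J. K s i * x s * x i) = (\<Sum>t\<in>J. K i t * x i * x t)"
    using assms(3) by (intro sum.cong) auto
  also have "(\<Sum>t\<in>J. K i t * x i * x t) = x i * (\<Sum>t\<in>J. K i t * x t)"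
    by (simp add: sum_distrib_left mult_ac)
  finally show ?thesis by (simp add: power2_eq_square algebra_simps)
qed

lemma quad_form_upd: "i \<notin> J \<Longrightarrow> quad_form J K (x(i := c)) = quad_form J K x"
  unfolding quad_form_def by (intro sum.cong refl) auto

text \<open>Averaging over one sign replaces \<open>K\<close> by \<open>K' = K + 2 b b\<^sup>T\<close> on the remaining signs, where \<open>b\<close> is
  the removed row. This is dominated by the Schur complement, so \<open>K' \<le> 1/4\<close> persists, and
  \<open>b\<^sup>T b \<le> K\<^sub>i\<^sub>i / 4\<close> controls the growth of the trace.\<close>

lemma sign_avg_exp_quad_form:
  assumes "finite J"
    and "\<And>s t. s \<in> J \<Longrightarrow> t \<in> J \<Longrightarrow> K s t = K t s"
    and "\<And>x. 0 \<le> quad_form J K x"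
    and "\<And>x. quad_form J K x \<le> (\<Sum>t\<in>J. (x t)\<^sup>2) / 4"
  shows "sign_avg J (\<lambda>\<xi>. exp (quad_form J K \<xi>)) \<xi> \<le> exp (2 * (\<Sum>t\<in>J. K t t))"
  using assms
proof (induction J arbitrary: K \<xi> rule: finite_induct)
  case empty
  then show ?case by (simp add: quad_form_def)
next
  case (insert i J)
  note ins = insert.hyps
  define b where "b x = (\<Sum>t\<in>J. K i t * x t)" for x
  define K' where "K' s t = K s t + 2 * K i s * K i t" for s t
  have qi: "quad_form (insert i J) K x = K i i * (x i)\<^sup>2 + 2 * x i * b x + quad_form J K x" for x
    unfolding b_def using ins insert.prems(1) by (intro quad_form_insert) auto
  have qi': "quad_form (insert i J) K (x(i := c)) = K i i * c\<^sup>2 + 2 * c * b x + quad_form J K x" for x c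
  proof -
    have "b (x(i := c)) = b x" unfolding b_def using ins(2) by (intro sum.cong refl) auto
    then show ?thesis unfolding qi quad_form_upd[OF ins(2)] by simp
  qed
  have ni': "(\<Sum>t\<in>insert i J. ((x(i := c)) t)\<^sup>2) = c\<^sup>2 + (\<Sum>t\<in>J. (x t)\<^sup>2)" for x :: "'a \<Rightarrow> real" and c
    using ins by (simp, intro sum.cong) auto
  have q': "quad_form J K' x = quad_form J K x + 2 * (b x)\<^sup>2" for x
    unfolding quad_form_def K'_def b_def power2_eq_square sum_product
    by (simp add: sum.distrib algebra_simps sum_distrib_left)
  have Kii: "0 \<le> K i i"
    using insert.prems(2)[of "(\<lambda>_. 0)(i := 1)"] unfolding qi' by (simp add: b_def quad_form_def)
  have low: "0 \<le> K i i * c\<^sup>2 + 2 * c * b x + quad_form J K x" for c x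
    using insert.prems(2)[of "x(i := c)"] unfolding qi' .
  have upp: "K i i * c\<^sup>2 + 2 * c * b x + quad_form J K x \<le> (c\<^sup>2 + (\<Sum>t\<in>J. (x t)\<^sup>2)) / 4" for c x
    using insert.prems(3)[of "x(i := c)"] unfolding qi' ni' .
  have "sign_avg J (\<lambda>\<xi>. exp (quad_form J K' \<xi>)) \<xi> \<le> exp (2 * (\<Sum>t\<in>J. K' t t))"
  proof (rule insert.IH)
    fix s t assume "s \<in> J" "t \<in> J"
    then show "K' s t = K' t s" using insert.prems(1)[of s t] by (simp add: K'_def)
  next
    fix x
    show "0 \<le> quad_form J K' x" using low[of 0 x] by (simp add: q')
    show "quad_form J K' x \<le> (\<Sum>t\<in>J. (x t)\<^sup>2) / 4"
    proof -
      have "K i i * (2 * b x)\<^sup>2 + 2 * (2 * b x) * b x = 4 * (K i i * (b x)\<^sup>2) + 4 * (b x)\<^sup>2"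
        "(2 * b x)\<^sup>2 = 4 * (b x)\<^sup>2"
        by (simp_all add: power2_eq_square)
      \<comment> \<open>The upper bound is evaluated at \<open>c = 2 * b x\<close>. After the
        right-hand \<open>(b x)\<^sup>2\<close> is subtracted, at least
        \<open>3 * (b x)\<^sup>2\<close> remains beside the old form, which covers the
        \<open>2 * (b x)\<^sup>2\<close> added by \<open>K'\<close>.\<close>
      then have "4 * (K i i * (b x)\<^sup>2) + 4 * (b x)\<^sup>2 + quad_form J K x \<le> (4 * (b x)\<^sup>2 + (\<Sum>t\<in>J. (x t)\<^sup>2)) / 4"
        using upp[of "2 * b x" x] by (simp only:)
      moreover obtain u v where uv: "u = K i i * (b x)\<^sup>2" "v = (b x)\<^sup>2" by blast
      moreover have "0 \<le> u" "0 \<le> v" using Kii by (simp_all add: uv)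
      ultimately show ?thesis unfolding q' uv[symmetric] by simp
    qed
  qed
  moreover have "(\<Sum>t\<in>J. K' t t) \<le> (\<Sum>t\<in>J. K t t) + K i i / 2"
  proof -
    have bb: "b (K i) = (\<Sum>t\<in>J. (K i t)\<^sup>2)" by (simp add: b_def power2_eq_square)
    have "(\<Sum>t\<in>J. K' t t) = (\<Sum>t\<in>J. K t t) + 2 * b (K i)"
      by (simp add: K'_def bb sum.distrib sum_distrib_left power2_eq_square mult_ac)
    \<comment> \<open>The test vector is the removed row itself, for which \<open>b (K i)\<close> is
      the squared length of that row. The lower bound at \<open>c = -1/4\<close> and the upper bound
      at \<open>c = 0\<close> eliminate the unknown value of the quadratic form.\<close>
    moreover have "b (K i) \<le> K i i / 4"
      using low[of "-1/4" "K i"] upp[of 0 "K i"] by (simp add: bb power2_eq_square field_simps)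
    ultimately show ?thesis by simp
  qed
  ultimately have IH: "sign_avg J (\<lambda>\<xi>. exp (quad_form J K' \<xi>)) \<xi> \<le> exp (2 * (\<Sum>t\<in>J. K t t) + K i i)"
    by (elim order_trans) simp
  have "sign_avg (insert i J) (\<lambda>\<xi>. exp (quad_form (insert i J) K \<xi>)) \<xi> =
      sign_avg J (\<lambda>\<xi>. exp (K i i) * (exp (quad_form J K \<xi>) * cosh (2 * b \<xi>))) \<xi>"
  proof -
    have "sign_avg (insert i J) (\<lambda>\<xi>. exp (quad_form (insert i J) K \<xi>)) \<xi> =
        (1 / 2) * sign_avg J (\<lambda>\<xi>. exp (K i i * 1\<^sup>2 + 2 * 1 * b \<xi> + quad_form J K \<xi>)
          + exp (K i i * (-1)\<^sup>2 + 2 * (-1) * b \<xi> + quad_form J K \<xi>)) \<xi>"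
      unfolding sign_avg_insert[OF ins(1,2)] qi' sign_avg_add by simp
    also have "\<dots> = sign_avg J (\<lambda>\<xi>. exp (K i i) * (exp (quad_form J K \<xi>) * cosh (2 * b \<xi>))) \<xi>"
      unfolding sign_avg_cmult[symmetric]
      by (intro sign_avg_cong) (simp add: cosh_field_def exp_add exp_diff exp_minus field_simps)
    finally show ?thesis .
  qed
  also have "\<dots> \<le> sign_avg J (\<lambda>\<xi>. exp (K i i) * exp (quad_form J K' \<xi>)) \<xi>"
  proof (intro sign_avg_mono mult_left_mono)
    fix \<xi>' :: "'a \<Rightarrow> real"
    have "cosh (2 * b \<xi>') \<le> exp (2 * (b \<xi>')\<^sup>2)"
      using cosh_le_exp_half_square[of "2 * b \<xi>'"] by (simp add: power_mult_distrib)
    then show "exp (quad_form J K \<xi>') * cosh (2 * b \<xi>') \<le> exp (quad_form J K' \<xi>')"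
      by (simp add: q' exp_add)
  qed auto
  also have "\<dots> = exp (K i i) * sign_avg J (\<lambda>\<xi>. exp (quad_form J K' \<xi>)) \<xi>"
    by (rule sign_avg_cmult)
  also have "\<dots> \<le> exp (K i i) * exp (2 * (\<Sum>t\<in>J. K t t) + K i i)"
    using IH by simp
  also have "\<dots> = exp (2 * (\<Sum>t\<in>insert i J. K t t))"
    using ins by (simp add: exp_add[symmetric] algebra_simps)
  finally show ?case .
qed

text \<open>The kernel is the Gram matrix of the coefficients: it is positive semidefinite by
  construction, the hypothesis says that the coefficient matrix has operator norm at most 1/2, and
  the trace in the conclusion is its squared Frobenius norm.\<close>

lemma sign_avg_exp_sum_squares:
  assumes "finite J"
    and "\<And>x. (\<Sum>c\<in>C. (\<Sum>t\<in>J. a c t * x t)\<^sup>2) \<le> (\<Sum>t\<in>J. (x t)\<^sup>2) / 4"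
  shows "sign_avg J (\<lambda>\<xi>. exp (\<Sum>c\<in>C. (\<Sum>t\<in>J. a c t * \<xi> t)\<^sup>2)) \<xi> \<le> exp (2 * (\<Sum>t\<in>J. \<Sum>c\<in>C. (a c t)\<^sup>2))"
proof -
  define K where "K s t = (\<Sum>c\<in>C. a c s * a c t)" for s t
  have q: "(\<Sum>c\<in>C. (\<Sum>t\<in>J. a c t * x t)\<^sup>2) = quad_form J K x" for x
  proof -
    have "(\<Sum>c\<in>C. (\<Sum>t\<in>J. a c t * x t)\<^sup>2) = (\<Sum>c\<in>C. \<Sum>s\<in>J. \<Sum>t\<in>J. a c s * a c t * x s * x t)"
      by (simp add: power2_eq_square sum_product mult_ac)
    also have "\<dots> = (\<Sum>s\<in>J. \<Sum>t\<in>J. \<Sum>c\<in>C. a c s * a c t * x s * x t)"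
      by (subst sum.swap, intro sum.cong refl, subst sum.swap) simp
    finally show ?thesis by (simp add: quad_form_def K_def sum_distrib_right)
  qed
  have "sign_avg J (\<lambda>\<xi>. exp (quad_form J K \<xi>)) \<xi> \<le> exp (2 * (\<Sum>t\<in>J. K t t))"
  proof (rule sign_avg_exp_quad_form)
    show "K s t = K t s" for s t by (simp add: K_def mult.commute)
    show "0 \<le> quad_form J K x" for x unfolding q[symmetric] by (simp add: sum_nonneg)
    show "quad_form J K x \<le> (\<Sum>t\<in>J. (x t)\<^sup>2) / 4" for x using assms(2)[of x] unfolding q .
  qed (rule assms)
  then show ?thesis unfolding q by (simp add: K_def power2_eq_square)
qed

section \<open>Norm of a random rectangular block\<close>

text \<open>The net is the integer lattice scaled by \<open>1 / s\<close> with
  \<open>s = 2 * sqrt m\<close>, cut to the ball of radius 2. Rounding moves each coordinate by at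
  most \<open>1 / (4 * sqrt m)\<close>, hence a vector by at most 1/4. Only the exponential size in
  the dimension matters; the constant 18 is not optimised.\<close>

lemma ex_unit_ball_net:
  fixes S :: "'s set"
  assumes "finite S"
  obtains G :: "('s \<Rightarrow> real) set"
  where "finite G" "G \<noteq> {}" "card G \<le> 2 ^ (18 * card S)" "\<And>z. z \<in> G \<Longrightarrow> (\<Sum>y\<in>S. (z y)\<^sup>2) \<le> 4"
    "\<And>u. L2_set u S \<le> 1 \<Longrightarrow> \<exists>z\<in>G. L2_set (\<lambda>y. u y - z y) S \<le> 1 / 2"
proof -
  define m where "m = card S"
  define s where "s = 2 * sqrt (real m)"
  define P where "P = {k \<in> S \<rightarrow>\<^sub>E (UNIV::int set). (\<Sum>y\<in>S. (k y)\<^sup>2) \<le> 16 * int m}"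
  define N where "N = 16 * int m"
  have abs_le_sq: "\<bar>k\<bar> \<le> k\<^sup>2" for k :: int
  proof (cases "k = 0")
    case False
    then have "\<bar>k\<bar> * 1 \<le> \<bar>k\<bar> * \<bar>k\<bar>" by (intro mult_left_mono) auto
    then show ?thesis by (simp add: power2_eq_square)
  qed simp
  have sub: "P \<subseteq> S \<rightarrow>\<^sub>E {-N..N}"
  proof
    fix k assume k: "k \<in> P"
    have "\<bar>k y\<bar> \<le> N" if "y \<in> S" for y
    proof -
      have "(k y)\<^sup>2 \<le> (\<Sum>y\<in>S. (k y)\<^sup>2)" using that assms by (intro member_le_sum) auto
      then show ?thesis using k abs_le_sq[of "k y"] by (simp add: P_def N_def)
    qed
    then show "k \<in> S \<rightarrow>\<^sub>E {-N..N}" using k unfolding P_def PiE_iff by (auto simp: abs_le_iff minus_le_iff)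
  qed
  have finP: "finite P" using assms by (intro finite_subset[OF sub] finite_PiE) auto
  have geo: "(\<Sum>k=-int n..int n. (1/2::real) ^ nat \<bar>k\<bar>) \<le> 3 - 2 * (1/2) ^ n" for n
  proof (induction n)
    case (Suc n)
    have "{- int (Suc n)..int (Suc n)} = insert (int (Suc n)) (insert (- int (Suc n)) {-int n..int n})"
      by auto
    then have "(\<Sum>k=-int (Suc n)..int (Suc n). (1/2::real) ^ nat \<bar>k\<bar>) =
       (1/2) ^ Suc n + (1/2) ^ Suc n + (\<Sum>k=-int n..int n. (1/2::real) ^ nat \<bar>k\<bar>)"
      by (simp add: nat_add_distrib)
    then show ?case using Suc by simp
  qed simp
  have geo': "(\<Sum>k=-N..N. (1/2::real) ^ nat \<bar>k\<bar>) \<le> 3"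
  proof -
    have "(\<Sum>k=-N..N. (1/2::real) ^ nat \<bar>k\<bar>) \<le> 3 - 2 * (1/2) ^ nat N"
      using geo[of "nat N"] by (simp add: N_def)
    also have "\<dots> \<le> 3" by simp
    finally show ?thesis .
  qed
  \<comment> \<open>Counting by a generating function: lattice points in the cut ball have absolute
    coordinate sum at most \<open>16 * m\<close>, so each has weight at least 1 here. The total
    weight factorises over the coordinates, and each factor is at most 3, rounded up to
    \<open>2 ^ 2\<close>; this gives the exponent 16 + 2.\<close>
  have one: "1 \<le> 2 ^ (16 * m) * (\<Prod>y\<in>S. (1/2::real) ^ nat \<bar>k y\<bar>)" if "k \<in> P" for k
  proof -
    have "int (\<Sum>y\<in>S. nat \<bar>k y\<bar>) = (\<Sum>y\<in>S. \<bar>k y\<bar>)" by simp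
    also have "\<dots> \<le> (\<Sum>y\<in>S. (k y)\<^sup>2)" by (intro sum_mono abs_le_sq)
    also have "\<dots> \<le> int (16 * m)" using that by (simp add: P_def)
    finally have "(\<Sum>y\<in>S. nat \<bar>k y\<bar>) \<le> 16 * m" by (simp only: of_nat_le_iff)
    then have "(1/2::real) ^ (16 * m) \<le> (1/2) ^ (\<Sum>y\<in>S. nat \<bar>k y\<bar>)"
      by (intro power_decreasing) auto
    then show ?thesis by (simp add: power_sum power_divide field_simps)
  qed
  have "real (card P) = (\<Sum>k\<in>P. 1)" by simp
  also have "\<dots> \<le> (\<Sum>k\<in>P. 2 ^ (16 * m) * (\<Prod>y\<in>S. (1/2::real) ^ nat \<bar>k y\<bar>))"
    by (intro sum_mono one)
  also have "\<dots> \<le> (\<Sum>k\<in>S \<rightarrow>\<^sub>E {-N..N}. 2 ^ (16 * m) * (\<Prod>y\<in>S. (1/2::real) ^ nat \<bar>k y\<bar>))"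
    using sub assms by (intro sum_mono2 finite_PiE) (auto intro!: prod_nonneg mult_nonneg_nonneg)
  also have "\<dots> = 2 ^ (16 * m) * (\<Prod>y\<in>S. \<Sum>k=-N..N. (1/2::real) ^ nat \<bar>k\<bar>)"
    using assms by (subst prod_sum_PiE) (auto simp: sum_distrib_left)
  also have "\<dots> \<le> 2 ^ (16 * m) * (\<Prod>y\<in>S. 4)"
    using geo' by (intro mult_left_mono prod_mono) (auto intro!: sum_nonneg)
  also have "\<dots> = 2 ^ (16 * m) * (2 ^ 2) ^ m" by (simp add: m_def)
  also have "\<dots> = 2 ^ (16 * m + 2 * m)" by (simp only: power_add power_mult)
  finally have "real (card P) \<le> real (2 ^ (18 * m))" by simp
  then have cardP: "card P \<le> 2 ^ (18 * m)" by (simp only: of_nat_le_iff)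
  define G where "G = (\<lambda>k y. real_of_int (k y) / s) ` P"
  show thesis
  proof
    show "finite G" using finP by (simp add: G_def)
    have "(\<lambda>y\<in>S. 0) \<in> P" by (simp add: P_def)
    then show "G \<noteq> {}" by (auto simp: G_def)
    show "card G \<le> 2 ^ (18 * card S)"
      using cardP card_image_le[OF finP, of "\<lambda>k y. real_of_int (k y) / s"] by (simp add: G_def m_def)
  next
    fix z assume "z \<in> G"
    then obtain k where k: "k \<in> P" "z = (\<lambda>y. real_of_int (k y) / s)" by (auto simp: G_def)
    show "(\<Sum>y\<in>S. (z y)\<^sup>2) \<le> 4"
    proof (cases "m = 0")
      case True
      then show ?thesis using assms by (simp add: m_def)
    next
      case False
      have "real_of_int (\<Sum>y\<in>S. (k y)\<^sup>2) \<le> real_of_int (16 * int m)"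
        using k by (simp only: of_int_le_iff P_def mem_Collect_eq)
      then have "(\<Sum>y\<in>S. (real_of_int (k y))\<^sup>2) / s\<^sup>2 \<le> 16 * real m / s\<^sup>2"
        by (intro divide_right_mono) auto
      then show ?thesis using False
        by (simp add: k s_def power_divide power_mult_distrib sum_divide_distrib)
    qed
  next
    fix u :: "'s \<Rightarrow> real" assume u: "L2_set u S \<le> 1"
    define k where "k = (\<lambda>y\<in>S. round (s * u y))"
    define z where "z y = real_of_int (k y) / s" for y
    have "\<exists>z\<in>G. L2_set (\<lambda>y. u y - z y) S \<le> 1 / 2"
    proof (cases "m = 0")
      case True
      then have "S = {}" using assms by (simp add: m_def)
      moreover have "(\<lambda>y\<in>S. 0) \<in> P" by (simp add: P_def)
      ultimately show ?thesis by (auto simp: G_def)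
    next
      case False
      then have s: "s > 0" by (simp add: s_def)
      have s2: "s\<^sup>2 = 4 * real m" by (simp add: s_def power_mult_distrib)
      have diff: "(u y - z y)\<^sup>2 \<le> 1 / (16 * real m)" if "y \<in> S" for y
      proof -
        have "\<bar>real_of_int (k y) - s * u y\<bar> \<le> 1 / 2"
          using that of_int_round_abs_le[of "s * u y"] by (simp add: k_def)
        then have "(real_of_int (k y) - s * u y)\<^sup>2 \<le> (1 / 2)\<^sup>2"
          by (intro power2_le_iff_abs_le[THEN iffD2]) auto
        then have "(real_of_int (k y) - s * u y)\<^sup>2 / s\<^sup>2 \<le> (1 / 2)\<^sup>2 / s\<^sup>2"
          by (intro divide_right_mono) auto
        moreover have "u y - z y = - (real_of_int (k y) - s * u y) / s"
          using s by (simp add: z_def field_simps)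
        ultimately have "(u y - z y)\<^sup>2 \<le> (1 / 2)\<^sup>2 / s\<^sup>2"
          by (simp only: power_divide power2_minus)
        then show ?thesis by (simp add: s2 power_divide)
      qed
      have "(\<Sum>y\<in>S. (u y - z y)\<^sup>2) \<le> (\<Sum>y\<in>S. 1 / (16 * real m))" by (intro sum_mono diff)
      also have "\<dots> = (1 / 4)\<^sup>2" using False by (simp add: m_def power2_eq_square)
      finally have d: "L2_set (\<lambda>y. u y - z y) S \<le> 1 / 4"
        unfolding L2_set_def by (rule real_le_lsqrt[rotated]) auto
      have "L2_set (\<lambda>y. u y + (-1) * (u y - z y)) S \<le> L2_set u S + L2_set (\<lambda>y. (-1) * (u y - z y)) S"
        by (rule L2_set_triangle_ineq)
      also have "\<dots> \<le> 2" using u d by (subst L2_set_cmult) simp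
      finally have "(L2_set z S)\<^sup>2 \<le> 2\<^sup>2" by (intro power_mono) auto
      then have "(\<Sum>y\<in>S. (real_of_int (k y))\<^sup>2) / s\<^sup>2 \<le> 4"
        unfolding L2_set_power2 by (simp add: z_def power_divide sum_divide_distrib)
      then have "(\<Sum>y\<in>S. (real_of_int (k y))\<^sup>2) \<le> 16 * real m"
        using False by (simp add: s2 pos_divide_le_eq)
      then have "real_of_int (\<Sum>y\<in>S. (k y)\<^sup>2) \<le> real_of_int (16 * int m)" by simp
      then have "k \<in> P" unfolding of_int_le_iff by (simp add: P_def k_def)
      then have "z \<in> G" unfolding G_def by (rule image_eqI[rotated]) (simp add: z_def fun_eq_iff)
      then show ?thesis using d by force
    qed
    then show "\<exists>z\<in>G. L2_set (\<lambda>y. u y - z y) S \<le> 1 / 2" .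
  qed
qed

text \<open>The remainder of a unit vector after its net point has norm at most 1/2, so it
  contributes at most half of the operator norm, which is absorbed into the left side. The
  maximising net point depends on \<open>M\<close>.\<close>

lemma op_norm_le_net:
  assumes "finite S" "finite G" "G \<noteq> {}"
    and net: "\<And>u. L2_set u S \<le> 1 \<Longrightarrow> \<exists>z\<in>G. L2_set (\<lambda>y. u y - z y) S \<le> 1 / 2"
  shows "\<exists>z\<in>G. op_norm C S M \<le> 2 * L2_set (\<lambda>c. \<Sum>y\<in>S. M c y * z y) C"
proof -
  define g where "g z = L2_set (\<lambda>c. \<Sum>y\<in>S. M c y * z y) C" for z
  obtain z0 where z0: "z0 \<in> G" "\<And>z. z \<in> G \<Longrightarrow> g z \<le> g z0"
  proof -
    have "Max (g ` G) \<in> g ` G" using assms(2,3) by (intro Max_in) auto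
    then obtain z where "z \<in> G" "Max (g ` G) = g z" by auto
    then show ?thesis using that[of z] assms(2) by (metis Max_ge finite_imageI imageI)
  qed
  have "op_norm C S M \<le> g z0 + op_norm C S M / 2"
    unfolding op_norm_def[of C S M]
  proof (rule cSUP_least, goal_cases)
    case 1
    show ?case by (auto intro: exI[of _ "\<lambda>_. 0"] simp: L2_set_0')
  next
    case (2 u)
    then obtain z where z: "z \<in> G" "L2_set (\<lambda>y. u y - z y) S \<le> 1 / 2" using net by auto
    have "L2_set (\<lambda>c. \<Sum>y\<in>S. M c y * u y) C =
        L2_set (\<lambda>c. (\<Sum>y\<in>S. M c y * z y) + (\<Sum>y\<in>S. M c y * (u y - z y))) C"
      by (simp add: algebra_simps sum_subtractf)
    also have "\<dots> \<le> g z + L2_set (\<lambda>c. \<Sum>y\<in>S. M c y * (u y - z y)) C"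
      unfolding g_def by (rule L2_set_triangle_ineq)
    also have "\<dots> \<le> g z0 + op_norm C S M * L2_set (\<lambda>y. u y - z y) S"
      using z0 z assms(1) by (intro add_mono op_norm_bound) auto
    also have "\<dots> \<le> g z0 + op_norm C S M * (1 / 2)"
      using z by (intro add_left_mono mult_left_mono) auto
    finally show ?case by (simp add: op_norm_def)
  qed
  then show ?thesis using z0 by (intro bexI[of _ z0]) (auto simp: g_def)
qed

text \<open>For a fixed net point the squared length of the image is a quadratic form in independent
  signs. Its exponential moment sees the Frobenius norm through the trace, while the operator norm
  only limits the admissible parameter. The sum over the net therefore charges the number of columns
  to the operator norm alone.\<close>

lemma sign_avg_op_norm_sq_le:
  fixes Y :: "'c \<Rightarrow> 'x \<Rightarrow> real" and e :: "'x \<Rightarrow> 's \<Rightarrow> 'i"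
  assumes fin: "finite X" "finite S" and inj: "inj_on (\<lambda>(x, y). e x y) (X \<times> S)"
    and \<beta>: "0 < \<beta>" "op_norm C X Y \<le> \<beta>"
  shows "sign_avg ((\<lambda>(x, y). e x y) ` (X \<times> S))
      (\<lambda>\<xi>. (op_norm C S (\<lambda>c y. \<Sum>x\<in>X. Y c x * \<xi> (e x y)))\<^sup>2) \<xi>0
    \<le> 32 * frob2 C X Y + 1152 * real (card S) * \<beta>\<^sup>2"
proof -
  define J where "J = (\<lambda>(x, y). e x y) ` (X \<times> S)"
  \<comment> \<open>The largest parameter for which \<open>\<theta> * F z \<xi>\<close> stays below
    a quarter of the squared length of \<xi>, as \<open>F z \<xi>\<close> can reach
    \<open>4 * \<beta>\<^sup>2\<close> times it. Dividing the final exponents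
    \<open>18 * card S\<close> and \<open>8 * \<theta> * frob2 C X Y\<close> by
    \<open>\<theta> / 4\<close> produces 1152 = 18 * 4 * 16 and 32.\<close>
  define \<theta> where "\<theta> = 1 / (16 * \<beta>\<^sup>2)"
  have \<theta>: "\<theta> > 0" using \<beta> by (simp add: \<theta>_def)
  have finJ: "finite J" using fin by (simp add: J_def)
  have sumJ: "(\<Sum>t\<in>J. h t) = (\<Sum>x\<in>X. \<Sum>y\<in>S. h (e x y))" for h :: "'i \<Rightarrow> real"
    unfolding J_def by (subst sum.reindex[OF inj]) (simp add: sum.cartesian_product case_prod_unfold)
  obtain G where G: "finite G" "G \<noteq> {}" "card G \<le> 2 ^ (18 * card S)"
      "\<And>z. z \<in> G \<Longrightarrow> (\<Sum>y\<in>S. (z y)\<^sup>2) \<le> 4"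
      "\<And>u. L2_set u S \<le> 1 \<Longrightarrow> \<exists>z\<in>G. L2_set (\<lambda>y. u y - z y) S \<le> 1 / 2"
    by (rule ex_unit_ball_net[OF fin(2)]) (rule that)
  define N where "N \<xi> = op_norm C S (\<lambda>c y. \<Sum>x\<in>X. Y c x * \<xi> (e x y))" for \<xi> :: "'i \<Rightarrow> real"
  define F where "F z \<xi> = (\<Sum>c\<in>C. (\<Sum>y\<in>S. (\<Sum>x\<in>X. Y c x * \<xi> (e x y)) * z y)\<^sup>2)"
    for z and \<xi> :: "'i \<Rightarrow> real"
  have F0: "0 \<le> F z \<xi>" for z \<xi> by (simp add: F_def sum_nonneg)
  have NF: "\<exists>z\<in>G. (N \<xi>)\<^sup>2 \<le> 4 * F z \<xi>" for \<xi>
  proof -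
    obtain z where z: "z \<in> G" "N \<xi> \<le> 2 * L2_set (\<lambda>c. \<Sum>y\<in>S. (\<Sum>x\<in>X. Y c x * \<xi> (e x y)) * z y) C"
      using op_norm_le_net[OF fin(2) G(1,2,5)] unfolding N_def by blast
    then have "(N \<xi>)\<^sup>2 \<le> (2 * L2_set (\<lambda>c. \<Sum>y\<in>S. (\<Sum>x\<in>X. Y c x * \<xi> (e x y)) * z y) C)\<^sup>2"
      by (intro power_mono) (auto simp: N_def)
    then show ?thesis using z(1) by (auto simp: power_mult_distrib L2_set_power2 F_def)
  qed
  have each: "sign_avg J (\<lambda>\<xi>. exp (\<theta> * F z \<xi>)) \<xi>0 \<le> exp (8 * \<theta> * frob2 C X Y)" if z: "z \<in> G" for z
  proof -
    \<comment> \<open>Recovers the matrix position from the index of its sign, so that the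
      coefficients can be written as functions on \<open>J\<close>.\<close>
    define p where "p = the_inv_into (X \<times> S) (\<lambda>(x, y). e x y)"
    have p: "p (e x y) = (x, y)" if "x \<in> X" "y \<in> S" for x y
      using the_inv_into_f_f[OF inj, of "(x, y)"] that by (simp add: p_def)
    define a where "a c t = sqrt \<theta> * Y c (fst (p t)) * z (snd (p t))" for c t
    have lin: "(\<Sum>t\<in>J. a c t * \<xi> t) = sqrt \<theta> * (\<Sum>y\<in>S. (\<Sum>x\<in>X. Y c x * \<xi> (e x y)) * z y)" for c \<xi>
    proof -
      have "(\<Sum>t\<in>J. a c t * \<xi> t) = (\<Sum>x\<in>X. \<Sum>y\<in>S. sqrt \<theta> * (Y c x * \<xi> (e x y) * z y))"
        unfolding sumJ by (intro sum.cong refl) (simp add: a_def p)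
      also have "\<dots> = sqrt \<theta> * (\<Sum>x\<in>X. \<Sum>y\<in>S. Y c x * \<xi> (e x y) * z y)"
        by (simp add: sum_distrib_left)
      also have "(\<Sum>x\<in>X. \<Sum>y\<in>S. Y c x * \<xi> (e x y) * z y) = (\<Sum>y\<in>S. \<Sum>x\<in>X. Y c x * \<xi> (e x y) * z y)"
        by (rule sum.swap)
      finally show ?thesis by (simp add: sum_distrib_right)
    qed
    have FF: "(\<Sum>c\<in>C. (\<Sum>t\<in>J. a c t * \<xi> t)\<^sup>2) = \<theta> * F z \<xi>" for \<xi>
      using \<theta> by (simp add: lin power_mult_distrib F_def flip: sum_distrib_left)
    have "sign_avg J (\<lambda>\<xi>. exp (\<Sum>c\<in>C. (\<Sum>t\<in>J. a c t * \<xi> t)\<^sup>2)) \<xi>0 \<le> exp (2 * (\<Sum>t\<in>J. \<Sum>c\<in>C. (a c t)\<^sup>2))"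
    proof (rule sign_avg_exp_sum_squares[OF finJ])
      fix \<xi> :: "'i \<Rightarrow> real"
      \<comment> \<open>The sign matrix is first applied to \<open>z\<close>; then
        \<open>F z \<xi>\<close> is the squared length of \<open>Y\<close> applied to
        \<open>w\<close>, and Cauchy-Schwarz with \<open>z\<close> of squared length at most 4
        bounds \<open>w\<close>.\<close>
      define w where "w x = (\<Sum>y\<in>S. \<xi> (e x y) * z y)" for x
      have "F z \<xi> = (\<Sum>c\<in>C. (\<Sum>x\<in>X. Y c x * w x)\<^sup>2)"
        unfolding F_def w_def
        by (intro sum.cong refl arg_cong[of _ _ "\<lambda>x. x\<^sup>2"])
           (simp add: sum_distrib_left sum_distrib_right mult_ac sum.swap[of _ X])
      also have "\<dots> = (L2_set (\<lambda>c. \<Sum>x\<in>X. Y c x * w x) C)\<^sup>2" by (simp add: L2_set_power2)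
      also have "\<dots> \<le> (op_norm C X Y * L2_set w X)\<^sup>2"
        using fin by (intro power_mono op_norm_bound) auto
      also have "\<dots> \<le> (\<beta> * L2_set w X)\<^sup>2"
        using \<beta> by (intro power_mono mult_right_mono) auto
      also have "\<dots> = \<beta>\<^sup>2 * (\<Sum>x\<in>X. (w x)\<^sup>2)" by (simp add: power_mult_distrib L2_set_power2)
      also have "(\<Sum>x\<in>X. (w x)\<^sup>2) \<le> (\<Sum>x\<in>X. (\<Sum>y\<in>S. (\<xi> (e x y))\<^sup>2) * 4)"
      proof (intro sum_mono)
        fix x
        have "(w x)\<^sup>2 \<le> (L2_set (\<lambda>y. \<xi> (e x y)) S * L2_set z S)\<^sup>2"
          unfolding w_def using abs_sum_mult_le_L2[of "\<lambda>y. \<xi> (e x y)" z S]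
          by (simp add: abs_le_square_iff[symmetric])
        also have "\<dots> = (\<Sum>y\<in>S. (\<xi> (e x y))\<^sup>2) * (\<Sum>y\<in>S. (z y)\<^sup>2)"
          by (simp add: power_mult_distrib L2_set_power2)
        also have "\<dots> \<le> (\<Sum>y\<in>S. (\<xi> (e x y))\<^sup>2) * 4"
          using G(4)[OF z] by (intro mult_left_mono) (auto intro: sum_nonneg)
        finally show "(w x)\<^sup>2 \<le> (\<Sum>y\<in>S. (\<xi> (e x y))\<^sup>2) * 4" .
      qed
      also have "(\<Sum>x\<in>X. (\<Sum>y\<in>S. (\<xi> (e x y))\<^sup>2) * 4) = 4 * (\<Sum>t\<in>J. (\<xi> t)\<^sup>2)"
        by (simp add: sumJ sum_distrib_left mult.commute)
      finally have "F z \<xi> \<le> \<beta>\<^sup>2 * (4 * (\<Sum>t\<in>J. (\<xi> t)\<^sup>2))" using \<beta> by simp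
      then have "\<theta> * F z \<xi> \<le> \<theta> * (\<beta>\<^sup>2 * (4 * (\<Sum>t\<in>J. (\<xi> t)\<^sup>2)))"
        using \<theta> by (intro mult_left_mono) auto
      then show "(\<Sum>c\<in>C. (\<Sum>t\<in>J. a c t * \<xi> t)\<^sup>2) \<le> (\<Sum>t\<in>J. (\<xi> t)\<^sup>2) / 4"
        unfolding FF using \<beta> by (simp add: \<theta>_def)
    qed
    also have "(\<Sum>t\<in>J. \<Sum>c\<in>C. (a c t)\<^sup>2) = \<theta> * (frob2 C X Y * (\<Sum>y\<in>S. (z y)\<^sup>2))"
    proof -
      have "(\<Sum>t\<in>J. \<Sum>c\<in>C. (a c t)\<^sup>2) = (\<Sum>x\<in>X. \<Sum>y\<in>S. \<Sum>c\<in>C. \<theta> * ((Y c x)\<^sup>2 * (z y)\<^sup>2))"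
        unfolding sumJ using \<theta> by (intro sum.cong refl) (simp add: a_def p power_mult_distrib)
      also have "\<dots> = (\<Sum>x\<in>X. \<Sum>c\<in>C. \<Sum>y\<in>S. \<theta> * ((Y c x)\<^sup>2 * (z y)\<^sup>2))"
        by (intro sum.cong refl sum.swap)
      also have "\<dots> = (\<Sum>c\<in>C. \<Sum>x\<in>X. \<Sum>y\<in>S. \<theta> * ((Y c x)\<^sup>2 * (z y)\<^sup>2))"
        by (rule sum.swap)
      also have "\<dots> = \<theta> * (\<Sum>c\<in>C. \<Sum>x\<in>X. (Y c x)\<^sup>2 * (\<Sum>y\<in>S. (z y)\<^sup>2))"
        by (simp add: sum_distrib_left)
      finally show ?thesis by (simp add: frob2_def sum_distrib_right)
    qed
    also have "exp (2 * (\<theta> * (frob2 C X Y * (\<Sum>y\<in>S. (z y)\<^sup>2)))) \<le> exp (8 * \<theta> * frob2 C X Y)"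
    proof -
      have "\<theta> * (frob2 C X Y * (\<Sum>y\<in>S. (z y)\<^sup>2)) \<le> \<theta> * (frob2 C X Y * 4)"
        using G(4)[OF z] \<theta> by (intro mult_left_mono) auto
      then show ?thesis by simp
    qed
    finally show ?thesis unfolding FF .
  qed
  have "exp (sign_avg J (\<lambda>\<xi>. \<theta> / 4 * (N \<xi>)\<^sup>2) \<xi>0) \<le> sign_avg J (\<lambda>\<xi>. exp (\<theta> / 4 * (N \<xi>)\<^sup>2)) \<xi>0"
    by (rule exp_sign_avg_le[OF finJ])
  also have "\<dots> \<le> sign_avg J (\<lambda>\<xi>. \<Sum>z\<in>G. exp (\<theta> * F z \<xi>)) \<xi>0"
  proof (intro sign_avg_mono)
    fix \<xi> :: "'i \<Rightarrow> real"
    obtain z where z: "z \<in> G" "(N \<xi>)\<^sup>2 \<le> 4 * F z \<xi>" using NF by blast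
    then have "exp (\<theta> / 4 * (N \<xi>)\<^sup>2) \<le> exp (\<theta> / 4 * (4 * F z \<xi>))"
      using \<theta> by (subst exp_le_cancel_iff, intro mult_left_mono) auto
    also have "\<dots> = exp (\<theta> * F z \<xi>)" by simp
    also have "\<dots> \<le> (\<Sum>z\<in>G. exp (\<theta> * F z \<xi>))" using z G(1) by (intro member_le_sum) auto
    finally show "exp (\<theta> / 4 * (N \<xi>)\<^sup>2) \<le> (\<Sum>z\<in>G. exp (\<theta> * F z \<xi>))" .
  qed
  also have "\<dots> \<le> (\<Sum>z\<in>G. exp (8 * \<theta> * frob2 C X Y))"
    unfolding sign_avg_sum by (intro sum_mono each)
  also have "\<dots> \<le> 2 ^ (18 * card S) * exp (8 * \<theta> * frob2 C X Y)"
  proof -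
    have "real (card G) \<le> 2 ^ (18 * card S)"
      using of_nat_mono[OF G(3), where 'a = real] by simp
    then show ?thesis by simp
  qed
  also have "\<dots> \<le> exp (real (18 * card S)) * exp (8 * \<theta> * frob2 C X Y)"
  proof (intro mult_right_mono)
    have "(2::real) ^ (18 * card S) \<le> exp 1 ^ (18 * card S)"
      using exp_ge_add_one_self[of 1] by (intro power_mono) auto
    then show "(2::real) ^ (18 * card S) \<le> exp (real (18 * card S))"
      by (simp add: exp_of_nat_mult[symmetric])
  qed auto
  finally have *: "\<theta> / 4 * sign_avg J (\<lambda>\<xi>. (N \<xi>)\<^sup>2) \<xi>0 \<le> 18 * real (card S) + 8 * \<theta> * frob2 C X Y"
    by (simp only: sign_avg_cmult exp_add[symmetric] exp_le_cancel_iff)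
  have "\<theta> * sign_avg J (\<lambda>\<xi>. (N \<xi>)\<^sup>2) \<xi>0 \<le> \<theta> * (32 * frob2 C X Y + 1152 * real (card S) * \<beta>\<^sup>2)"
  proof -
    have "\<theta> * (32 * frob2 C X Y + 1152 * real (card S) * \<beta>\<^sup>2) = 4 * (18 * real (card S) + 8 * \<theta> * frob2 C X Y)"
      using \<beta> by (simp add: \<theta>_def field_simps)
    with * show ?thesis by simp
  qed
  then show ?thesis using \<theta> by (simp add: J_def N_def)
qed

section \<open>Weighted columns\<close>

text \<open>A bound that is uniform in the remaining coordinates survives averaging over them. It
  serves to restrict attention to the signs of a subset of the columns.\<close>

lemma sign_avg_subset_le:
  assumes "finite J" "J' \<subseteq> J" "\<And>\<xi>. sign_avg J' f \<xi> \<le> B"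
  shows "sign_avg J f \<xi> \<le> B"
proof -
  have fin: "finite J'" "finite (J - J')" using assms finite_subset by auto
  have "sign_avg ((J - J') \<union> J') f \<xi> = sign_avg (J - J') (sign_avg J' f) \<xi>"
    using fin by (intro sign_avg_Un) auto
  also have "\<dots> \<le> sign_avg (J - J') (\<lambda>_. B) \<xi>"
    by (intro sign_avg_mono assms)
  also have "(J - J') \<union> J' = J" using assms by auto
  finally show ?thesis using fin by simp
qed

lemma op_norm_mult_le:
  assumes "finite X" "finite S"
  shows "op_norm C S (\<lambda>c y. \<Sum>x\<in>X. Y c x * B x y) \<le> op_norm C X Y * op_norm X S B"
proof (rule op_norm_leI)
  fix v
  have "L2_set (\<lambda>c. \<Sum>y\<in>S. (\<Sum>x\<in>X. Y c x * B x y) * v y) C =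
      L2_set (\<lambda>c. \<Sum>x\<in>X. Y c x * (\<Sum>y\<in>S. B x y * v y)) C"
    by (intro L2_set_cong refl)
       (simp add: sum_distrib_left sum_distrib_right mult_ac sum.swap[of _ S X])
  also have "\<dots> \<le> op_norm C X Y * L2_set (\<lambda>x. \<Sum>y\<in>S. B x y * v y) X"
    using assms by (intro op_norm_bound)
  also have "\<dots> \<le> op_norm C X Y * (op_norm X S B * L2_set v S)"
    using assms by (intro mult_left_mono op_norm_bound) auto
  finally show "L2_set (\<lambda>c. \<Sum>y\<in>S. (\<Sum>x\<in>X. Y c x * B x y) * v y) C
      \<le> op_norm C X Y * op_norm X S B * L2_set v S" by (simp add: mult_ac)
qed auto

lemma op_norm_scale_cols_le:
  assumes "finite S" "\<And>y. y \<in> S \<Longrightarrow> \<bar>d y\<bar> \<le> \<kappa>" "0 \<le> \<kappa>"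
  shows "op_norm C S (\<lambda>c y. M c y * d y) \<le> \<kappa> * op_norm C S M"
proof (rule op_norm_leI)
  fix v
  have "L2_set (\<lambda>c. \<Sum>y\<in>S. M c y * d y * v y) C \<le> op_norm C S M * L2_set (\<lambda>y. d y * v y) S"
    using op_norm_bound[OF assms(1), where M = M and I = C and x = "\<lambda>y. d y * v y"] by (simp add: mult_ac)
  also have "\<dots> \<le> op_norm C S M * L2_set (\<lambda>y. \<kappa> * v y) S"
  proof (intro mult_left_mono op_norm_nonneg)
    show "L2_set (\<lambda>y. d y * v y) S \<le> L2_set (\<lambda>y. \<kappa> * v y) S"
      unfolding L2_set_def power_mult_distrib
      by (intro real_sqrt_le_mono sum_mono mult_right_mono)
         (use assms(2,3) in \<open>auto simp: abs_le_square_iff[symmetric]\<close>)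
  qed
  also have "\<dots> = op_norm C S M * (\<kappa> * L2_set v S)" using assms(3) by (subst L2_set_cmult) simp
  finally show "L2_set (\<lambda>c. \<Sum>y\<in>S. M c y * d y * v y) C \<le> \<kappa> * op_norm C S M * L2_set v S"
    by (simp add: mult_ac)
qed (use assms in auto)

text \<open>Square root of the preceding bound with \<beta> the operator norm itself; 6 and 34 round
  up the roots of 32 and 1152. A vanishing \<open>Y\<close> is separated because the exponential
  parameter is a reciprocal of \<beta>.\<close>

lemma sign_avg_op_norm_le:
  fixes Y :: "'c \<Rightarrow> 'x \<Rightarrow> real" and e :: "'x \<Rightarrow> 's \<Rightarrow> 'i"
  assumes fin: "finite X" "finite S" and inj: "inj_on (\<lambda>(x, y). e x y) (X \<times> S)"
  shows "sign_avg ((\<lambda>(x, y). e x y) ` (X \<times> S))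
      (\<lambda>\<xi>. op_norm C S (\<lambda>c y. \<Sum>x\<in>X. Y c x * \<xi> (e x y))) \<xi>0
    \<le> 6 * sqrt (frob2 C X Y) + 34 * sqrt (real (card S)) * op_norm C X Y"
proof (cases "op_norm C X Y = 0")
  case True
  then have "op_norm C S (\<lambda>c y. \<Sum>x\<in>X. Y c x * \<xi> (e x y)) = 0" for \<xi>
    using op_norm_mult_le[OF fin, of C Y "\<lambda>x y. \<xi> (e x y)"]
    by (intro antisym) auto
  then show ?thesis using True fin by simp
next
  case False
  then have \<beta>: "0 < op_norm C X Y" using op_norm_nonneg[of C X Y] by linarith
  let ?J = "(\<lambda>(x, y). e x y) ` (X \<times> S)"
  let ?N = "\<lambda>\<xi>. op_norm C S (\<lambda>c y. \<Sum>x\<in>X. Y c x * \<xi> (e x y))"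
  have "sign_avg ?J ?N \<xi>0 \<le> sqrt (sign_avg ?J (\<lambda>\<xi>. (?N \<xi>)\<^sup>2) \<xi>0)"
    using sign_avg_le_sqrt[of ?J ?N \<xi>0] fin by (intro real_le_rsqrt) auto
  also have "\<dots> \<le> sqrt (32 * frob2 C X Y + 1152 * real (card S) * (op_norm C X Y)\<^sup>2)"
    using sign_avg_op_norm_sq_le[OF fin inj \<beta> order.refl] by (rule real_sqrt_le_mono)
  also have "\<dots> \<le> sqrt (32 * frob2 C X Y) + sqrt (1152 * real (card S) * (op_norm C X Y)\<^sup>2)"
    by (rule sqrt_add_le_add_sqrt) auto
  also have "\<dots> = sqrt 32 * sqrt (frob2 C X Y) + sqrt 1152 * sqrt (real (card S)) * op_norm C X Y"
    by (simp add: real_sqrt_mult)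
  also have "\<dots> \<le> 6 * sqrt (frob2 C X Y) + 34 * sqrt (real (card S)) * op_norm C X Y"
    by (intro add_mono mult_right_mono real_le_lsqrt) auto
  finally show ?thesis .
qed

text \<open>A union bound over all columns at once would multiply both terms by \<open>g\<close>. Splitting the columns
  into dyadic levels of \<open>\<bar>d\<bar>\<close> lets the few heavy columns contribute to the second term only through
  the fourth moment of \<open>d\<close>.\<close>

lemma sign_avg_op_norm_weighted_le:
  fixes Y :: "'c \<Rightarrow> 'x \<Rightarrow> real" and e :: "'x \<Rightarrow> 's \<Rightarrow> 'i" and d :: "'s \<Rightarrow> real"
  assumes fin: "finite C" "finite X" "finite S" and inj: "inj_on (\<lambda>(x, y). e x y) (X \<times> S)"
    and \<delta>: "0 < \<delta>" and g: "\<And>y. y \<in> S \<Longrightarrow> \<bar>d y\<bar> \<le> g" "0 \<le> g"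
  shows "sign_avg ((\<lambda>(x, y). e x y) ` (X \<times> S))
      (\<lambda>\<xi>. op_norm C S (\<lambda>c y. (\<Sum>x\<in>X. Y c x * \<xi> (e x y)) * d y)) \<xi>0
    \<le> 24 * (\<delta> + g) * sqrt (frob2 C X Y) +
      136 * (\<delta> * sqrt (real (card S)) + sqrt (\<Sum>y\<in>S. d y ^ 4) / \<delta>) * op_norm C X Y"
proof (cases "S = {}")
  case True
  have "op_norm C {} M = 0" for M :: "'c \<Rightarrow> 's \<Rightarrow> real"
    using op_norm_le_frob[of C "{}" M] op_norm_nonneg[of C "{}" M] by (simp add: frob2_def)
  then show ?thesis using True \<delta> g(2) by (simp add: mult_nonneg_nonneg)
next
  case False
  define J where "J = (\<lambda>(x, y). e x y) ` (X \<times> S)"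
  \<comment> \<open>Level 0 collects the columns with weight below \<delta>; level
    \<open>Suc s\<close> those with weight between \<open>\<delta> * 2 ^ s\<close> and twice
    that.\<close>
  define lev where "lev y = (LEAST s. \<bar>d y\<bar> < \<delta> * 2 ^ s)" for y
  have ex: "\<exists>s. \<bar>d y\<bar> < \<delta> * 2 ^ s" for y
  proof -
    obtain s where "\<bar>d y\<bar> / \<delta> < 2 ^ s" using real_arch_pow[of 2 "\<bar>d y\<bar> / \<delta>"] by auto
    then show ?thesis using \<delta> by (auto simp: field_simps)
  qed
  have lev_upper: "\<bar>d y\<bar> < \<delta> * 2 ^ lev y" for y
    unfolding lev_def by (rule LeastI_ex[OF ex])
  have lev_lower: "\<delta> * 2 ^ s \<le> \<bar>d y\<bar>" if "lev y = Suc s" for y s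
    using not_less_Least[of s "\<lambda>s. \<bar>d y\<bar> < \<delta> * 2 ^ s"] that unfolding lev_def by (simp add: not_less)
  define S' where "S' s = {y \<in> S. lev y = s}" for s
  define K where "K = Max (lev ` S)"
  have levK: "lev y \<le> K" if "y \<in> S" for y
    unfolding K_def using fin that by (intro Max_ge) auto
  have "K \<in> lev ` S" unfolding K_def using fin False by (intro Max_in) auto
  then obtain y0 where y0: "y0 \<in> S" "lev y0 = K" by auto
  have finS': "finite (S' s)" for s using fin by (simp add: S'_def)
  define D4 where "D4 = (\<Sum>y\<in>S. d y ^ 4)"
  have D4: "0 \<le> D4" by (simp add: D4_def sum_nonneg)
  define F where "F = sqrt (frob2 C X Y)"
  define \<beta> where "\<beta> = op_norm C X Y"
  define M where "M \<xi> c y = (\<Sum>x\<in>X. Y c x * \<xi> (e x y))" for \<xi> c y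
  have split: "op_norm C S (\<lambda>c y. M \<xi> c y * d y) \<le> (\<Sum>s\<le>K. \<delta> * 2 ^ s * op_norm C (S' s) (M \<xi>))" for \<xi>
  proof -
    have "op_norm C S (\<lambda>c y. M \<xi> c y * d y) =
        op_norm C S (\<lambda>c y. \<Sum>s\<le>K. if lev y = s then M \<xi> c y * d y else 0)"
      using levK by (intro op_norm_cong) simp
    also have "\<dots> \<le> (\<Sum>s\<le>K. op_norm C S (\<lambda>c y. if lev y = s then M \<xi> c y * d y else 0))"
      using fin by (intro op_norm_sum_le)
    also have "\<dots> \<le> (\<Sum>s\<le>K. \<delta> * 2 ^ s * op_norm C (S' s) (M \<xi>))"
    proof (intro sum_mono)
      fix s
      have "op_norm C S (\<lambda>c y. if lev y = s then M \<xi> c y * d y else 0) \<le>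
          op_norm C (S' s) (\<lambda>c y. if lev y = s then M \<xi> c y * d y else 0)"
        using fin by (intro op_norm_extend_le) (auto simp: S'_def)
      also have "\<dots> = op_norm C (S' s) (\<lambda>c y. M \<xi> c y * d y)"
        by (intro op_norm_cong) (auto simp: S'_def)
      also have "\<dots> \<le> \<delta> * 2 ^ s * op_norm C (S' s) (M \<xi>)"
        using lev_upper \<delta> by (intro op_norm_scale_cols_le finS') (auto simp: S'_def less_imp_le)
      finally show "op_norm C S (\<lambda>c y. if lev y = s then M \<xi> c y * d y else 0)
          \<le> \<delta> * 2 ^ s * op_norm C (S' s) (M \<xi>)" .
    qed
    finally show ?thesis .
  qed
  have each: "sign_avg J (\<lambda>\<xi>. op_norm C (S' s) (M \<xi>)) \<xi>0 \<le> 6 * F + 34 * sqrt (real (card (S' s))) * \<beta>" for s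
    unfolding M_def F_def \<beta>_def
  proof (rule sign_avg_subset_le)
    show "finite J" using fin by (simp add: J_def)
    show "(\<lambda>(x, y). e x y) ` (X \<times> S' s) \<subseteq> J" by (auto simp: J_def S'_def)
    show "sign_avg ((\<lambda>(x, y). e x y) ` (X \<times> S' s))
        (\<lambda>\<xi>. op_norm C (S' s) (\<lambda>c y. \<Sum>x\<in>X. Y c x * \<xi> (e x y))) \<xi>
      \<le> 6 * sqrt (frob2 C X Y) + 34 * sqrt (real (card (S' s))) * op_norm C X Y" for \<xi>
      by (intro sign_avg_op_norm_le fin finS' inj_on_subset[OF inj]) (auto simp: S'_def)
  qed
  \<comment> \<open>A geometric sum is dominated by its last term. The top level is inhabited by
    \<open>y0\<close>, whose weight is at most \<open>g\<close>, so the sum is at most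
    \<open>4 * g\<close> unless only level 0 occurs.\<close>
  have sum1: "(\<Sum>s\<le>K. \<delta> * 2 ^ s) \<le> 4 * (\<delta> + g)"
  proof -
    have "(\<Sum>s\<le>K. (2::real) ^ s) \<le> 2 * 2 ^ K" by (induction K) auto
    then have "(\<Sum>s\<le>K. \<delta> * 2 ^ s) \<le> \<delta> * (2 * 2 ^ K)"
      using \<delta> by (simp flip: sum_distrib_left)
    also have "\<dots> \<le> 4 * (\<delta> + g)"
    proof (cases K)
      case 0
      then show ?thesis using \<delta> g(2) by simp
    next
      case (Suc K')
      then show ?thesis using lev_lower[of y0 K'] y0 g(1)[of y0] \<delta> by simp
    qed
    finally show ?thesis .
  qed
  have sum2: "(\<Sum>s\<le>K. \<delta> * 2 ^ s * sqrt (real (card (S' s)))) \<le> \<delta> * sqrt (real (card S)) + 4 * sqrt D4 / \<delta>"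
  proof -
    \<comment> \<open>Markov's inequality for fourth powers bounds the size of the level by
      \<open>D4 / (\<delta> * 2 ^ s') ^ 4\<close>. Its square root falls like
      \<open>4 ^ (- s')\<close> while the weight grows like \<open>2 ^ s'\<close>, so the levels sum
      geometrically.\<close>
    have lvl: "\<delta> * 2 ^ s * sqrt (real (card (S' s))) \<le> 4 * sqrt D4 / \<delta> * (1 / 2) ^ s" if s: "s = Suc s'" for s s'
    proof -
      have "real (card (S' s)) * (\<delta> * 2 ^ s') ^ 4 = (\<Sum>y\<in>S' s. (\<delta> * 2 ^ s') ^ 4)" by simp
      also have "\<dots> \<le> (\<Sum>y\<in>S' s. d y ^ 4)"
      proof (intro sum_mono)
        fix y assume "y \<in> S' s"
        then have "(\<delta> * 2 ^ s') ^ 4 \<le> \<bar>d y\<bar> ^ 4"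
          using \<delta> lev_lower[of y s'] s by (intro power_mono) (auto simp: S'_def)
        then show "(\<delta> * 2 ^ s') ^ 4 \<le> d y ^ 4" by simp
      qed
      also have "\<dots> \<le> D4" unfolding D4_def using fin by (intro sum_mono2) (auto simp: S'_def)
      finally have "sqrt (real (card (S' s)) * ((\<delta> * 2 ^ s')\<^sup>2)\<^sup>2) \<le> sqrt D4"
        by (intro real_sqrt_le_mono) (simp flip: power_mult)
      then have "sqrt (real (card (S' s))) * (\<delta> * 2 ^ s')\<^sup>2 \<le> sqrt D4"
        by (simp only: real_sqrt_mult real_sqrt_abs abs_power2)
      then have "sqrt (real (card (S' s))) * (\<delta> * 2 ^ s')\<^sup>2 / (\<delta> * 2 ^ s') * 2 \<le> sqrt D4 / (\<delta> * 2 ^ s') * 2"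
        using \<delta> by (intro mult_right_mono divide_right_mono) auto
      then show ?thesis using \<delta> by (simp add: s power2_eq_square power_divide field_simps)
    qed
    have half: "(\<Sum>s\<in>{1..K}. (1 / 2 :: real) ^ s) \<le> 1"
    proof -
      have "(\<Sum>s\<in>{1..K}. (1 / 2 :: real) ^ s) = 1 - (1 / 2) ^ K" by (induction K) auto
      then show ?thesis by simp
    qed
    have "{..K} = insert 0 {1..K}" by auto
    then have "(\<Sum>s\<le>K. \<delta> * 2 ^ s * sqrt (real (card (S' s)))) =
        \<delta> * sqrt (real (card (S' 0))) + (\<Sum>s\<in>{1..K}. \<delta> * 2 ^ s * sqrt (real (card (S' s))))"
      by simp
    also have "\<dots> \<le> \<delta> * sqrt (real (card S)) + (\<Sum>s\<in>{1..K}. 4 * sqrt D4 / \<delta> * (1 / 2) ^ s)"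
    proof (intro add_mono sum_mono)
      have "card (S' 0) \<le> card S" using fin by (intro card_mono) (auto simp: S'_def)
      then show "\<delta> * sqrt (real (card (S' 0))) \<le> \<delta> * sqrt (real (card S))"
        using \<delta> by (intro mult_left_mono) auto
    next
      fix s assume "s \<in> {1..K}"
      then show "\<delta> * 2 ^ s * sqrt (real (card (S' s))) \<le> 4 * sqrt D4 / \<delta> * (1 / 2) ^ s"
        using lvl[of s "s - 1"] by simp
    qed
    also have "(\<Sum>s\<in>{1..K}. 4 * sqrt D4 / \<delta> * (1 / 2) ^ s) \<le> 4 * sqrt D4 / \<delta> * 1"
      unfolding sum_distrib_left[symmetric] using half \<delta> D4 by (intro mult_left_mono) auto
    finally show ?thesis by simp
  qed
  have "sign_avg J (\<lambda>\<xi>. op_norm C S (\<lambda>c y. M \<xi> c y * d y)) \<xi>0 \<le>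
      sign_avg J (\<lambda>\<xi>. \<Sum>s\<le>K. \<delta> * 2 ^ s * op_norm C (S' s) (M \<xi>)) \<xi>0"
    by (intro sign_avg_mono split)
  also have "\<dots> = (\<Sum>s\<le>K. \<delta> * 2 ^ s * sign_avg J (\<lambda>\<xi>. op_norm C (S' s) (M \<xi>)) \<xi>0)"
    by (simp add: sign_avg_sum sign_avg_cmult)
  also have "\<dots> \<le> (\<Sum>s\<le>K. \<delta> * 2 ^ s * (6 * F + 34 * sqrt (real (card (S' s))) * \<beta>))"
    using \<delta> by (intro sum_mono mult_left_mono each) auto
  also have "\<dots> = (\<Sum>s\<le>K. \<delta> * 2 ^ s) * (6 * F) + 34 * \<beta> * (\<Sum>s\<le>K. \<delta> * 2 ^ s * sqrt (real (card (S' s))))"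
    by (simp add: sum_distrib_left sum_distrib_right sum.distrib algebra_simps)
  also have "\<dots> \<le> 4 * (\<delta> + g) * (6 * F) + 34 * \<beta> * (4 * (\<delta> * sqrt (real (card S)) + sqrt D4 / \<delta>))"
  proof (intro add_mono mult_right_mono mult_left_mono sum1)
    have "0 \<le> \<delta> * sqrt (real (card S))" using \<delta> by simp
    then show "(\<Sum>s\<le>K. \<delta> * 2 ^ s * sqrt (real (card (S' s)))) \<le> 4 * (\<delta> * sqrt (real (card S)) + sqrt D4 / \<delta>)"
      using sum2 by simp
  qed (auto simp: F_def \<beta>_def)
  also have "\<dots> = 24 * (\<delta> + g) * F + 136 * (\<delta> * sqrt (real (card S)) + sqrt D4 / \<delta>) * \<beta>"
    by (simp add: algebra_simps)
  finally show ?thesis by (simp only: J_def M_def F_def \<beta>_def D4_def)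
qed

section \<open>Sums of signs\<close>

text \<open>Measurability with respect to the coordinates in \<open>H\<close>. Together with
  disjointness of such sets it plays the role of independence.\<close>

definition depends_on :: "'i set \<Rightarrow> (('i \<Rightarrow> real) \<Rightarrow> 'b) \<Rightarrow> bool" where
  "depends_on H f \<longleftrightarrow> (\<forall>\<xi> \<xi>'. (\<forall>i\<in>H. \<xi> i = \<xi>' i) \<longrightarrow> f \<xi> = f \<xi>')"

lemma depends_onD: "depends_on H f \<Longrightarrow> (\<And>i. i \<in> H \<Longrightarrow> \<xi> i = \<xi>' i) \<Longrightarrow> f \<xi> = f \<xi>'"
  unfolding depends_on_def by blast

lemma depends_on_agree_off: "depends_on H f \<Longrightarrow> H \<inter> J = {} \<Longrightarrow> agree_off J \<xi> \<xi>' \<Longrightarrow> f \<xi>' = f \<xi>"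
  by (rule depends_onD[of H f]) (auto simp: agree_off_def)

lemma sign_avg_base_irrelevant:
  assumes "depends_on H f" "H \<subseteq> J"
  shows "sign_avg J f \<xi> = sign_avg J f \<xi>'"
  unfolding sign_avg_def using assms
  by (intro arg_cong2[of _ _ _ _ "(/)"] sum.cong refl depends_onD[of H f]) auto

lemma sign_avg_restrict:
  assumes "depends_on H f" "H \<subseteq> J" "finite J"
  shows "sign_avg J f \<xi> = sign_avg H f \<xi>"
proof -
  have fin: "finite H" "finite (J - H)" using assms finite_subset by auto
  have "sign_avg (H \<union> (J - H)) f \<xi> = sign_avg H (sign_avg (J - H) f) \<xi>"
    using fin by (intro sign_avg_Un) auto
  also have "sign_avg (J - H) f = f"
    using fin by (intro ext sign_avg_indep) (auto intro: depends_on_agree_off[OF assms(1)])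
  also have "H \<union> (J - H) = J" using assms by auto
  finally show ?thesis .
qed

text \<open>Functions of disjoint blocks of signs are independent. In the induction, the average of
  the remaining product reads no sign of the new block and does not depend on the base point, so it
  leaves the average as a constant.\<close>

lemma sign_avg_prod:
  assumes "finite I" "\<And>i. i \<in> I \<Longrightarrow> finite (J i)"
    and "\<And>i. i \<in> I \<Longrightarrow> depends_on (J i) (f i)"
    and "\<And>i i'. i \<in> I \<Longrightarrow> i' \<in> I \<Longrightarrow> i \<noteq> i' \<Longrightarrow> J i \<inter> J i' = {}"
  shows "sign_avg (\<Union>i\<in>I. J i) (\<lambda>\<xi>. \<Prod>i\<in>I. f i \<xi>) \<xi> = (\<Prod>i\<in>I. sign_avg (J i) (f i) \<xi>)"
  using assms
proof (induction I arbitrary: \<xi> rule: finite_induct)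
  case (insert i I)
  let ?U = "\<Union>i\<in>I. J i"
  have disj: "J i \<inter> ?U = {}"
    using insert.prems(3)[of i] insert.hyps(2) by auto
  have "sign_avg (J i \<union> ?U) (\<lambda>\<xi>. \<Prod>i\<in>insert i I. f i \<xi>) \<xi> =
      sign_avg (J i) (sign_avg ?U (\<lambda>\<xi>. f i \<xi> * (\<Prod>i\<in>I. f i \<xi>))) \<xi>"
    using insert.hyps insert.prems disj by (subst sign_avg_Un) auto
  also have "sign_avg ?U (\<lambda>\<xi>. f i \<xi> * (\<Prod>i\<in>I. f i \<xi>)) = (\<lambda>\<xi>. f i \<xi> * sign_avg ?U (\<lambda>\<xi>. \<Prod>i\<in>I. f i \<xi>) \<xi>)"
    using insert.prems(2)[of i] disj
    by (intro ext sign_avg_factor) (auto intro: depends_on_agree_off)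
  also have "(\<lambda>\<xi>. sign_avg ?U (\<lambda>\<xi>. \<Prod>i\<in>I. f i \<xi>) \<xi>) = (\<lambda>_. \<Prod>i\<in>I. sign_avg (J i) (f i) \<xi>)"
  proof
    fix \<xi>'
    have "depends_on ?U (\<lambda>\<xi>. \<Prod>i\<in>I. f i \<xi>)"
      unfolding depends_on_def
      by (intro allI impI prod.cong refl, rule depends_onD, rule insert.prems(2)) auto
    then have "sign_avg ?U (\<lambda>\<xi>. \<Prod>i\<in>I. f i \<xi>) \<xi>' = sign_avg ?U (\<lambda>\<xi>. \<Prod>i\<in>I. f i \<xi>) \<xi>"
      by (rule sign_avg_base_irrelevant) simp
    then show "sign_avg ?U (\<lambda>\<xi>. \<Prod>i\<in>I. f i \<xi>) \<xi>' = (\<Prod>i\<in>I. sign_avg (J i) (f i) \<xi>)"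
      using insert by auto
  qed
  finally show ?case using insert.hyps by (simp add: sign_avg_cmult_right)
qed simp

text \<open>The shift \<open>s\<close> is carried for the induction, where each fixed sign moves
  into it. Using \<open>cosh\<close> rather than \<open>exp\<close> gives access to even moments
  directly.\<close>

lemma sign_avg_cosh_sum:
  assumes "finite J"
  shows "sign_avg J (\<lambda>\<xi>. cosh (t * (\<Sum>i\<in>J. \<xi> i) + s)) \<xi> = cosh t ^ card J * cosh s"
  using assms
proof (induction J arbitrary: s \<xi> rule: finite_induct)
  case (insert i J)
  have e: "sign_avg J (\<lambda>\<xi>. cosh (t * (\<Sum>j\<in>insert i J. (\<xi>(i := c)) j) + s)) \<xi> =
      cosh t ^ card J * cosh (t * c + s)" for c
  proof -
    have "(\<Sum>j\<in>insert i J. (\<xi>(i := c)) j) = c + (\<Sum>j\<in>J. \<xi> j)" for \<xi> :: "'a \<Rightarrow> real"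
      using insert.hyps by (simp, intro sum.cong) auto
    then show ?thesis
      using insert.IH[of "t * c + s"] by (simp add: algebra_simps)
  qed
  have "cosh (t + s) + cosh (- t + s) = 2 * (cosh t * cosh s)"
    using cosh_add[of t s] cosh_diff[of s t] by (simp add: algebra_simps)
  then show ?case
    unfolding sign_avg_insert[OF insert.hyps(1,2)] e using insert.hyps
    by (simp flip: distrib_left)
qed simp

lemma power_le_fact_cosh: "(x::real) ^ (2 * p) \<le> fact (2 * p) * cosh x"
proof -
  let ?a = "\<lambda>n. if even n then x ^ n /\<^sub>R fact n else 0"
  have "?a sums cosh x" by (rule cosh_converges)
  moreover have "0 \<le> ?a n" for n by (auto simp: zero_le_even_power)
  ultimately have "(\<Sum>n\<in>{2 * p}. ?a n) \<le> cosh x"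
    using sum_le_suminf[of ?a "{2 * p}"] by (auto simp: sums_iff)
  then show ?thesis by (simp add: field_simps)
qed

text \<open>Subgaussian moments by the exponential method. With \<open>t\<^sup>2 = 2 * p / n\<close>
  the exponential factor is at most \<open>exp p\<close>, hence of the form constant to the power
  \<open>p\<close>, and the factorial contributes \<open>(2 * p) ^ (2 * p)\<close>. The number of
  signs enters only through its upper bound \<open>n\<close>.\<close>

lemma sign_avg_sum_moment_le:
  assumes "finite J" "card J \<le> n" "1 \<le> p"
  shows "sign_avg J (\<lambda>\<xi>. (\<Sum>i\<in>J. \<xi> i) ^ (2 * p)) \<xi> \<le> (6 * real p * real n) ^ p"
proof (cases "n = 0")
  case True
  then show ?thesis using assms by (simp add: power_0_left)
next
  case False
  define t where "t = sqrt (2 * real p / real n)"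
  have t: "t > 0" using False assms by (simp add: t_def)
  have t2: "t\<^sup>2 = 2 * real p / real n" using False assms by (simp add: t_def)
  have "t ^ (2 * p) * sign_avg J (\<lambda>\<xi>. (\<Sum>i\<in>J. \<xi> i) ^ (2 * p)) \<xi> =
      sign_avg J (\<lambda>\<xi>. (t * (\<Sum>i\<in>J. \<xi> i)) ^ (2 * p)) \<xi>"
    by (simp add: power_mult_distrib sign_avg_cmult)
  also have "\<dots> \<le> sign_avg J (\<lambda>\<xi>. fact (2 * p) * cosh (t * (\<Sum>i\<in>J. \<xi> i) + 0)) \<xi>"
    by (intro sign_avg_mono) (simp add: power_le_fact_cosh)
  also have "\<dots> = fact (2 * p) * cosh t ^ card J"
    unfolding sign_avg_cmult sign_avg_cosh_sum[OF assms(1)] by simp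
  also have "\<dots> \<le> fact (2 * p) * exp (t\<^sup>2 / 2) ^ card J"
    by (intro mult_left_mono power_mono cosh_le_exp_half_square) auto
  also have "\<dots> \<le> fact (2 * p) * exp (t\<^sup>2 / 2) ^ n"
    using assms by (intro mult_left_mono power_increasing) auto
  also have "exp (t\<^sup>2 / 2) ^ n = exp (real p)"
    using False by (simp add: t2 flip: exp_of_nat_mult)
  also have "\<dots> \<le> 3 ^ p"
    using exp_le power_mono[of "exp 1" "3::real" p] by (simp flip: exp_of_nat_mult)
  also have "fact (2 * p) * 3 ^ p \<le> ((2 * real p) ^ (2 * p)) * (3::real) ^ p"
    using fact_le_power[of "2 * p", where 'a = real] by (intro mult_right_mono) auto
  also have "\<dots> = t ^ (2 * p) * (6 * real p * real n) ^ p"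
  proof -
    have "(2 * real p) ^ (2 * p) * 3 ^ p = ((2 * real p)\<^sup>2 * 3) ^ p"
      by (simp only: power_mult power_mult_distrib)
    also have "(2 * real p)\<^sup>2 * 3 = t\<^sup>2 * (6 * real p * real n)"
      unfolding t2 using False by (simp add: power2_eq_square)
    also have "\<dots> ^ p = t ^ (2 * p) * (6 * real p * real n) ^ p"
      by (simp only: power_mult power_mult_distrib)
    finally show ?thesis .
  qed
  finally show ?thesis using t by simp
qed

lemma sign_avg_linear_sq:
  assumes "finite J"
  shows "sign_avg J (\<lambda>\<xi>. (\<Sum>t\<in>J. a t * \<xi> t)\<^sup>2) \<xi> = (\<Sum>t\<in>J. (a t)\<^sup>2)"
  using assms
proof (induction J arbitrary: \<xi> rule: finite_induct)
  case (insert i J)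
  define S where "S \<xi> = (\<Sum>t\<in>J. a t * \<xi> t)" for \<xi>
  have e: "(\<Sum>t\<in>insert i J. a t * (\<xi>(i := c)) t) = a i * c + S \<xi>" for \<xi> c
    unfolding S_def using insert.hyps by (simp, intro sum.cong) auto
  have "sign_avg (insert i J) (\<lambda>\<xi>. (\<Sum>t\<in>insert i J. a t * \<xi> t)\<^sup>2) \<xi> =
      1 / 2 * sign_avg J (\<lambda>\<xi>. (a i * 1 + S \<xi>)\<^sup>2 + (a i * (-1) + S \<xi>)\<^sup>2) \<xi>"
    unfolding sign_avg_insert[OF insert.hyps(1,2)] e sign_avg_add by simp
  also have "\<dots> = sign_avg J (\<lambda>\<xi>. (a i)\<^sup>2 + (S \<xi>)\<^sup>2) \<xi>"
    unfolding sign_avg_cmult[symmetric] by (intro sign_avg_cong) (simp add: power2_eq_square algebra_simps)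
  also have "\<dots> = (a i)\<^sup>2 + (\<Sum>t\<in>J. (a t)\<^sup>2)"
    using insert by (simp add: sign_avg_add S_def)
  finally show ?case using insert.hyps by simp
qed simp

text \<open>Averaging over one more sign kills the odd binomial terms; the remaining recursion is
  the one of a Gaussian, hence the constant 3.\<close>

lemma sign_avg_linear_fourth_le:
  assumes "finite J"
  shows "sign_avg J (\<lambda>\<xi>. (\<Sum>t\<in>J. a t * \<xi> t) ^ 4) \<xi> \<le> 3 * (\<Sum>t\<in>J. (a t)\<^sup>2)\<^sup>2"
  using assms
proof (induction J arbitrary: \<xi> rule: finite_induct)
  case (insert i J)
  define S where "S \<xi> = (\<Sum>t\<in>J. a t * \<xi> t)" for \<xi>
  define v where "v = (\<Sum>t\<in>J. (a t)\<^sup>2)"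
  have e: "(\<Sum>t\<in>insert i J. a t * (\<xi>(i := c)) t) = a i * c + S \<xi>" for \<xi> c
    unfolding S_def using insert.hyps by (simp, intro sum.cong) auto
  have "sign_avg (insert i J) (\<lambda>\<xi>. (\<Sum>t\<in>insert i J. a t * \<xi> t) ^ 4) \<xi> =
      1 / 2 * sign_avg J (\<lambda>\<xi>. (a i * 1 + S \<xi>) ^ 4 + (a i * (-1) + S \<xi>) ^ 4) \<xi>"
    unfolding sign_avg_insert[OF insert.hyps(1,2)] e sign_avg_add by simp
  also have "\<dots> = sign_avg J (\<lambda>\<xi>. (a i) ^ 4 + (6 * (a i)\<^sup>2 * (S \<xi>)\<^sup>2 + (S \<xi>) ^ 4)) \<xi>"
    unfolding sign_avg_cmult[symmetric]
    by (intro sign_avg_cong) (simp add: power2_eq_square power4_eq_xxxx algebra_simps)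
  also have "\<dots> = (a i) ^ 4 + (6 * (a i)\<^sup>2 * v + sign_avg J (\<lambda>\<xi>. (S \<xi>) ^ 4) \<xi>)"
    unfolding sign_avg_add sign_avg_cmult using insert.hyps
    by (simp add: S_def v_def sign_avg_linear_sq)
  also have "\<dots> \<le> (a i) ^ 4 + (6 * (a i)\<^sup>2 * v + 3 * v\<^sup>2)"
    using insert.IH by (simp add: S_def v_def)
  also have "\<dots> \<le> 3 * ((a i)\<^sup>2 + v)\<^sup>2"
  proof -
    have "3 * ((a i)\<^sup>2 + v)\<^sup>2 = 3 * (a i) ^ 4 + (6 * (a i)\<^sup>2 * v + 3 * v\<^sup>2)"
      by (simp add: power2_eq_square power4_eq_xxxx algebra_simps)
    then show ?thesis by simp
  qed
  finally show ?case using insert.hyps by (simp add: v_def)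
qed simp

text \<open>The Khintchine inequality in \<open>L\<^sub>1\<close>, from \<open>\<bar>s\<bar> \<ge> 3/4 s\<^sup>2 - 1/16 s\<^sup>4\<close>.\<close>

lemma sign_avg_abs_linear_ge:
  assumes "finite J"
  shows "9 / 16 * sqrt (\<Sum>t\<in>J. (a t)\<^sup>2) \<le> sign_avg J (\<lambda>\<xi>. \<bar>\<Sum>t\<in>J. a t * \<xi> t\<bar>) \<xi>"
proof (cases "(\<Sum>t\<in>J. (a t)\<^sup>2) = 0")
  case True
  then show ?thesis by (auto intro: sign_avg_nonneg)
next
  case False
  define v where "v = sqrt (\<Sum>t\<in>J. (a t)\<^sup>2)"
  have v2: "v\<^sup>2 = (\<Sum>t\<in>J. (a t)\<^sup>2)" by (simp add: v_def sum_nonneg)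
  have v: "v > 0" using False by (simp add: v_def sum_nonneg less_le)
  define S where "S \<xi> = (\<Sum>t\<in>J. a t * \<xi> t)" for \<xi>
  \<comment> \<open>For \<open>t\<close> the modulus of \<open>s\<close>, the difference of the two
    sides is \<open>t * (t - 2)\<^sup>2 * (t + 4) / 16\<close>.\<close>
  have pt: "3 / 4 * s\<^sup>2 + (- 1 / 16) * s ^ 4 \<le> \<bar>s\<bar>" for s :: real
  proof -
    have "0 \<le> \<bar>s\<bar> * ((\<bar>s\<bar> - 2)\<^sup>2 * (\<bar>s\<bar> + 4))" by (intro mult_nonneg_nonneg) auto
    also have "\<dots> = \<bar>s\<bar> ^ 4 - 12 * \<bar>s\<bar>\<^sup>2 + 16 * \<bar>s\<bar>"
      by (simp add: power2_eq_square power4_eq_xxxx algebra_simps)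
    finally show ?thesis by simp
  qed
  \<comment> \<open>After division by the standard deviation \<open>v\<close> the second moment is 1
    and the fourth at most 3, so the constant is 3/4 - 3/16.\<close>
  have "9 / 16 * v = v * (3 / 4 * (1 / v\<^sup>2 * v\<^sup>2) + (- 1 / 16) * (1 / v ^ 4 * (3 * (v\<^sup>2)\<^sup>2)))"
    using v by (simp add: power2_eq_square power4_eq_xxxx)
  also have "\<dots> \<le> v * (3 / 4 * (1 / v\<^sup>2 * sign_avg J (\<lambda>\<xi>. (S \<xi>)\<^sup>2) \<xi>) +
      (- 1 / 16) * (1 / v ^ 4 * sign_avg J (\<lambda>\<xi>. (S \<xi>) ^ 4) \<xi>))"
  proof -
    have a: "sign_avg J (\<lambda>\<xi>. (S \<xi>)\<^sup>2) \<xi> = v\<^sup>2"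
      by (simp add: S_def v2 sign_avg_linear_sq[OF assms])
    have "1 / v ^ 4 * sign_avg J (\<lambda>\<xi>. (S \<xi>) ^ 4) \<xi> \<le> 1 / v ^ 4 * (3 * (v\<^sup>2)\<^sup>2)"
      unfolding S_def v2 using sign_avg_linear_fourth_le[OF assms] v by (intro mult_left_mono) auto
    then have b: "(- 1 / 16) * (1 / v ^ 4 * (3 * (v\<^sup>2)\<^sup>2)) \<le> (- 1 / 16) * (1 / v ^ 4 * sign_avg J (\<lambda>\<xi>. (S \<xi>) ^ 4) \<xi>)"
      by simp
    show ?thesis
      unfolding a by (rule mult_left_mono[OF add_left_mono[OF b]]) (use v in simp)
  qed
  also have "\<dots> = sign_avg J (\<lambda>\<xi>. v * (3 / 4 * (S \<xi> / v)\<^sup>2 + (- 1 / 16) * (S \<xi> / v) ^ 4)) \<xi>"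
  proof -
    have "sign_avg J (\<lambda>\<xi>. v * (3 / 4 * (S \<xi> / v)\<^sup>2 + (- 1 / 16) * (S \<xi> / v) ^ 4)) \<xi> =
        sign_avg J (\<lambda>\<xi>. v * (3 / 4 * (1 / v\<^sup>2 * (S \<xi>)\<^sup>2) + (- 1 / 16) * (1 / v ^ 4 * (S \<xi>) ^ 4))) \<xi>"
      by (simp add: power_divide)
    then show ?thesis by (simp only: sign_avg_cmult sign_avg_add)
  qed
  also have "\<dots> \<le> sign_avg J (\<lambda>\<xi>. v * \<bar>S \<xi> / v\<bar>) \<xi>"
    using v by (intro sign_avg_mono mult_left_mono pt) auto
  also have "\<dots> = sign_avg J (\<lambda>\<xi>. \<bar>S \<xi>\<bar>) \<xi>" using v by simp
  finally show ?thesis by (simp add: v_def S_def)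
qed

lemma linear_reindex:
  assumes "inj_on e X"
  shows "(\<Sum>t\<in>e ` X. c (the_inv_into X e t) * \<xi> t) = (\<Sum>x\<in>X. c x * \<xi> (e x))"
    and "(\<Sum>t\<in>e ` X. (c (the_inv_into X e t))\<^sup>2) = (\<Sum>x\<in>X. (c x)\<^sup>2)"
  using assms by (auto simp: sum.reindex the_inv_into_f_f intro!: sum.cong)

lemma sign_avg_linear_image:
  fixes c :: "'x \<Rightarrow> real"
  assumes "finite J" "e ` X \<subseteq> J" "inj_on e X"
  shows "sign_avg J (\<lambda>\<xi>. (\<Sum>x\<in>X. c x * \<xi> (e x))\<^sup>2) \<xi> = (\<Sum>x\<in>X. (c x)\<^sup>2)"
    and "9 / 16 * sqrt (\<Sum>x\<in>X. (c x)\<^sup>2) \<le> sign_avg J (\<lambda>\<xi>. \<bar>\<Sum>x\<in>X. c x * \<xi> (e x)\<bar>) \<xi>"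
proof -
  have fin: "finite (e ` X)" using assms finite_subset by blast
  have "depends_on (e ` X) (\<lambda>\<xi>. (\<Sum>x\<in>X. c x * \<xi> (e x))\<^sup>2)"
    "depends_on (e ` X) (\<lambda>\<xi>. \<bar>\<Sum>x\<in>X. c x * \<xi> (e x)\<bar>)"
    by (auto simp: depends_on_def cong: sum.cong)
  note r = this[THEN sign_avg_restrict, OF assms(2,1)]
  show "sign_avg J (\<lambda>\<xi>. (\<Sum>x\<in>X. c x * \<xi> (e x))\<^sup>2) \<xi> = (\<Sum>x\<in>X. (c x)\<^sup>2)"
    using sign_avg_linear_sq[OF fin, of "\<lambda>t. c (the_inv_into X e t)" \<xi>]
    by (simp add: r linear_reindex[OF assms(3)])
  show "9 / 16 * sqrt (\<Sum>x\<in>X. (c x)\<^sup>2) \<le> sign_avg J (\<lambda>\<xi>. \<bar>\<Sum>x\<in>X. c x * \<xi> (e x)\<bar>) \<xi>"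
    using sign_avg_abs_linear_ge[OF fin, of "\<lambda>t. c (the_inv_into X e t)" \<xi>]
    by (simp add: r linear_reindex[OF assms(3)])
qed

section \<open>Chains with disjoint label classes\<close>

text \<open>The diagonal entry of the matrix \<open>D\<^sub>j\<close> at the label \<open>y\<close>.
  A vertex without leaves has the empty product, so its diagonal matrix is the identity.\<close>

definition leaf_prod ::
  "(nat \<Rightarrow> nat) \<Rightarrow> (chain_vertex \<Rightarrow> nat set) \<Rightarrow> nat \<Rightarrow> (nat set \<Rightarrow> real) \<Rightarrow> nat \<Rightarrow> real" where
  "leaf_prod q V j \<xi> y = (\<Prod>l<q j. \<Sum>z\<in>V (Leaf j l). \<xi> {y, z})"

text \<open>The row vector \<open>f\<close>, indexed by the labels of \<open>x\<^sub>j\<close>, is propagated along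
  \<open>x\<^sub>j, x\<^sub>j\<^sub>+\<^sub>1, \<dots>\<close>; the leaves at \<open>x\<^sub>j\<close> itself are not included.\<close>

primrec walk ::
  "(nat \<Rightarrow> nat) \<Rightarrow> (chain_vertex \<Rightarrow> nat set) \<Rightarrow> nat \<Rightarrow> (nat set \<Rightarrow> real) \<Rightarrow> (nat \<Rightarrow> real) \<Rightarrow> nat \<Rightarrow> nat \<Rightarrow> real"
where
  "walk q V j \<xi> f 0 = f"
| "walk q V j \<xi> f (Suc k) =
    (\<lambda>y. (\<Sum>x\<in>V (Spine (j + k)). walk q V j \<xi> f k x * \<xi> {x, y}) * leaf_prod q V (Suc (j + k)) \<xi> y)"

text \<open>The supports of the independent factors: \<open>spine_edges V k\<close> contains the
  signs of \<open>A\<^sub>k\<close>, \<open>leaf_edges q V k\<close> those of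
  \<open>D\<^sub>k\<close>, and \<open>walk_edges q V j k\<close> all signs read in \<open>k\<close>
  steps from \<open>x\<^sub>j\<close>.\<close>

definition spine_edges :: "(chain_vertex \<Rightarrow> nat set) \<Rightarrow> nat \<Rightarrow> nat set set" where
  "spine_edges V k = (\<lambda>(x, y). {x, y}) ` (V (Spine k) \<times> V (Spine (Suc k)))"

definition leaf_edges :: "(nat \<Rightarrow> nat) \<Rightarrow> (chain_vertex \<Rightarrow> nat set) \<Rightarrow> nat \<Rightarrow> nat set set" where
  "leaf_edges q V k = (\<Union>y\<in>V (Spine k). \<Union>l<q k. (\<lambda>z. {y, z}) ` V (Leaf k l))"

definition walk_edges :: "(nat \<Rightarrow> nat) \<Rightarrow> (chain_vertex \<Rightarrow> nat set) \<Rightarrow> nat \<Rightarrow> nat \<Rightarrow> nat set set" where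
  "walk_edges q V j k = (\<Union>i<k. spine_edges V (j + i) \<union> leaf_edges q V (Suc (j + i)))"

text \<open>Because the classes are disjoint, a pair of labels determines the pair of vertices it
  belongs to. Different edges of the chain therefore read different signs, which is the source of
  all independence below.\<close>

locale label_classes =
  fixes n :: nat and V :: "chain_vertex \<Rightarrow> nat set"
  assumes classes_sub: "V x \<subseteq> {1..n}"
    and classes_disj: "x \<noteq> y \<Longrightarrow> V x \<inter> V y = {}"
begin

lemma finite_class [simp]: "finite (V x)"
  using classes_sub by (rule finite_subset) simp

lemma card_class_le: "card (V x) \<le> n"
  using card_mono[OF _ classes_sub, of x] by simp

lemma class_unique: "a \<in> V x \<Longrightarrow> a \<in> V y \<Longrightarrow> x = y"
  using classes_disj by blast

text \<open>Disjointness in equational form: used as a destruction rule, two memberships of the same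
  label identify the two vertices, and distinct constructors or indices then give a
  contradiction.\<close>

lemma class_eq_The: "a \<in> V x \<Longrightarrow> (THE x. a \<in> V x) = x"
  using class_unique by blast

lemma finite_spine_edges [simp]: "finite (spine_edges V k)"
  by (simp add: spine_edges_def)

lemma finite_leaf_edges [simp]: "finite (leaf_edges q V k)"
  by (simp add: leaf_edges_def)

lemma finite_walk_edges [simp]: "finite (walk_edges q V j k)"
  by (simp add: walk_edges_def)

lemma spine_leaf_disj: "spine_edges V k \<inter> leaf_edges q V k' = {}"
  unfolding spine_edges_def leaf_edges_def
  by (auto simp: doubleton_eq_iff dest!: class_eq_The)

lemma spine_spine_disj: "k \<noteq> k' \<Longrightarrow> spine_edges V k \<inter> spine_edges V k' = {}"
  unfolding spine_edges_def
  by (auto simp: doubleton_eq_iff dest!: class_eq_The)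

lemma leaf_leaf_disj: "k \<noteq> k' \<Longrightarrow> leaf_edges q V k \<inter> leaf_edges q V k' = {}"
  unfolding leaf_edges_def
  by (auto simp: doubleton_eq_iff dest!: class_eq_The)

text \<open>The signs read in the next step are fresh. This and the corresponding fact for leaves
  justify conditioning on the walk so far.\<close>

lemma walk_spine_disj:
  assumes "j + k \<le> k'"
  shows "walk_edges q V j k \<inter> spine_edges V k' = {}"
proof -
  have "(spine_edges V (j + i) \<union> leaf_edges q V (Suc (j + i))) \<inter> spine_edges V k' = {}" if "i < k" for i
    using that assms spine_spine_disj[of "j + i" k'] spine_leaf_disj[of k' q "Suc (j + i)"] by auto
  then show ?thesis unfolding walk_edges_def by blast
qed

lemma walk_leaf_disj:
  assumes "j + k < k'"
  shows "walk_edges q V j k \<inter> leaf_edges q V k' = {}"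
proof -
  have "(spine_edges V (j + i) \<union> leaf_edges q V (Suc (j + i))) \<inter> leaf_edges q V k' = {}" if "i < k" for i
    using that assms leaf_leaf_disj[of "Suc (j + i)" k' q] spine_leaf_disj[of "j + i" q k'] by auto
  then show ?thesis unfolding walk_edges_def by blast
qed

lemma walk_edges_sub: "walk_edges q V j k \<subseteq> {e. e \<subseteq> {1..n} \<and> card e = 2}"
proof -
  have "card {x, y} = 2" if "x \<in> V a" "y \<in> V b" "a \<noteq> b" for x y a b
  proof -
    have "x \<noteq> y" using that class_unique by blast
    then show ?thesis by simp
  qed
  moreover have "{x, y} \<subseteq> {1..n}" if "x \<in> V a" "y \<in> V b" for x y a b
    using that classes_sub[of a] classes_sub[of b] by blast
  ultimately show ?thesis
    unfolding walk_edges_def spine_edges_def leaf_edges_def by fastforce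
qed

lemma depends_on_leaf_prod:
  "y \<in> V (Spine k) \<Longrightarrow> depends_on (leaf_edges q V k) (\<lambda>\<xi>. leaf_prod q V k \<xi> y)"
  unfolding depends_on_def leaf_prod_def leaf_edges_def
  by (intro allI impI prod.cong sum.cong refl) auto

lemma depends_on_walk:
  "y \<in> V (Spine (j + k)) \<Longrightarrow> depends_on (walk_edges q V j k) (\<lambda>\<xi>. walk q V j \<xi> f k y)"
proof (induction k arbitrary: y)
  case 0
  then show ?case by (simp add: depends_on_def)
next
  case (Suc k)
  show ?case
    unfolding depends_on_def
  proof (intro allI impI)
    fix \<xi> \<xi>' :: "nat set \<Rightarrow> real"
    assume e: "\<forall>i\<in>walk_edges q V j (Suc k). \<xi> i = \<xi>' i"
    have "leaf_prod q V (Suc (j + k)) \<xi> y = leaf_prod q V (Suc (j + k)) \<xi>' y"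
      using Suc.prems e
      by (intro depends_onD[OF depends_on_leaf_prod]) (auto simp: walk_edges_def)
    moreover have "walk q V j \<xi> f k x * \<xi> {x, y} = walk q V j \<xi>' f k x * \<xi>' {x, y}" if x: "x \<in> V (Spine (j + k))" for x
    proof (intro arg_cong2[of _ _ _ _ times])
      show "walk q V j \<xi> f k x = walk q V j \<xi>' f k x"
        using e by (intro depends_onD[OF Suc.IH[OF x]]) (auto simp: walk_edges_def)
      have "{x, y} \<in> spine_edges V (j + k)" using x Suc.prems by (auto simp: spine_edges_def)
      then show "\<xi> {x, y} = \<xi>' {x, y}" using e by (auto simp: walk_edges_def)
    qed
    ultimately show "walk q V j \<xi> f (Suc k) y = walk q V j \<xi>' f (Suc k) y"
      by (simp cong: sum.cong)
  qed
qed

lemma leaf_factor_image: "(\<Sum>z\<in>V x. \<xi> {y, z}) = (\<Sum>e\<in>(\<lambda>z. {y, z}) ` V x. \<xi> e)"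
  by (subst sum.reindex) (auto simp: inj_on_def doubleton_eq_iff)

section \<open>Moments and maximum of the diagonal entries\<close>

lemma sign_avg_leaf_prod_power:
  assumes y: "y \<in> V (Spine k)"
  shows "sign_avg (leaf_edges q V k) (\<lambda>\<xi>. h (leaf_prod q V k \<xi> y)) \<xi>
    = sign_avg (\<Union>l<q k. (\<lambda>z. {y, z}) ` V (Leaf k l)) (\<lambda>\<xi>. h (leaf_prod q V k \<xi> y)) \<xi>"
proof (rule sign_avg_restrict)
  show "depends_on (\<Union>l<q k. (\<lambda>z. {y, z}) ` V (Leaf k l)) (\<lambda>\<xi>. h (leaf_prod q V k \<xi> y))"
    unfolding depends_on_def leaf_prod_def
    by (intro allI impI arg_cong[of _ _ h] prod.cong sum.cong refl) auto
qed (use y in \<open>auto simp: leaf_edges_def\<close>)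

text \<open>The sums over the different leaves at one label read disjoint sets of signs. The
  functions \<open>h\<close> and \<open>g\<close> are kept abstract so that even powers and absolute
  values are covered by one statement.\<close>

lemma sign_avg_leaf_prod_multiplicative:
  assumes y: "y \<in> V (Spine k)" and h: "\<And>u. h (leaf_prod q V k u y) = (\<Prod>l<q k. g (\<Sum>z\<in>V (Leaf k l). u {y, z}))"
  shows "sign_avg (leaf_edges q V k) (\<lambda>\<xi>. h (leaf_prod q V k \<xi> y)) \<xi> =
    (\<Prod>l<q k. sign_avg ((\<lambda>z. {y, z}) ` V (Leaf k l)) (\<lambda>\<xi>. g (\<Sum>e\<in>(\<lambda>z. {y, z}) ` V (Leaf k l). \<xi> e)) \<xi>)"
proof -
  have "sign_avg (leaf_edges q V k) (\<lambda>\<xi>. h (leaf_prod q V k \<xi> y)) \<xi> =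
      sign_avg (\<Union>l<q k. (\<lambda>z. {y, z}) ` V (Leaf k l)) (\<lambda>\<xi>. h (leaf_prod q V k \<xi> y)) \<xi>"
    by (rule sign_avg_leaf_prod_power[OF y])
  also have "\<dots> = sign_avg (\<Union>l<q k. (\<lambda>z. {y, z}) ` V (Leaf k l))
      (\<lambda>\<xi>. \<Prod>l<q k. g (\<Sum>e\<in>(\<lambda>z. {y, z}) ` V (Leaf k l). \<xi> e)) \<xi>"
    by (simp only: h leaf_factor_image)
  also have "\<dots> = (\<Prod>l<q k. sign_avg ((\<lambda>z. {y, z}) ` V (Leaf k l)) (\<lambda>\<xi>. g (\<Sum>e\<in>(\<lambda>z. {y, z}) ` V (Leaf k l). \<xi> e)) \<xi>)"
  proof (rule sign_avg_prod)
    fix l l' :: nat assume "l \<noteq> l'"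
    then show "(\<lambda>z. {y, z}) ` V (Leaf k l) \<inter> (\<lambda>z. {y, z}) ` V (Leaf k l') = {}"
      by (auto simp: doubleton_eq_iff dest!: class_eq_The)
  qed (auto simp: depends_on_def intro!: arg_cong[of _ _ g] sum.cong)
  finally show ?thesis .
qed

lemma sign_avg_leaf_prod_moment_le:
  assumes y: "y \<in> V (Spine k)" and p: "1 \<le> p"
  shows "sign_avg (leaf_edges q V k) (\<lambda>\<xi>. leaf_prod q V k \<xi> y ^ (2 * p)) \<xi> \<le> (6 * real p * real n) ^ (p * q k)"
proof -
  have "sign_avg (leaf_edges q V k) (\<lambda>\<xi>. leaf_prod q V k \<xi> y ^ (2 * p)) \<xi> =
    (\<Prod>l<q k. sign_avg ((\<lambda>z. {y, z}) ` V (Leaf k l)) (\<lambda>\<xi>. (\<Sum>e\<in>(\<lambda>z. {y, z}) ` V (Leaf k l). \<xi> e) ^ (2 * p)) \<xi>)"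
    by (rule sign_avg_leaf_prod_multiplicative[OF y]) (simp add: leaf_prod_def prod_power_distrib)
  also have "\<dots> \<le> (\<Prod>l<q k. (6 * real p * real n) ^ p)"
  proof (intro prod_mono conjI)
    fix l :: nat
    show "0 \<le> sign_avg ((\<lambda>z. {y, z}) ` V (Leaf k l)) (\<lambda>\<xi>. (\<Sum>e\<in>(\<lambda>z. {y, z}) ` V (Leaf k l). \<xi> e) ^ (2 * p)) \<xi>"
      by (intro sign_avg_nonneg) (simp add: zero_le_even_power')
    have "card ((\<lambda>z. {y, z}) ` V (Leaf k l)) \<le> n"
      using card_image_le[of "V (Leaf k l)"] card_class_le order_trans by (metis finite_class)
    then show "sign_avg ((\<lambda>z. {y, z}) ` V (Leaf k l)) (\<lambda>\<xi>. (\<Sum>e\<in>(\<lambda>z. {y, z}) ` V (Leaf k l). \<xi> e) ^ (2 * p)) \<xi>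
        \<le> (6 * real p * real n) ^ p"
      using p by (intro sign_avg_sum_moment_le) auto
  qed
  also have "\<dots> = (6 * real p * real n) ^ (p * q k)" by (simp add: power_mult)
  finally show ?thesis .
qed

text \<open>The maximum is replaced by the \<open>2 * p\<close> norm of the vector of entries, for
  which Jensen and the moment bound apply entry by entry. With \<open>p\<close> of order
  \<open>ln n\<close> the factor \<open>n\<close> from the number of entries has a bounded root, and
  only the growth of the moments in \<open>p\<close> remains; it produces one
  \<open>sqrt (ln n)\<close> for each leaf.\<close>

lemma ex_leaf_prod_max:
  assumes n: "3 \<le> n"
  shows "\<exists>g. (\<forall>\<xi>. \<forall>y\<in>V (Spine k). \<bar>leaf_prod q V k \<xi> y\<bar> \<le> g \<xi>) \<and> (\<forall>\<xi>. 0 \<le> g \<xi>) \<and>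
    (\<forall>\<xi>. sign_avg (leaf_edges q V k) g \<xi> \<le> 2 * 4 ^ q k * sqrt (ln n) ^ q k * sqrt n ^ q k)"
proof -
  \<comment> \<open>From below, \<open>p \<ge> ln n\<close> gives \<open>n \<le> 4 ^ p\<close>; from
    above, \<open>p \<le> 2 * ln n\<close> needs \<open>ln n \<ge> 1\<close>, which is why
    \<open>n \<ge> 3\<close> is assumed.\<close>
  define p where "p = nat \<lceil>ln (real n)\<rceil>"
  have ln1: "1 \<le> ln (real n)"
    using n exp_le ln_ge_iff[of "real n" 1] by simp
  have p: "1 \<le> p" "real p \<le> 2 * ln n" "ln n \<le> real p"
    using ln1 unfolding p_def by linarith+
  define g where "g \<xi> = root (2 * p) (\<Sum>y\<in>V (Spine k). leaf_prod q V k \<xi> y ^ (2 * p))" for \<xi>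
  have pos: "0 \<le> (\<Sum>y\<in>V (Spine k). leaf_prod q V k \<xi> y ^ (2 * p))" for \<xi>
    by (intro sum_nonneg) (simp add: zero_le_even_power')
  have g0: "0 \<le> g \<xi>" for \<xi> unfolding g_def by (rule real_root_ge_zero[OF pos])
  have gp: "g \<xi> ^ (2 * p) = (\<Sum>y\<in>V (Spine k). leaf_prod q V k \<xi> y ^ (2 * p))" for \<xi>
    unfolding g_def using p pos by (intro real_root_pow_pos2) auto
  have "\<bar>leaf_prod q V k \<xi> y\<bar> \<le> g \<xi>" if y: "y \<in> V (Spine k)" for \<xi> y
  proof -
    have "\<bar>leaf_prod q V k \<xi> y\<bar> ^ (2 * p) = leaf_prod q V k \<xi> y ^ (2 * p)"
      by (simp add: power_mult)
    also have "\<dots> \<le> g \<xi> ^ (2 * p)" unfolding gp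
      by (rule member_le_sum[OF y]) (auto simp: zero_le_even_power')
    finally show ?thesis using p g0 power_mono_iff[of "\<bar>leaf_prod q V k \<xi> y\<bar>" "g \<xi>" "2 * p"] by simp
  qed
  moreover have "sign_avg (leaf_edges q V k) g \<xi> \<le> 2 * 4 ^ q k * sqrt (ln n) ^ q k * sqrt n ^ q k" (is "?A \<le> ?B") for \<xi>
  proof -
    have A0: "0 \<le> ?A" using g0 by (intro sign_avg_nonneg)
    have B0: "0 \<le> ?B" using ln1 by simp
    have "?A ^ (2 * p) \<le> sign_avg (leaf_edges q V k) (\<lambda>\<xi>. g \<xi> ^ (2 * p)) \<xi>"
      using g0 p by (intro sign_avg_power_le) auto
    also have "\<dots> = (\<Sum>y\<in>V (Spine k). sign_avg (leaf_edges q V k) (\<lambda>\<xi>. leaf_prod q V k \<xi> y ^ (2 * p)) \<xi>)"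
      unfolding gp sign_avg_sum ..
    also have "\<dots> \<le> (\<Sum>y\<in>V (Spine k). (6 * real p * real n) ^ (p * q k))"
      using p by (intro sum_mono sign_avg_leaf_prod_moment_le) auto
    also have "\<dots> \<le> real n * (6 * real p * real n) ^ (p * q k)"
      using card_class_le by (simp add: mult_right_mono)
    also have "\<dots> \<le> 4 ^ p * (16 * ln n * real n) ^ (p * q k)"
    proof (rule mult_mono[OF _ power_mono])
      have "real n = exp (ln (real n))" using n by simp
      also have "\<dots> \<le> exp (real p)" using p by simp
      also have "\<dots> = exp 1 ^ p" by (simp flip: exp_of_nat_mult)
      also have "\<dots> \<le> 4 ^ p" using exp_le by (intro power_mono) auto
      finally show "real n \<le> 4 ^ p" .
      show "6 * real p * real n \<le> 16 * ln n * real n" using p ln1 by (intro mult_right_mono) auto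
    qed auto
    also have "\<dots> = ?B ^ (2 * p)"
    proof -
      define u where "u = 4 * sqrt (ln n) * sqrt n"
      have u2: "u\<^sup>2 = 16 * ln n * real n" using ln1 by (simp add: u_def power_mult_distrib)
      have "?B = 2 * u ^ q k" by (simp add: u_def power_mult_distrib)
      then have "?B ^ (2 * p) = 2 ^ (2 * p) * u ^ (2 * (p * q k))"
        by (simp add: power_mult_distrib mult_ac flip: power_mult)
      also have "\<dots> = (2\<^sup>2) ^ p * (u\<^sup>2) ^ (p * q k)" by (simp only: power_mult)
      finally show ?thesis by (simp add: u2)
    qed
    finally show ?thesis using power_mono_iff[OF A0 B0, of "2 * p"] p by simp
  qed
  ultimately show ?thesis using g0 by blast
qed

section \<open>Conditioning on the past of the walk, and its second moments\<close>

lemma inj_pair_classes: "a \<noteq> b \<Longrightarrow> inj_on (\<lambda>(x, y). {x, y}) (V a \<times> V b)"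
  by (auto simp: inj_on_def doubleton_eq_iff dest!: class_eq_The)

text \<open>The order of averaging matters: the signs of the new spine factor are innermost, so that
  the walk so far and the new diagonal entries are both fixed while they are averaged.\<close>

lemma sign_avg_walk_step:
  "sign_avg (walk_edges q V j (Suc k)) h \<xi> = sign_avg (walk_edges q V j k)
    (sign_avg (leaf_edges q V (Suc (j + k))) (sign_avg (spine_edges V (j + k)) h)) \<xi>"
proof -
  have "walk_edges q V j (Suc k) = walk_edges q V j k \<union> (leaf_edges q V (Suc (j + k)) \<union> spine_edges V (j + k))"
    by (auto simp: walk_edges_def less_Suc_eq)
  moreover have "sign_avg (leaf_edges q V (Suc (j + k)) \<union> spine_edges V (j + k)) h =
      sign_avg (leaf_edges q V (Suc (j + k))) (sign_avg (spine_edges V (j + k)) h)"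
    using spine_leaf_disj by (intro ext sign_avg_Un) auto
  moreover have "sign_avg (walk_edges q V j k \<union> (leaf_edges q V (Suc (j + k)) \<union> spine_edges V (j + k))) h \<xi> =
      sign_avg (walk_edges q V j k) (sign_avg (leaf_edges q V (Suc (j + k)) \<union> spine_edges V (j + k)) h) \<xi>"
    using walk_spine_disj[of j k "j + k" q] walk_leaf_disj[of j k "Suc (j + k)" q]
    by (intro sign_avg_Un) auto
  ultimately show ?thesis by simp
qed

lemma walk_agree_spine:
  assumes "agree_off (spine_edges V (j + k)) \<xi> \<xi>'" "x \<in> V (Spine (j + k))"
  shows "walk q V j \<xi>' f k x = walk q V j \<xi> f k x"
  using depends_on_agree_off[OF depends_on_walk[OF assms(2)] walk_spine_disj assms(1)] by simp

lemma walk_agree_leaf: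
  assumes "agree_off (leaf_edges q V (Suc (j + k))) \<xi> \<xi>'" "x \<in> V (Spine (j + k))"
  shows "walk q V j \<xi>' f k x = walk q V j \<xi> f k x"
  using depends_on_agree_off[OF depends_on_walk[OF assms(2)] walk_leaf_disj assms(1)] by simp

lemma leaf_prod_agree_spine:
  assumes "agree_off (spine_edges V k) \<xi> \<xi>'" "x \<in> V (Spine k')"
  shows "leaf_prod q V k' \<xi>' x = leaf_prod q V k' \<xi> x"
  using depends_on_agree_off[OF depends_on_leaf_prod[OF assms(2)] _ assms(1)] spine_leaf_disj[of k q k'] by auto

lemma sign_avg_walk_entry_sq:
  assumes y: "y \<in> V (Spine (Suc (j + k)))"
  shows "sign_avg (spine_edges V (j + k)) (\<lambda>\<xi>. (walk q V j \<xi> f (Suc k) y)\<^sup>2) \<xi> =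
    (\<Sum>x\<in>V (Spine (j + k)). (walk q V j \<xi> f k x)\<^sup>2) * (leaf_prod q V (Suc (j + k)) \<xi> y)\<^sup>2"
proof -
  have "sign_avg (spine_edges V (j + k)) (\<lambda>\<xi>. (walk q V j \<xi> f (Suc k) y)\<^sup>2) \<xi> =
    sign_avg (spine_edges V (j + k))
      (\<lambda>\<xi>'. (\<Sum>x\<in>V (Spine (j + k)). walk q V j \<xi> f k x * \<xi>' {x, y})\<^sup>2 * (leaf_prod q V (Suc (j + k)) \<xi> y)\<^sup>2) \<xi>"
    by (intro sign_avg_cong)
       (simp add: walk_agree_spine leaf_prod_agree_spine[OF _ y] power_mult_distrib cong: sum.cong)
  also have "\<dots> = (\<Sum>x\<in>V (Spine (j + k)). (walk q V j \<xi> f k x)\<^sup>2) * (leaf_prod q V (Suc (j + k)) \<xi> y)\<^sup>2"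
    proof -
    have "(\<lambda>x. {x, y}) ` V (Spine (j + k)) \<subseteq> spine_edges V (j + k)"
      using y by (auto simp: spine_edges_def)
    moreover have "inj_on (\<lambda>x. {x, y}) (V (Spine (j + k)))"
      by (auto simp: inj_on_def doubleton_eq_iff)
    ultimately show ?thesis
      unfolding sign_avg_cmult_right by (subst sign_avg_linear_image(1)) auto
  qed
  finally show ?thesis .
qed

text \<open>Orthogonality of the spine signs makes the squared Frobenius norm multiply, step by
  step, by the sum of the squared diagonal entries. Its average is at most \<open>n\<close> labels
  times a second moment \<open>(6 * n) ^ q\<close>. No maximum is taken, hence no logarithm.\<close>

lemma sign_avg_walk_frob2_le:
  "sign_avg (walk_edges q V j k) (\<lambda>\<xi>. frob2 C (V (Spine (j + k))) (\<lambda>a. walk q V j \<xi> (f a) k)) \<xi>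
    \<le> real n ^ k * (6 * real n) ^ (\<Sum>i=1..k. q (j + i)) * frob2 C (V (Spine j)) f"
proof (induction k)
  case 0
  then show ?case by (simp add: walk_edges_def)
next
  case (Suc k)
  let ?S = "V (Spine (j + k))" and ?S' = "V (Spine (Suc (j + k)))"
  let ?F = "\<lambda>\<xi>. frob2 C ?S (\<lambda>a. walk q V j \<xi> (f a) k)"
  let ?D = "\<lambda>\<xi> y. leaf_prod q V (Suc (j + k)) \<xi> y"
  have inner: "sign_avg (spine_edges V (j + k))
      (\<lambda>\<xi>. frob2 C ?S' (\<lambda>a. walk q V j \<xi> (f a) (Suc k))) \<xi> = ?F \<xi> * (\<Sum>y\<in>?S'. (?D \<xi> y)\<^sup>2)" for \<xi>
  proof -
    have "sign_avg (spine_edges V (j + k)) (\<lambda>\<xi>. frob2 C ?S' (\<lambda>a. walk q V j \<xi> (f a) (Suc k))) \<xi> =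
       (\<Sum>a\<in>C. \<Sum>y\<in>?S'. (\<Sum>x\<in>?S. (walk q V j \<xi> (f a) k x)\<^sup>2) * (?D \<xi> y)\<^sup>2)"
      unfolding frob2_def sign_avg_sum by (intro sum.cong refl sign_avg_walk_entry_sq)
    also have "\<dots> = (\<Sum>a\<in>C. (\<Sum>x\<in>?S. (walk q V j \<xi> (f a) k x)\<^sup>2) * (\<Sum>y\<in>?S'. (?D \<xi> y)\<^sup>2))"
      by (simp only: sum_distrib_left)
    finally show ?thesis by (simp only: frob2_def sum_distrib_right)
  qed
  have "sign_avg (leaf_edges q V (Suc (j + k))) (\<lambda>\<xi>. ?F \<xi> * (\<Sum>y\<in>?S'. (?D \<xi> y)\<^sup>2)) \<xi>
      \<le> real n * (6 * real n) ^ q (Suc (j + k)) * ?F \<xi>" for \<xi>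
  proof -
    have "sign_avg (leaf_edges q V (Suc (j + k))) (\<lambda>\<xi>. ?F \<xi> * (\<Sum>y\<in>?S'. (?D \<xi> y)\<^sup>2)) \<xi> =
        ?F \<xi> * (\<Sum>y\<in>?S'. sign_avg (leaf_edges q V (Suc (j + k))) (\<lambda>\<xi>. (?D \<xi> y) ^ (2 * 1)) \<xi>)"
      by (subst sign_avg_factor) (auto simp: frob2_def walk_agree_leaf sign_avg_sum cong: sum.cong)
    also have "\<dots> \<le> ?F \<xi> * (\<Sum>y\<in>?S'. (6 * real 1 * real n) ^ (1 * q (Suc (j + k))))"
      by (intro mult_left_mono sum_mono sign_avg_leaf_prod_moment_le) auto
    also have "\<dots> \<le> ?F \<xi> * (real n * (6 * real n) ^ q (Suc (j + k)))"
      using card_class_le by (intro mult_left_mono) (auto simp: mult_right_mono)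
    finally show ?thesis by (simp add: mult_ac)
  qed
  then have "sign_avg (walk_edges q V j (Suc k)) (\<lambda>\<xi>. frob2 C ?S' (\<lambda>a. walk q V j \<xi> (f a) (Suc k))) \<xi> \<le>
      sign_avg (walk_edges q V j k) (\<lambda>\<xi>. real n * (6 * real n) ^ q (Suc (j + k)) * ?F \<xi>) \<xi>"
    unfolding sign_avg_walk_step inner[abs_def] by (intro sign_avg_mono)
  also have "\<dots> \<le> real n * (6 * real n) ^ q (Suc (j + k)) *
      (real n ^ k * (6 * real n) ^ (\<Sum>i=1..k. q (j + i)) * frob2 C (V (Spine j)) f)"
    unfolding sign_avg_cmult using Suc by (intro mult_left_mono) auto
  finally show ?case by (simp add: power_add mult_ac)
qed

lemma sign_avg_sqrt_fourth_le:
  "sign_avg (leaf_edges q V k) (\<lambda>\<xi>. sqrt (\<Sum>y\<in>V (Spine k). leaf_prod q V k \<xi> y ^ 4)) \<xi>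
    \<le> sqrt n * 12 ^ q k * real n ^ q k"
proof -
  have "sign_avg (leaf_edges q V k) (\<lambda>\<xi>. sqrt (\<Sum>y\<in>V (Spine k). leaf_prod q V k \<xi> y ^ 4)) \<xi> \<le>
      sqrt (sign_avg (leaf_edges q V k) (\<lambda>\<xi>. \<Sum>y\<in>V (Spine k). leaf_prod q V k \<xi> y ^ (2 * 2)) \<xi>)"
    using sign_avg_sqrt_le[of "leaf_edges q V k" "\<lambda>\<xi>. \<Sum>y\<in>V (Spine k). leaf_prod q V k \<xi> y ^ 4" \<xi>]
    by (simp add: sum_nonneg)
  also have "\<dots> \<le> sqrt (real n * ((12 * real n) ^ q k)\<^sup>2)"
  proof (intro real_sqrt_le_mono)
    have "sign_avg (leaf_edges q V k) (\<lambda>\<xi>. \<Sum>y\<in>V (Spine k). leaf_prod q V k \<xi> y ^ (2 * 2)) \<xi> \<le>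
        (\<Sum>y\<in>V (Spine k). (6 * real 2 * real n) ^ (2 * q k))"
      unfolding sign_avg_sum by (intro sum_mono sign_avg_leaf_prod_moment_le) auto
    also have "\<dots> \<le> real n * (12 * real n) ^ (2 * q k)"
      using card_class_le by (simp add: mult_right_mono)
    finally show "sign_avg (leaf_edges q V k) (\<lambda>\<xi>. \<Sum>y\<in>V (Spine k). leaf_prod q V k \<xi> y ^ (2 * 2)) \<xi>
        \<le> real n * ((12 * real n) ^ q k)\<^sup>2" by (simp only: power_even_eq)
  qed
  also have "\<dots> = sqrt n * 12 ^ q k * real n ^ q k"
    by (simp add: real_sqrt_mult power_mult_distrib)
  finally show ?thesis .
qed

end

lemma indicator_square: "(if P then 1 else 0 :: real)\<^sup>2 = (if P then 1 else 0)"
  by simp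

section \<open>Growth of the operator norm along the chain\<close>

context label_classes
begin

text \<open>The weighted column bound is applied with threshold \<delta> equal to the typical size
  of a diagonal entry, \<open>n\<close> to the power \<open>Q/2\<close>. For this choice the
  fourth-moment term has an average of the same order as \<open>\<delta> * sqrt n\<close>, so the
  factor of the operator norm carries no logarithm; the maximum of the diagonal multiplies the
  Frobenius norm only.\<close>

lemma sign_avg_walk_norm_step:
  fixes j k q
  defines "Q \<equiv> q (Suc (j + k))"
  assumes n: "3 \<le> n" and C: "finite C"
  shows "sign_avg (leaf_edges q V (Suc (j + k))) (sign_avg (spine_edges V (j + k))
      (\<lambda>\<xi>. op_norm C (V (Spine (Suc (j + k)))) (\<lambda>a. walk q V j \<xi> (f a) (Suc k)))) \<xi>
    \<le> 24 * (sqrt n ^ Q + 2 * 4 ^ Q * sqrt (ln n) ^ Q * sqrt n ^ Q) *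
        sqrt (frob2 C (V (Spine (j + k))) (\<lambda>a. walk q V j \<xi> (f a) k)) +
      136 * (1 + 12 ^ Q) * (sqrt n * sqrt n ^ Q) *
        op_norm C (V (Spine (j + k))) (\<lambda>a. walk q V j \<xi> (f a) k)"
proof -
  let ?S = "V (Spine (j + k))" and ?S' = "V (Spine (Suc (j + k)))"
  let ?J = "leaf_edges q V (Suc (j + k))"
  define F where "F \<xi> = sqrt (frob2 C ?S (\<lambda>a. walk q V j \<xi> (f a) k))" for \<xi>
  define N where "N \<xi> = op_norm C ?S (\<lambda>a. walk q V j \<xi> (f a) k)" for \<xi>
  define D where "D \<xi> = leaf_prod q V (Suc (j + k)) \<xi>" for \<xi>
  define R where "R \<xi> = sqrt (\<Sum>y\<in>?S'. D \<xi> y ^ 4)" for \<xi>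
  define \<delta> where "\<delta> = sqrt n ^ Q"
  have \<delta>: "0 < \<delta>" using n by (simp add: \<delta>_def)
  obtain g where g: "\<And>\<xi> y. y \<in> ?S' \<Longrightarrow> \<bar>D \<xi> y\<bar> \<le> g \<xi>" "\<And>\<xi>. 0 \<le> g \<xi>"
    "\<And>\<xi>. sign_avg ?J g \<xi> \<le> 2 * 4 ^ Q * sqrt (ln n) ^ Q * sqrt n ^ Q"
    using ex_leaf_prod_max[OF n, of "Suc (j + k)" q] unfolding D_def Q_def by blast
  have inner: "sign_avg (spine_edges V (j + k)) (\<lambda>\<xi>. op_norm C ?S' (\<lambda>a. walk q V j \<xi> (f a) (Suc k))) \<xi>
      \<le> 24 * (\<delta> + g \<xi>) * F \<xi> + 136 * (\<delta> * sqrt (real (card ?S')) + R \<xi> / \<delta>) * N \<xi>" for \<xi>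
  proof -
    have "sign_avg (spine_edges V (j + k)) (\<lambda>\<xi>. op_norm C ?S' (\<lambda>a. walk q V j \<xi> (f a) (Suc k))) \<xi> =
        sign_avg (spine_edges V (j + k))
          (\<lambda>\<xi>'. op_norm C ?S' (\<lambda>a y. (\<Sum>x\<in>?S. walk q V j \<xi> (f a) k x * \<xi>' {x, y}) * D \<xi> y)) \<xi>"
      unfolding D_def
      by (intro sign_avg_cong op_norm_cong)
         (simp add: walk_agree_spine leaf_prod_agree_spine cong: sum.cong)
    also have "\<dots> \<le> 24 * (\<delta> + g \<xi>) * F \<xi> + 136 * (\<delta> * sqrt (real (card ?S')) + R \<xi> / \<delta>) * N \<xi>"
      unfolding spine_edges_def F_def N_def R_def
      by (rule sign_avg_op_norm_weighted_le[where e = "\<lambda>x y. {x, y}"])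
         (use C \<delta> g inj_pair_classes in auto)
    finally show ?thesis .
  qed
  have F: "F \<xi>' = F \<xi>" and N: "N \<xi>' = N \<xi>" if "agree_off ?J \<xi> \<xi>'" for \<xi> \<xi>'
    unfolding F_def N_def frob2_def using that
    by (auto simp: walk_agree_leaf intro!: op_norm_cong cong: sum.cong)
  have "sign_avg ?J (sign_avg (spine_edges V (j + k)) (\<lambda>\<xi>. op_norm C ?S' (\<lambda>a. walk q V j \<xi> (f a) (Suc k)))) \<xi>
      \<le> sign_avg ?J (\<lambda>\<xi>. 24 * (\<delta> + g \<xi>) * F \<xi> + 136 * (\<delta> * sqrt (real (card ?S')) + R \<xi> / \<delta>) * N \<xi>) \<xi>"
    by (intro sign_avg_mono inner)
  also have "\<dots> = sign_avg ?J (\<lambda>\<xi>'. 24 * F \<xi> * (\<delta> + g \<xi>') + 136 * N \<xi> * (\<delta> * sqrt (real (card ?S')) + 1 / \<delta> * R \<xi>')) \<xi>"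
    using F N by (intro sign_avg_cong) (simp add: algebra_simps)
  also have "\<dots> = 24 * F \<xi> * (\<delta> + sign_avg ?J g \<xi>) +
      136 * N \<xi> * (\<delta> * sqrt (real (card ?S')) + 1 / \<delta> * sign_avg ?J R \<xi>)"
    by (simp only: sign_avg_add sign_avg_cmult sign_avg_const finite_leaf_edges)
  also have "\<dots> \<le> 24 * F \<xi> * (\<delta> + 2 * 4 ^ Q * sqrt (ln n) ^ Q * sqrt n ^ Q) +
      136 * N \<xi> * (\<delta> * sqrt n + 1 / \<delta> * (sqrt n * 12 ^ Q * real n ^ Q))"
  proof (rule add_mono; rule mult_left_mono)
    show "\<delta> + sign_avg ?J g \<xi> \<le> \<delta> + 2 * 4 ^ Q * sqrt (ln n) ^ Q * sqrt n ^ Q" using g(3) by simp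
    show "\<delta> * sqrt (real (card ?S')) + 1 / \<delta> * sign_avg ?J R \<xi> \<le> \<delta> * sqrt n + 1 / \<delta> * (sqrt n * 12 ^ Q * real n ^ Q)"
    proof (rule add_mono; rule mult_left_mono)
      show "sqrt (real (card ?S')) \<le> sqrt n" using card_class_le by simp
      show "sign_avg ?J R \<xi> \<le> sqrt n * 12 ^ Q * real n ^ Q"
        unfolding R_def[abs_def] D_def Q_def by (rule sign_avg_sqrt_fourth_le)
    qed (use \<delta> in auto)
  qed (auto simp: F_def N_def)
  also have "1 / \<delta> * (sqrt n * 12 ^ Q * real n ^ Q) = sqrt n * 12 ^ Q * \<delta>"
  proof -
    have "real n ^ Q = \<delta> * \<delta>" by (simp add: \<delta>_def flip: power_mult_distrib)
    then show ?thesis using \<delta> by simp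
  qed
  finally show ?thesis by (simp add: F_def N_def \<delta>_def algebra_simps)
qed

end

text \<open>In the inductive step the operator norm, with its factor \<open>sqrt (ln n) ^ m\<close>,
  is multiplied by a constant times the expected power of \<open>sqrt n\<close>. The Frobenius term
  contributes \<open>sqrt (ln n) ^ Q\<close> afresh, and \<open>Q \<le> m\<close>. The two add up to
  the same form, with a constant that is uniform in \<open>n\<close>, the classes and the base
  point.\<close>

lemma walk_norm_bound:
  assumes "\<And>i. 1 \<le> i \<Longrightarrow> i \<le> k \<Longrightarrow> q i \<le> m"
  shows "\<exists>C\<ge>0. \<forall>n V \<xi>. label_classes n V \<longrightarrow> 3 \<le> n \<longrightarrow>
    sign_avg (walk_edges q V 0 k) (\<lambda>\<xi>. op_norm (V (Spine 0)) (V (Spine k))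
      (\<lambda>a. walk q V 0 \<xi> (\<lambda>y. if a = y then 1 else 0) k)) \<xi>
    \<le> C * sqrt n ^ (k + (\<Sum>i=1..k. q i)) * sqrt (ln n) ^ m"
  using assms
proof (induction k)
  case 0
  show ?case
  proof (intro exI[of _ 1] conjI allI impI)
    fix n :: nat and V :: "chain_vertex \<Rightarrow> nat set" and \<xi>
    assume V: "label_classes n V" and n: "3 \<le> n"
    then interpret label_classes n V by simp
    have "op_norm (V (Spine 0)) (V (Spine 0)) (\<lambda>a y. if a = y then 1 else 0) \<le> 1"
      by (rule op_norm_leI) (auto simp: if_distrib if_distribR cong: if_cong L2_set_cong)
    moreover have "1 \<le> sqrt (ln n) ^ m"
      using n exp_le ln_ge_iff[of "real n" 1] by (intro one_le_power) simp
    ultimately show "sign_avg (walk_edges q V 0 0) (\<lambda>\<xi>. op_norm (V (Spine 0)) (V (Spine 0))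
      (\<lambda>a. walk q V 0 \<xi> (\<lambda>y. if a = y then 1 else 0) 0)) \<xi>
    \<le> 1 * sqrt n ^ (0 + (\<Sum>i=1..0. q i)) * sqrt (ln n) ^ m"
      by (simp add: walk_edges_def)
  qed simp
next
  case (Suc k)
  define Q where "Q = q (Suc k)"
  define P where "P = (\<Sum>i=1..k. q i)"
  have Qm: "Q \<le> m" using Suc.prems[of "Suc k"] by (simp add: Q_def)
  obtain C where C: "C \<ge> 0" "\<And>n V \<xi>. label_classes n V \<Longrightarrow> 3 \<le> n \<Longrightarrow>
    sign_avg (walk_edges q V 0 k) (\<lambda>\<xi>. op_norm (V (Spine 0)) (V (Spine k))
      (\<lambda>a. walk q V 0 \<xi> (\<lambda>y. if a = y then 1 else 0) k)) \<xi>
    \<le> C * sqrt n ^ (k + P) * sqrt (ln n) ^ m"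
    using Suc unfolding P_def by force
  define C' where "C' = 24 * (1 + 2 * 4 ^ Q) * 3 ^ P + 136 * (1 + 12 ^ Q) * C"
  show ?case
  proof (intro exI[of _ C'] conjI allI impI)
    show "C' \<ge> 0" using C by (simp add: C'_def)
    fix n :: nat and V :: "chain_vertex \<Rightarrow> nat set" and \<xi>
    assume V: "label_classes n V" and n: "3 \<le> n"
    then interpret label_classes n V by simp
    define \<iota> :: "nat \<Rightarrow> nat \<Rightarrow> real" where "\<iota> a y = (if a = y then 1 else 0)" for a y
    then have \<iota>: "\<iota> = (\<lambda>a y. if a = y then 1 else 0)" by (simp add: fun_eq_iff)
    let ?W = "walk_edges q V 0 k"
    define s l where "s = sqrt (real n)" and "l = sqrt (ln (real n))"
    have l: "1 \<le> l" using n exp_le ln_ge_iff[of "real n" 1] by (simp add: l_def)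
    have s: "1 \<le> s" using n by (simp add: s_def)
    have lQ: "l ^ Q \<le> l ^ m" "1 \<le> l ^ m" using l Qm by (auto intro: power_increasing one_le_power)
    define F where "F \<xi> = sqrt (frob2 (V (Spine 0)) (V (Spine k)) (\<lambda>a. walk q V 0 \<xi> (\<iota> a) k))" for \<xi>
    define N where "N \<xi> = op_norm (V (Spine 0)) (V (Spine k)) (\<lambda>a. walk q V 0 \<xi> (\<iota> a) k)" for \<xi>
    have FF: "sign_avg ?W F \<xi> \<le> 3 ^ P * s ^ Suc (k + P)"
    proof -
      have "sign_avg ?W F \<xi> \<le> sqrt (sign_avg ?W (\<lambda>\<xi>. frob2 (V (Spine 0)) (V (Spine k)) (\<lambda>a. walk q V 0 \<xi> (\<iota> a) k)) \<xi>)"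
        unfolding F_def by (rule sign_avg_sqrt_le) auto
      also have "\<dots> \<le> sqrt ((3 ^ P * s ^ Suc (k + P))\<^sup>2)"
      proof (rule real_sqrt_le_mono)
        \<comment> \<open>The identity has squared Frobenius norm at most \<open>n\<close>. This is
          the additional \<open>sqrt n\<close> that the Frobenius estimate has over the operator
          norm, and it replaces the \<open>sqrt n\<close> missing from the Frobenius coefficient of
          the step.\<close>
        have fr: "frob2 (V (Spine 0)) (V (Spine 0)) \<iota> \<le> real n"
          using card_class_le[of "Spine 0"] by (simp add: frob2_def \<iota>_def indicator_square)
        have "sign_avg ?W (\<lambda>\<xi>. frob2 (V (Spine 0)) (V (Spine k)) (\<lambda>a. walk q V 0 \<xi> (\<iota> a) k)) \<xi>
            \<le> real n ^ k * (6 * real n) ^ P * frob2 (V (Spine 0)) (V (Spine 0)) \<iota>"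
          using sign_avg_walk_frob2_le[of q 0 k "V (Spine 0)" \<iota> \<xi>] by (simp add: P_def)
        also have "\<dots> \<le> real n ^ k * (9 * real n) ^ P * real n"
          using fr by (intro mult_mono power_mono) auto
        also have "\<dots> = (9::real) ^ P * (s\<^sup>2) ^ (Suc (k + P))"
          by (simp add: s_def power_add power_mult_distrib mult_ac)
        also have "\<dots> = (3 ^ P * s ^ Suc (k + P))\<^sup>2"
        proof -
          have "(9::real) ^ P = (3 ^ P)\<^sup>2" by (simp add: power2_eq_square flip: power_mult_distrib)
          then show ?thesis by (simp only: power_mult_distrib power_mult[symmetric] mult.commute)
        qed
        finally show "sign_avg ?W (\<lambda>\<xi>. frob2 (V (Spine 0)) (V (Spine k)) (\<lambda>a. walk q V 0 \<xi> (\<iota> a) k)) \<xi>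
            \<le> (3 ^ P * s ^ Suc (k + P))\<^sup>2" .
      qed
      also have "\<dots> = 3 ^ P * s ^ Suc (k + P)" using s by (simp add: abs_mult)
      finally show ?thesis .
    qed
    have NN: "sign_avg ?W N \<xi> \<le> C * s ^ (k + P) * l ^ m"
      unfolding N_def \<iota>_def s_def l_def by (rule C(2)[OF V n])
    have "sign_avg (walk_edges q V 0 (Suc k)) (\<lambda>\<xi>. op_norm (V (Spine 0)) (V (Spine (Suc k)))
        (\<lambda>a. walk q V 0 \<xi> (\<iota> a) (Suc k))) \<xi> \<le>
      sign_avg ?W (\<lambda>\<xi>. 24 * (s ^ Q + 2 * 4 ^ Q * l ^ Q * s ^ Q) * F \<xi> + 136 * (1 + 12 ^ Q) * (s * s ^ Q) * N \<xi>) \<xi>"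
      unfolding sign_avg_walk_step F_def N_def s_def l_def Q_def
      using sign_avg_walk_norm_step[OF n, of "V (Spine 0)" q 0 k \<iota>]
      by (intro sign_avg_mono) simp
    also have "\<dots> = 24 * (s ^ Q + 2 * 4 ^ Q * l ^ Q * s ^ Q) * sign_avg ?W F \<xi> + 136 * (1 + 12 ^ Q) * (s * s ^ Q) * sign_avg ?W N \<xi>"
      by (simp only: sign_avg_add sign_avg_cmult)
    also have "\<dots> \<le> 24 * (s ^ Q * l ^ m + 2 * 4 ^ Q * l ^ m * s ^ Q) * (3 ^ P * s ^ Suc (k + P)) +
        136 * (1 + 12 ^ Q) * (s * s ^ Q) * (C * s ^ (k + P) * l ^ m)"
    proof (rule add_mono)
      show "24 * (s ^ Q + 2 * 4 ^ Q * l ^ Q * s ^ Q) * sign_avg ?W F \<xi> \<le>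
          24 * (s ^ Q * l ^ m + 2 * 4 ^ Q * l ^ m * s ^ Q) * (3 ^ P * s ^ Suc (k + P))"
      proof (rule mult_mono[OF _ FF])
        have a: "s ^ Q \<le> s ^ Q * l ^ m" using s lQ mult_left_mono[of 1 "l ^ m" "s ^ Q"] by simp
        have b: "2 * 4 ^ Q * l ^ Q * s ^ Q \<le> 2 * 4 ^ Q * l ^ m * s ^ Q"
          using s lQ by (intro mult_right_mono mult_left_mono) auto
        show "24 * (s ^ Q + 2 * 4 ^ Q * l ^ Q * s ^ Q) \<le> 24 * (s ^ Q * l ^ m + 2 * 4 ^ Q * l ^ m * s ^ Q)"
          by (rule mult_left_mono[OF add_mono[OF a b]]) simp
        show "0 \<le> sign_avg ?W F \<xi>" by (intro sign_avg_nonneg) (simp add: F_def)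
      qed (use s l in auto)
      show "136 * (1 + 12 ^ Q) * (s * s ^ Q) * sign_avg ?W N \<xi> \<le> 136 * (1 + 12 ^ Q) * (s * s ^ Q) * (C * s ^ (k + P) * l ^ m)"
        using s NN by (intro mult_left_mono) auto
    qed
    also have "\<dots> = C' * s ^ (Suc k + (P + Q)) * l ^ m"
      by (simp add: C'_def power_add algebra_simps)
    finally show "sign_avg (walk_edges q V 0 (Suc k)) (\<lambda>\<xi>. op_norm (V (Spine 0)) (V (Spine (Suc k)))
      (\<lambda>a. walk q V 0 \<xi> (\<lambda>y. if a = y then 1 else 0) (Suc k))) \<xi>
      \<le> C' * sqrt n ^ (Suc k + (\<Sum>i=1..Suc k. q i)) * sqrt (ln n) ^ m"
      by (simp add: \<iota> s_def l_def P_def Q_def)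
  qed
qed

section \<open>Lower bounds for chains with disjoint label classes\<close>

lemma sum_abs_le_sqrt_card: "finite X \<Longrightarrow> (\<Sum>x\<in>X. \<bar>w x :: real\<bar>) \<le> sqrt (card X) * sqrt (\<Sum>x\<in>X. (w x)\<^sup>2)"
  using abs_sum_mult_le_L2[of "\<lambda>_. 1" "\<lambda>x. \<bar>w x\<bar>" X] by (simp add: L2_set_def)

context label_classes
begin

lemma sign_avg_abs_leaf_prod_ge:
  assumes y: "y \<in> V (Spine k)" and card: "\<And>l. l < q k \<Longrightarrow> card (V (Leaf k l)) = m"
  shows "(9 / 16 * sqrt m) ^ q k \<le> sign_avg (leaf_edges q V k) (\<lambda>\<xi>. \<bar>leaf_prod q V k \<xi> y\<bar>) \<xi>"
proof -
  have "sign_avg (leaf_edges q V k) (\<lambda>\<xi>. \<bar>leaf_prod q V k \<xi> y\<bar>) \<xi> =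
    (\<Prod>l<q k. sign_avg ((\<lambda>z. {y, z}) ` V (Leaf k l)) (\<lambda>\<xi>. \<bar>\<Sum>e\<in>(\<lambda>z. {y, z}) ` V (Leaf k l). \<xi> e\<bar>) \<xi>)"
    by (rule sign_avg_leaf_prod_multiplicative[OF y]) (simp add: leaf_prod_def abs_prod)
  moreover have "(\<Prod>l<q k. 9 / 16 * sqrt m) \<le>
    (\<Prod>l<q k. sign_avg ((\<lambda>z. {y, z}) ` V (Leaf k l)) (\<lambda>\<xi>. \<bar>\<Sum>e\<in>(\<lambda>z. {y, z}) ` V (Leaf k l). \<xi> e\<bar>) \<xi>)"
  proof (intro prod_mono conjI)
    fix l assume "l \<in> {..<q k}"
    then have c: "card ((\<lambda>z. {y, z}) ` V (Leaf k l)) = m"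
      using card[of l] by (subst card_image) (auto simp: inj_on_def doubleton_eq_iff)
    show "9 / 16 * sqrt m \<le> sign_avg ((\<lambda>z. {y, z}) ` V (Leaf k l)) (\<lambda>\<xi>. \<bar>\<Sum>e\<in>(\<lambda>z. {y, z}) ` V (Leaf k l). \<xi> e\<bar>) \<xi>"
      using sign_avg_abs_linear_ge[of "(\<lambda>z. {y, z}) ` V (Leaf k l)" "\<lambda>_. 1" \<xi>] c by simp
  qed simp
  ultimately show ?thesis by simp
qed

text \<open>Given the walk so far, the new entry is a linear form in fresh signs times an
  independent diagonal entry; the \<open>L\<^sub>1\<close> Khintchine inequality applies to the form
  and to each leaf sum.\<close>

lemma sign_avg_abs_walk_step_ge:
  fixes j k q
  defines "Q \<equiv> q (Suc (j + k))"
  assumes y: "y \<in> V (Spine (Suc (j + k)))" and card: "\<And>l. l < Q \<Longrightarrow> card (V (Leaf (Suc (j + k)) l)) = m"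
  shows "9 / 16 * sqrt (\<Sum>x\<in>V (Spine (j + k)). (walk q V j \<xi> f k x)\<^sup>2) * (9 / 16 * sqrt m) ^ Q \<le>
    sign_avg (leaf_edges q V (Suc (j + k))) (sign_avg (spine_edges V (j + k)) (\<lambda>\<xi>. \<bar>walk q V j \<xi> f (Suc k) y\<bar>)) \<xi>"
proof -
  let ?S = "V (Spine (j + k))" and ?J = "leaf_edges q V (Suc (j + k))"
  define D where "D \<xi> = \<bar>leaf_prod q V (Suc (j + k)) \<xi> y\<bar>" for \<xi>
  define F where "F \<xi> = sqrt (\<Sum>x\<in>?S. (walk q V j \<xi> f k x)\<^sup>2)" for \<xi>
  have inner: "9 / 16 * F \<xi> * D \<xi> \<le> sign_avg (spine_edges V (j + k)) (\<lambda>\<xi>. \<bar>walk q V j \<xi> f (Suc k) y\<bar>) \<xi>" for \<xi>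
  proof -
    have sub: "(\<lambda>x. {x, y}) ` ?S \<subseteq> spine_edges V (j + k)" using y by (auto simp: spine_edges_def)
    have inj: "inj_on (\<lambda>x. {x, y}) ?S" by (auto simp: inj_on_def doubleton_eq_iff)
    have "9 / 16 * F \<xi> * D \<xi> \<le>
        sign_avg (spine_edges V (j + k)) (\<lambda>\<xi>'. \<bar>\<Sum>x\<in>?S. walk q V j \<xi> f k x * \<xi>' {x, y}\<bar>) \<xi> * D \<xi>"
      unfolding F_def using sign_avg_linear_image(2)[OF finite_spine_edges sub inj]
      by (intro mult_right_mono) (auto simp: D_def)
    also have "\<dots> = sign_avg (spine_edges V (j + k)) (\<lambda>\<xi>. \<bar>walk q V j \<xi> f (Suc k) y\<bar>) \<xi>"
      unfolding sign_avg_cmult_right[symmetric] D_def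
      by (intro sign_avg_cong)
         (simp add: walk_agree_spine leaf_prod_agree_spine[OF _ y] abs_mult cong: sum.cong)
    finally show ?thesis .
  qed
  have "9 / 16 * F \<xi> * (9 / 16 * sqrt m) ^ Q \<le> 9 / 16 * F \<xi> * sign_avg ?J D \<xi>"
    unfolding D_def Q_def using y card
    by (intro mult_left_mono sign_avg_abs_leaf_prod_ge) (auto simp: F_def Q_def sum_nonneg)
  also have "\<dots> = sign_avg ?J (\<lambda>\<xi>. 9 / 16 * F \<xi> * D \<xi>) \<xi>"
    by (subst sign_avg_factor) (auto simp: F_def walk_agree_leaf cong: sum.cong)
  also have "\<dots> \<le> sign_avg ?J (sign_avg (spine_edges V (j + k)) (\<lambda>\<xi>. \<bar>walk q V j \<xi> f (Suc k) y\<bar>)) \<xi>"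
    by (intro sign_avg_mono inner)
  finally show ?thesis by (simp add: F_def)
qed

text \<open>First absolute moments can be propagated by averages alone: Khintchine bounds a new
  entry below by the Euclidean length of the previous row, and Cauchy-Schwarz bounds that length
  below by the sum of absolute entries divided by \<open>sqrt m\<close>, a net gain of
  \<open>sqrt m\<close> per step. The unit vector at the start has a single nonzero entry and gains
  nothing, hence the exponent \<open>k\<close> after \<open>Suc k\<close> steps.\<close>

lemma sign_avg_abs_walk_ge:
  assumes x0: "x0 \<in> V (Spine j)"
    and spine: "\<And>i. 1 \<le> i \<Longrightarrow> i \<le> k \<Longrightarrow> card (V (Spine (j + i))) = m"
    and leaf: "\<And>i l. 1 \<le> i \<Longrightarrow> i \<le> Suc k \<Longrightarrow> l < q (j + i) \<Longrightarrow> card (V (Leaf (j + i) l)) = m"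
    and y: "y \<in> V (Spine (j + Suc k))" and m: "1 \<le> m"
  shows "(9 / 16) ^ Suc k * (9 / 16) ^ (\<Sum>i=1..Suc k. q (j + i)) * sqrt m ^ (k + (\<Sum>i=1..Suc k. q (j + i)))
    \<le> sign_avg (walk_edges q V j (Suc k)) (\<lambda>\<xi>. \<bar>walk q V j \<xi> (\<lambda>x. if x = x0 then 1 else 0) (Suc k) y\<bar>) \<xi>"
  using spine leaf y
proof (induction k arbitrary: y \<xi>)
  case 0
  have "(\<Sum>x\<in>V (Spine j). ((if x = x0 then 1 else 0)::real)\<^sup>2) = 1"
    using x0 by (simp add: indicator_square)
  moreover have "card (V (Leaf (Suc (j + 0)) l)) = m" if "l < q (Suc (j + 0))" for l
    using "0.prems"(2)[of 1 l] that by simp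
  ultimately have "9 / 16 * (9 / 16 * sqrt m) ^ q (Suc j) \<le>
      sign_avg (walk_edges q V j (Suc 0)) (\<lambda>\<xi>. \<bar>walk q V j \<xi> (\<lambda>x. if x = x0 then 1 else 0) (Suc 0) y\<bar>) \<xi>"
    using sign_avg_abs_walk_step_ge[of y j 0 q m \<xi> "\<lambda>x. if x = x0 then 1 else 0"] "0.prems"(3)
    unfolding sign_avg_walk_step[of q j 0] by (simp add: walk_edges_def)
  moreover have "9 / 16 * (9 / 16 * sqrt m) ^ q (Suc j) =
      (9 / 16) ^ Suc 0 * (9 / 16) ^ (\<Sum>i=1..Suc 0. q (j + i)) * sqrt m ^ (0 + (\<Sum>i=1..Suc 0. q (j + i)))"
    by (simp only: power_mult_distrib) simp
  ultimately show ?case by simp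
next
  case (Suc k)
  let ?f = "\<lambda>x. if x = x0 then 1 else (0::real)"
  let ?S = "V (Spine (j + Suc k))" and ?Q = "q (j + Suc (Suc k))"
  define w where "w = (9 / 16) ^ Suc k * (9 / 16) ^ (\<Sum>i=1..Suc k. q (j + i)) * sqrt m ^ (k + (\<Sum>i=1..Suc k. q (j + i)))"
  have cS: "card ?S = m" using Suc.prems(1)[of "Suc k"] by simp
  have IH: "w \<le> sign_avg (walk_edges q V j (Suc k)) (\<lambda>\<xi>. \<bar>walk q V j \<xi> ?f (Suc k) x\<bar>) \<xi>" if "x \<in> ?S" for x \<xi>
    unfolding w_def using that Suc.prems by (intro Suc.IH) auto
  define c where "c = 9 / 16 * (9 / 16 * sqrt m) ^ ?Q"
  have c: "0 \<le> c" by (simp add: c_def)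
  have sm: "sqrt m > 0" using m by simp
  have "c * (sqrt m * w) = c / sqrt m * (real m * w)"
    using sm by (simp add: field_simps)
  also have "\<dots> = c / sqrt m * (\<Sum>x\<in>?S. w)" by (simp add: cS[simplified])
  also have "\<dots> \<le> c / sqrt m * (\<Sum>x\<in>?S. sign_avg (walk_edges q V j (Suc k)) (\<lambda>\<xi>. \<bar>walk q V j \<xi> ?f (Suc k) x\<bar>) \<xi>)"
    using c sm by (intro mult_left_mono sum_mono IH) auto
  also have "\<dots> = sign_avg (walk_edges q V j (Suc k)) (\<lambda>\<xi>. c / sqrt m * (\<Sum>x\<in>?S. \<bar>walk q V j \<xi> ?f (Suc k) x\<bar>)) \<xi>"
    by (simp only: sign_avg_cmult sign_avg_sum)
  also have "\<dots> \<le> sign_avg (walk_edges q V j (Suc (Suc k))) (\<lambda>\<xi>. \<bar>walk q V j \<xi> ?f (Suc (Suc k)) y\<bar>) \<xi>"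
    unfolding sign_avg_walk_step[of q j "Suc k"]
  proof (intro sign_avg_mono)
    fix \<xi>
    have "c / sqrt m * (\<Sum>x\<in>?S. \<bar>walk q V j \<xi> ?f (Suc k) x\<bar>) \<le>
        c / sqrt m * (sqrt m * sqrt (\<Sum>x\<in>?S. (walk q V j \<xi> ?f (Suc k) x)\<^sup>2))"
      using c sm sum_abs_le_sqrt_card[of ?S "walk q V j \<xi> ?f (Suc k)"] unfolding cS by (intro mult_left_mono) auto
    also have "\<dots> = 9 / 16 * sqrt (\<Sum>x\<in>?S. (walk q V j \<xi> ?f (Suc k) x)\<^sup>2) * (9 / 16 * sqrt m) ^ ?Q"
      using sm by (simp add: c_def)
    also have "\<dots> \<le> sign_avg (leaf_edges q V (Suc (j + Suc k)))
        (sign_avg (spine_edges V (j + Suc k)) (\<lambda>\<xi>. \<bar>walk q V j \<xi> ?f (Suc (Suc k)) y\<bar>)) \<xi>"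
    proof -
      have "card (V (Leaf (Suc (j + Suc k)) l)) = m" if "l < q (Suc (j + Suc k))" for l
        using Suc.prems(2)[of "Suc (Suc k)" l] that by simp
      then show ?thesis
        using sign_avg_abs_walk_step_ge[of y j "Suc k" q m \<xi> ?f] Suc.prems(3) by simp
    qed
    finally show "c / sqrt m * (\<Sum>x\<in>?S. \<bar>walk q V j \<xi> ?f (Suc k) x\<bar>) \<le>
      sign_avg (leaf_edges q V (Suc (j + Suc k)))
        (sign_avg (spine_edges V (j + Suc k)) (\<lambda>\<xi>. \<bar>walk q V j \<xi> ?f (Suc (Suc k)) y\<bar>)) \<xi>" .
  qed
  finally have "c * (sqrt m * w) \<le>
    sign_avg (walk_edges q V j (Suc (Suc k))) (\<lambda>\<xi>. \<bar>walk q V j \<xi> ?f (Suc (Suc k)) y\<bar>) \<xi>" .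
  moreover have "c * (sqrt m * w) = (9 / 16) ^ Suc (Suc k) * (9 / 16) ^ (\<Sum>i=1..Suc (Suc k). q (j + i)) *
      sqrt m ^ (Suc k + (\<Sum>i=1..Suc (Suc k). q (j + i)))"
    by (simp only: c_def w_def power_mult_distrib) (simp add: power_add mult_ac)
  ultimately show ?case by simp
qed

end

section \<open>Extraction of one term from a sum with random signs\<close>

lemma sign_avg_swap:
  "sign_avg X (\<lambda>\<epsilon>. sign_avg J (\<lambda>\<xi>. h \<epsilon> \<xi>) \<xi>0) \<epsilon>0 = sign_avg J (\<lambda>\<xi>. sign_avg X (\<lambda>\<epsilon>. h \<epsilon> \<xi>) \<epsilon>0) \<xi>0"
  unfolding sign_avg_def by (simp add: sum_divide_distrib[symmetric] mult.commute) (subst sum.swap, simp)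

text \<open>A sign vector and the one obtained by flipping all signs except that of
  \<open>x0\<close> have sums in which the other terms cancel. Both vectors have the same
  distribution, so the triangle inequality gives the claim.\<close>

lemma op_norm_le_sign_avg_sum:
  assumes "finite X" "finite J" "x0 \<in> X"
  shows "op_norm I J (B x0) \<le> sign_avg X (\<lambda>\<epsilon>. op_norm I J (\<lambda>a b. \<Sum>x\<in>X. \<epsilon> x * B x a b)) \<epsilon>0"
proof -
  define N where "N \<epsilon> = op_norm I J (\<lambda>a b. \<Sum>x\<in>X. \<epsilon> x * B x a b)" for \<epsilon>
  define s where "s x = (if x \<in> X - {x0} then -1 else 1 :: real)" for x
  have "sign_avg X (\<lambda>\<epsilon>. N (\<lambda>x. s x * \<epsilon> x)) \<epsilon>0 = sign_avg X N \<epsilon>0"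
    by (rule sign_avg_flip[OF assms(1)]) (auto simp: s_def)
  then have "sign_avg X N \<epsilon>0 = sign_avg X (\<lambda>\<epsilon>. 1 / 2 * (N \<epsilon> + N (\<lambda>x. s x * \<epsilon> x))) \<epsilon>0"
    by (simp only: sign_avg_cmult sign_avg_add) simp
  moreover have "op_norm I J (B x0) \<le> 1 / 2 * (N \<epsilon> + N (\<lambda>x. s x * \<epsilon> x))" if "is_sign X \<epsilon>" for \<epsilon>
  proof -
    define M where "M u a b = (\<Sum>x\<in>X. (if u then \<epsilon> x else s x * \<epsilon> x) * B x a b)" for u a b
    have e: "\<epsilon> x0 = 1 \<or> \<epsilon> x0 = -1" using that assms(3) by (simp add: is_sign_def)
    have "B x0 a b = \<epsilon> x0 / 2 * (\<Sum>u\<in>UNIV. M u a b)" for a b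
    proof -
      have "(\<Sum>u\<in>UNIV. M u a b) = (\<Sum>x\<in>X. (\<epsilon> x + s x * \<epsilon> x) * B x a b)"
        by (simp add: M_def UNIV_bool sum.distrib algebra_simps)
      also have "\<dots> = (\<Sum>x\<in>X. if x = x0 then 2 * \<epsilon> x0 * B x0 a b else 0)"
        by (intro sum.cong) (auto simp: s_def)
      also have "\<dots> = 2 * \<epsilon> x0 * B x0 a b" using assms by simp
      finally show ?thesis using e by auto
    qed
    then have "op_norm I J (B x0) = op_norm I J (\<lambda>a b. \<epsilon> x0 / 2 * (\<Sum>u\<in>UNIV. M u a b))"
      by (intro op_norm_cong)
    also have "\<dots> \<le> \<bar>\<epsilon> x0 / 2\<bar> * op_norm I J (\<lambda>a b. \<Sum>u\<in>UNIV. M u a b)"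
      by (rule op_norm_cmult_le[OF assms(2)])
    also have "\<dots> \<le> \<bar>\<epsilon> x0 / 2\<bar> * (\<Sum>u\<in>UNIV. op_norm I J (M u))"
      using assms by (intro mult_left_mono op_norm_sum_le) auto
    also have "\<dots> = 1 / 2 * (N \<epsilon> + N (\<lambda>x. s x * \<epsilon> x))"
      using e by (auto simp: UNIV_bool N_def M_def[abs_def])
    finally show ?thesis .
  qed
  then have "sign_avg X (\<lambda>_. op_norm I J (B x0)) \<epsilon>0 \<le> sign_avg X (\<lambda>\<epsilon>. 1 / 2 * (N \<epsilon> + N (\<lambda>x. s x * \<epsilon> x))) \<epsilon>0"
    by (intro sign_avg_mono)
  ultimately have "op_norm I J (B x0) \<le> sign_avg X N \<epsilon>0" using assms(1) by simp
  then show ?thesis unfolding N_def[abs_def] .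
qed

lemma op_norm_rank_one_ge:
  assumes "finite J"
  shows "L2_set u I * L2_set w J \<le> op_norm I J (\<lambda>a b. u a * w b)"
proof (cases "L2_set w J = 0")
  case False
  then have w: "0 < L2_set w J" using L2_set_nonneg[of w J] by linarith
  have "(\<Sum>b\<in>J. u a * w b * w b) = (L2_set w J)\<^sup>2 * u a" for a
    unfolding L2_set_power2 by (simp add: sum_distrib_left power2_eq_square mult_ac)
  then have "(L2_set w J)\<^sup>2 * L2_set u I = L2_set (\<lambda>a. \<Sum>b\<in>J. u a * w b * w b) I"
    by (simp add: L2_set_cmult)
  also have "\<dots> \<le> op_norm I J (\<lambda>a b. u a * w b) * L2_set w J"
    by (rule op_norm_bound[OF assms])
  finally show ?thesis using w by (simp add: power2_eq_square mult_ac)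
qed simp

section \<open>Tails of sums of signs\<close>

text \<open>A Paley-Zygmund argument with the first and second moments. With \<open>b\<close> the
  standard deviation, the modulus of the sum is at most \<open>b / 4\<close>, plus a square divided
  by \<open>8 * b\<close>, plus \<open>2 * b\<close> on the event of a deviation by
  \<open>b / 4\<close> in either direction. Averaging gives 9/16 \<le> 1/4 + 1/8 + 4P, by symmetry
  of the two tails.\<close>

lemma sign_avg_sum_tail_block:
  assumes "finite J"
  shows "3 / 64 \<le> sign_avg J (\<lambda>\<xi>. of_bool (sqrt (card J) / 4 \<le> (\<Sum>i\<in>J. \<xi> i))) \<xi>"
proof (cases "card J = 0")
  case True
  then show ?thesis using assms by simp
next
  case False
  define b where "b = sqrt (card J)"
  have b: "0 < b" using False by (simp add: b_def)
  have b2: "b\<^sup>2 = real (card J)" by (simp add: b_def)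
  define P where "P = sign_avg J (\<lambda>\<xi>. of_bool (b / 4 \<le> (\<Sum>i\<in>J. \<xi> i))) \<xi>"
  have "sign_avg J (\<lambda>\<xi>. of_bool (b / 4 \<le> (\<Sum>i\<in>J. (if i \<in> J then -1 else 1) * \<xi> i))) \<xi> = P"
    unfolding P_def by (rule sign_avg_flip[OF assms]) auto
  moreover have "sign_avg J (\<lambda>\<xi>. of_bool (b / 4 \<le> (\<Sum>i\<in>J. (if i \<in> J then -1 else 1) * \<xi> i))) \<xi> =
      sign_avg J (\<lambda>\<xi>. of_bool (b / 4 \<le> - (\<Sum>i\<in>J. \<xi> i))) \<xi>"
    by (simp add: sum_negf cong: sum.cong)
  ultimately have P': "sign_avg J (\<lambda>\<xi>. of_bool (b / 4 \<le> - (\<Sum>i\<in>J. \<xi> i))) \<xi> = P" by simp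
  have pt: "\<bar>S\<bar> \<le> b / 4 + (1 / (8 * b) * S\<^sup>2 + (2 * b) * (of_bool (b / 4 \<le> S) + of_bool (b / 4 \<le> - S)))" for S
  proof -
    have "0 \<le> (\<bar>S\<bar> - 4 * b)\<^sup>2" by simp
    then have "8 * b * \<bar>S\<bar> \<le> S\<^sup>2 + 16 * b\<^sup>2" by (simp add: power2_eq_square algebra_simps)
    then have "\<bar>S\<bar> \<le> 1 / (8 * b) * S\<^sup>2 + 2 * b" using b by (simp add: field_simps power2_eq_square)
    moreover have "0 \<le> 1 / (8 * b) * S\<^sup>2" using b by simp
    ultimately have *: "\<bar>S\<bar> \<le> u + 2 * b" "0 \<le> u" if "u = 1 / (8 * b) * S\<^sup>2" for u
      using that by simp_all
    obtain u where u: "u = 1 / (8 * b) * S\<^sup>2" by simp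
    show ?thesis unfolding u[symmetric]
      using *[OF u] b by (cases "b / 4 \<le> S"; cases "b / 4 \<le> - S") auto
  qed
  have "9 / 16 * b \<le> sign_avg J (\<lambda>\<xi>. \<bar>\<Sum>i\<in>J. 1 * \<xi> i\<bar>) \<xi>"
    using sign_avg_abs_linear_ge[OF assms, of "\<lambda>_. 1" \<xi>] by (simp add: b_def)
  also have "\<dots> \<le> sign_avg J (\<lambda>\<xi>. b / 4 + (1 / (8 * b) * (\<Sum>i\<in>J. 1 * \<xi> i)\<^sup>2 +
      (2 * b) * (of_bool (b / 4 \<le> (\<Sum>i\<in>J. 1 * \<xi> i)) + of_bool (b / 4 \<le> - (\<Sum>i\<in>J. 1 * \<xi> i))))) \<xi>"
    by (intro sign_avg_mono pt)
  also have "\<dots> = b / 4 + (1 / (8 * b) * b\<^sup>2 + (2 * b) * (P + P))"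
    unfolding sign_avg_add sign_avg_cmult sign_avg_linear_sq[OF assms] using assms P'
    by (simp add: P_def b2)
  also have "\<dots> = b * (3 / 8 + 4 * P)" using b by (simp add: power2_eq_square field_simps)
  finally have "b * (9 / 16) \<le> b * (3 / 8 + 4 * P)" by (simp add: mult.commute)
  then have "9 / 16 \<le> 3 / 8 + 4 * P" using b by (simp only: mult_le_cancel_left_pos)
  then show ?thesis by (simp add: P_def b_def)
qed

text \<open>The deviation is forced by \<open>h\<close> independent blocks of \<open>b\<close> signs, each of which deviates by \<open>\<surd>b/4\<close>.\<close>

lemma sign_avg_sum_tail_ge:
  assumes "finite J" "card J = h * b"
  shows "(3 / 64) ^ h \<le> sign_avg J (\<lambda>\<xi>. of_bool (real h * sqrt b / 4 \<le> (\<Sum>i\<in>J. \<xi> i))) \<xi>"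
  using assms
proof (induction h arbitrary: J \<xi>)
  case 0
  then show ?case by simp
next
  case (Suc h)
  obtain J1 where J1: "J1 \<subseteq> J" "card J1 = b"
    using Suc.prems obtain_subset_with_card_n[of b J] by auto
  define J2 where "J2 = J - J1"
  have fin: "finite J1" "finite J2" using Suc.prems J1 finite_subset by (auto simp: J2_def)
  have J: "J = J1 \<union> J2" "J1 \<inter> J2 = {}" using J1 by (auto simp: J2_def)
  have card2: "card J2 = h * b" using Suc.prems J1 fin by (simp add: J2_def card_Diff_subset)
  define A where "A \<xi> = (of_bool (sqrt b / 4 \<le> (\<Sum>i\<in>J1. \<xi> i)) :: real)" for \<xi>
  define B where "B \<xi> = (of_bool (real h * sqrt b / 4 \<le> (\<Sum>i\<in>J2. \<xi> i)) :: real)" for \<xi>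
  have "(3 / 64) ^ Suc h = 3 / 64 * (3 / 64) ^ h" by simp
  also have "\<dots> \<le> sign_avg J1 A \<xi> * (3 / 64) ^ h"
    unfolding A_def using sign_avg_sum_tail_block[OF fin(1)] J1 by (intro mult_right_mono) auto
  also have "\<dots> = sign_avg J1 (\<lambda>\<xi>. A \<xi> * (3 / 64) ^ h) \<xi>" by (rule sign_avg_cmult_right[symmetric])
  also have "\<dots> \<le> sign_avg J1 (\<lambda>\<xi>. A \<xi> * sign_avg J2 B \<xi>) \<xi>"
    unfolding B_def using Suc.IH[OF fin(2) card2] by (intro sign_avg_mono mult_left_mono) (auto simp: A_def)
  also have "\<dots> = sign_avg J1 (sign_avg J2 (\<lambda>\<xi>. A \<xi> * B \<xi>)) \<xi>"
  proof (rule arg_cong[of _ _ "\<lambda>f. sign_avg J1 f \<xi>"], rule ext)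
    fix \<xi>
    have "A \<xi>' = A \<xi>" if "agree_off J2 \<xi> \<xi>'" for \<xi>'
    proof -
      have "(\<Sum>i\<in>J1. \<xi>' i) = (\<Sum>i\<in>J1. \<xi> i)"
        using that J(2) by (intro sum.cong refl) (auto simp: agree_off_def)
      then show ?thesis by (simp add: A_def)
    qed
    then show "A \<xi> * sign_avg J2 B \<xi> = sign_avg J2 (\<lambda>\<xi>. A \<xi> * B \<xi>) \<xi>"
      by (rule sign_avg_factor[symmetric])
  qed
  also have "\<dots> = sign_avg J (\<lambda>\<xi>. A \<xi> * B \<xi>) \<xi>"
    unfolding J(1) using fin J(2) by (rule sign_avg_Un[symmetric])
  also have "\<dots> \<le> sign_avg J (\<lambda>\<xi>. of_bool (real (Suc h) * sqrt b / 4 \<le> (\<Sum>i\<in>J. \<xi> i))) \<xi>"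
  proof (intro sign_avg_mono)
    fix \<xi> :: "'a \<Rightarrow> real"
    have "(\<Sum>i\<in>J. \<xi> i) = (\<Sum>i\<in>J1. \<xi> i) + (\<Sum>i\<in>J2. \<xi> i)"
      unfolding J(1) using fin J(2) by (intro sum.union_disjoint) auto
    then show "A \<xi> * B \<xi> \<le> of_bool (real (Suc h) * sqrt b / 4 \<le> (\<Sum>i\<in>J. \<xi> i))"
      by (auto simp: A_def B_def of_bool_def field_simps)
  qed
  finally show ?case .
qed

section \<open>Lower bound for the typed chain\<close>

context label_classes
begin

lemma walk_linear:
  "b \<in> V (Spine (j + k)) \<Longrightarrow>
    walk q V j \<xi> f k b = (\<Sum>x\<in>V (Spine j). f x * walk q V j \<xi> (\<lambda>y. if y = x then 1 else 0) k b)"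
proof (induction k arbitrary: b)
  case 0
  then show ?case by (simp add: if_distrib cong: if_cong)
next
  case (Suc k)
  have "(\<Sum>x\<in>V (Spine (j + k)). walk q V j \<xi> f k x * \<xi> {x, b}) =
      (\<Sum>x\<in>V (Spine (j + k)). \<Sum>u\<in>V (Spine j). f u * (walk q V j \<xi> (\<lambda>y. if y = u then 1 else 0) k x * \<xi> {x, b}))"
    by (intro sum.cong refl) (subst Suc.IH, auto simp: sum_distrib_left sum_distrib_right mult_ac)
  also have "\<dots> = (\<Sum>u\<in>V (Spine j). f u * (\<Sum>x\<in>V (Spine (j + k)). walk q V j \<xi> (\<lambda>y. if y = u then 1 else 0) k x * \<xi> {x, b}))"
    by (subst sum.swap) (simp add: sum_distrib_left)
  finally have "walk q V j \<xi> f (Suc k) b =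
      (\<Sum>u\<in>V (Spine j). f u * (\<Sum>x\<in>V (Spine (j + k)). walk q V j \<xi> (\<lambda>y. if y = u then 1 else 0) k x * \<xi> {x, b})) *
      leaf_prod q V (Suc (j + k)) \<xi> b" by simp
  also have "\<dots> = (\<Sum>u\<in>V (Spine j). f u * (\<Sum>x\<in>V (Spine (j + k)). walk q V j \<xi> (\<lambda>y. if y = u then 1 else 0) k x * \<xi> {x, b}) *
      leaf_prod q V (Suc (j + k)) \<xi> b)" by (rule sum_distrib_right)
  finally show ?case by (simp add: mult.assoc)
qed

lemma walk_split_first: "walk q V 0 \<xi> f (Suc k) = walk q V (Suc 0) \<xi> (walk q V 0 \<xi> f (Suc 0)) k"
  by (induction k) (simp_all add: fun_eq_iff)

text \<open>Exhibits the product as a sum, over the labels \<open>x\<close> of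
  \<open>x\<^sub>1\<close>, of rank-one matrices weighted by the diagonal entry at \<open>x\<close>.
  The lower bound selects one of these terms.\<close>

lemma walk_unit_eq:
  assumes "a \<in> V (Spine 0)" "b \<in> V (Spine (Suc k))"
  shows "walk q V 0 \<xi> (\<lambda>y. if a = y then 1 else 0) (Suc k) b =
    (\<Sum>x\<in>V (Spine 1). \<xi> {a, x} * leaf_prod q V 1 \<xi> x * walk q V 1 \<xi> (\<lambda>y. if y = x then 1 else 0) k b)"
proof -
  have "walk q V 0 \<xi> (\<lambda>y. if a = y then 1 else 0) (Suc 0) x = \<xi> {a, x} * leaf_prod q V 1 \<xi> x" for x
    using assms(1) by (simp add: if_distrib if_distribR cong: if_cong)
  then have first: "walk q V 0 \<xi> (\<lambda>y. if a = y then 1 else 0) (Suc 0) = (\<lambda>x. \<xi> {a, x} * leaf_prod q V 1 \<xi> x)"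
    by (rule ext)
  show ?thesis
    by (subst walk_split_first, subst first, subst walk_linear) (use assms(2) in simp_all)
qed

lemma walk_leaf_disj_before: "k' \<le> j \<Longrightarrow> walk_edges q V j k \<inter> leaf_edges q V k' = {}"
proof -
  assume "k' \<le> j"
  then have "(spine_edges V (j + i) \<union> leaf_edges q V (Suc (j + i))) \<inter> leaf_edges q V k' = {}" for i
    using leaf_leaf_disj[of "Suc (j + i)" k' q] spine_leaf_disj[of "j + i" q k'] by auto
  then show ?thesis unfolding walk_edges_def by blast
qed

text \<open>Multiplies by \<open>\<epsilon> x\<close> the signs joining \<open>x\<close> to the
  class of the first leaf at \<open>x\<^sub>1\<close>. One leaf is enough: the diagonal entry at
  \<open>x\<close> then picks up the factor \<open>\<epsilon> x\<close> exactly once, and every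
  other sign of the chain is left alone.\<close>

definition leaf_flip :: "(nat \<Rightarrow> real) \<Rightarrow> nat set \<Rightarrow> real" where
  "leaf_flip \<epsilon> e = (\<Prod>x\<in>V (Spine 1). if e \<in> (\<lambda>z. {x, z}) ` V (Leaf 1 0) then \<epsilon> x else 1)"

lemma leaf_flip_leaf:
  assumes "x \<in> V (Spine 1)" "z \<in> V (Leaf 1 l)"
  shows "leaf_flip \<epsilon> {x, z} = (if l = 0 then \<epsilon> x else 1)"
proof -
  have "leaf_flip \<epsilon> {x, z} = (\<Prod>x'\<in>V (Spine 1). if x' = x then (if l = 0 then \<epsilon> x else 1) else 1)"
    unfolding leaf_flip_def
  proof (intro prod.cong refl)
    fix x' assume x': "x' \<in> V (Spine 1)"
    have "{x, z} \<in> (\<lambda>z. {x', z}) ` V (Leaf 1 0) \<longleftrightarrow> x' = x \<and> l = 0"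
    proof
      assume "{x, z} \<in> (\<lambda>z. {x', z}) ` V (Leaf 1 0)"
      then obtain z' where z': "z' \<in> V (Leaf 1 0)" "{x, z} = {x', z'}" by blast
      then consider "x = x'" "z = z'" | "x = z'" unfolding doubleton_eq_iff by blast
      then show "x' = x \<and> l = 0"
        using class_unique[OF assms(2), of "Leaf 1 0"] class_unique[OF assms(1), of "Leaf 1 0"] z'(1)
        by cases simp_all
    qed (use assms in auto)
    then show "(if {x, z} \<in> (\<lambda>z. {x', z}) ` V (Leaf 1 0) then \<epsilon> x' else 1) = (if x' = x then (if l = 0 then \<epsilon> x else 1) else 1)"
      by auto
  qed
  then show ?thesis using assms(1) by simp
qed

lemma leaf_flip_other: "1 \<le> q 1 \<Longrightarrow> e \<notin> leaf_edges q V 1 \<Longrightarrow> leaf_flip \<epsilon> e = 1"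
  unfolding leaf_flip_def leaf_edges_def by (intro prod.neutral ballI) auto

lemma leaf_flip_sign: "is_sign (V (Spine 1)) \<epsilon> \<Longrightarrow> leaf_flip \<epsilon> e = 1 \<or> leaf_flip \<epsilon> e = -1"
proof -
  have "(\<Prod>x\<in>X. u x) = 1 \<or> (\<Prod>x\<in>X. u x) = -1" if "\<And>x. x \<in> X \<Longrightarrow> u x = 1 \<or> u x = -1"
    for X and u :: "nat \<Rightarrow> real"
    using that
  proof (induction X rule: infinite_finite_induct)
    case (insert x X)
    then have "u x = 1 \<or> u x = -1" "(\<Prod>x\<in>X. u x) = 1 \<or> (\<Prod>x\<in>X. u x) = -1" by simp_all
    then show ?case using insert.hyps by auto
  qed simp_all
  then show "is_sign (V (Spine 1)) \<epsilon> \<Longrightarrow> leaf_flip \<epsilon> e = 1 \<or> leaf_flip \<epsilon> e = -1"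
    unfolding leaf_flip_def by (simp add: is_sign_def)
qed

lemma leaf_prod_flip:
  assumes "x \<in> V (Spine 1)" "1 \<le> q 1"
  shows "leaf_prod q V 1 (\<lambda>e. leaf_flip \<epsilon> e * \<xi> e) x = \<epsilon> x * leaf_prod q V 1 \<xi> x"
proof -
  have "leaf_prod q V 1 (\<lambda>e. leaf_flip \<epsilon> e * \<xi> e) x =
      (\<Prod>l<q 1. (if l = 0 then \<epsilon> x else 1) * (\<Sum>z\<in>V (Leaf 1 l). \<xi> {x, z}))"
    unfolding leaf_prod_def sum_distrib_left
    by (intro prod.cong sum.cong refl) (simp add: leaf_flip_leaf[OF assms(1)])
  also have "\<dots> = (\<Prod>l<q 1. if l = 0 then \<epsilon> x else 1) * leaf_prod q V 1 \<xi> x"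
    by (simp add: prod.distrib leaf_prod_def)
  also have "(\<Prod>l<q 1. if l = 0 then \<epsilon> x else 1) = \<epsilon> x" using assms(2) by simp
  finally show ?thesis .
qed

lemma walk_flip:
  assumes "b \<in> V (Spine (1 + k))" "1 \<le> q 1"
  shows "walk q V 1 (\<lambda>e. leaf_flip \<epsilon> e * \<xi> e) f k b = walk q V 1 \<xi> f k b"
proof (rule depends_onD[OF depends_on_walk[OF assms(1)]])
  fix e assume "e \<in> walk_edges q V 1 k"
  then have "e \<notin> leaf_edges q V 1" using walk_leaf_disj_before[of 1 1 q k] by auto
  then show "leaf_flip \<epsilon> e * \<xi> e = \<xi> e" using leaf_flip_other[of q, OF assms(2)] by simp
qed

text \<open>The selected label may depend on the signs. For each fixed \<xi> an average over the
  flips \<epsilon> isolates the rank-one term at \<open>X \<xi>\<close>; afterwards the two averages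
  are exchanged, and invariance under each flip removes it. The column of signs at the selected
  label has length \<open>sqrt m\<close>, which pays for replacing a Euclidean length by the sum of
  absolute entries.\<close>

lemma sign_avg_op_norm_walk_ge_selected:
  assumes q1: "1 \<le> q 1"
    and X: "\<And>\<xi>. X \<xi> \<in> V (Spine 1)"
    and card: "card (V (Spine 0)) = m" "card (V (Spine (Suc k))) = m"
  shows "sign_avg (walk_edges q V 0 (Suc k))
      (\<lambda>\<xi>. \<bar>leaf_prod q V 1 \<xi> (X \<xi>)\<bar> * (\<Sum>b\<in>V (Spine (Suc k)). \<bar>walk q V 1 \<xi> (\<lambda>y. if y = X \<xi> then 1 else 0) k b\<bar>)) \<xi>0
    \<le> sign_avg (walk_edges q V 0 (Suc k)) (\<lambda>\<xi>. op_norm (V (Spine 0)) (V (Spine (Suc k)))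
      (\<lambda>a. walk q V 0 \<xi> (\<lambda>y. if a = y then 1 else 0) (Suc k))) \<xi>0"
proof -
  let ?J = "walk_edges q V 0 (Suc k)" and ?I = "V (Spine 0)" and ?K = "V (Spine (Suc k))"
  define N where "N \<xi> = op_norm ?I ?K (\<lambda>a. walk q V 0 \<xi> (\<lambda>y. if a = y then 1 else 0) (Suc k))" for \<xi>
  define D where "D = leaf_prod q V 1"
  define w where "w \<xi> x b = walk q V 1 \<xi> (\<lambda>y. if y = x then 1 else 0) k b" for \<xi> x b
  have leaf_sub: "leaf_edges q V 1 \<subseteq> ?J" and spine_sub: "spine_edges V 0 \<subseteq> ?J"
    unfolding walk_edges_def by auto
  have N: "N (\<lambda>e. leaf_flip \<epsilon> e * \<xi> e) = op_norm ?I ?K (\<lambda>a b. \<Sum>x\<in>V (Spine 1). \<epsilon> x * (\<xi> {a, x} * D \<xi> x * w \<xi> x b))" for \<epsilon> \<xi>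
    unfolding N_def
  proof (intro op_norm_cong)
    fix a b assume ab: "a \<in> ?I" "b \<in> ?K"
    have "leaf_flip \<epsilon> {a, x} = 1" if x: "x \<in> V (Spine 1)" for x
    proof (rule leaf_flip_other[of q])
      have "{a, x} \<in> spine_edges V 0" using ab x by (auto simp: spine_edges_def)
      then show "{a, x} \<notin> leaf_edges q V 1" using spine_leaf_disj by blast
    qed (rule q1)
    then show "walk q V 0 (\<lambda>e. leaf_flip \<epsilon> e * \<xi> e) (\<lambda>y. if a = y then 1 else 0) (Suc k) b =
      (\<Sum>x\<in>V (Spine 1). \<epsilon> x * (\<xi> {a, x} * D \<xi> x * w \<xi> x b))"
      unfolding walk_unit_eq[OF ab] D_def w_def using ab q1
      by (intro sum.cong refl) (simp add: leaf_prod_flip[simplified] walk_flip[simplified])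
  qed
  have flipN: "sign_avg ?J (\<lambda>\<xi>. N (\<lambda>e. leaf_flip \<epsilon> e * \<xi> e)) \<xi>0 = sign_avg ?J N \<xi>0" if "is_sign (V (Spine 1)) \<epsilon>" for \<epsilon>
    using leaf_flip_sign[OF that] leaf_flip_other[of q, OF q1] leaf_sub
    by (intro sign_avg_flip) auto
  have pt: "\<bar>D \<xi> (X \<xi>)\<bar> * (\<Sum>b\<in>?K. \<bar>w \<xi> (X \<xi>) b\<bar>) \<le> sign_avg (V (Spine 1)) (\<lambda>\<epsilon>. N (\<lambda>e. leaf_flip \<epsilon> e * \<xi> e)) (\<lambda>_. 1)"
    if sgn: "is_sign ?J \<xi>" for \<xi>
  proof -
    let ?x = "X \<xi>"
    have "L2_set (\<lambda>a. \<xi> {a, ?x} * D \<xi> ?x) ?I = sqrt m * \<bar>D \<xi> ?x\<bar>"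
    proof -
      have "(\<xi> {a, ?x} * D \<xi> ?x)\<^sup>2 = (D \<xi> ?x)\<^sup>2" if "a \<in> ?I" for a
      proof -
        have "{a, ?x} \<in> ?J" using that X[of \<xi>] spine_sub by (auto simp: spine_edges_def)
        then have "\<xi> {a, ?x} = 1 \<or> \<xi> {a, ?x} = -1" using sgn by (simp add: is_sign_def)
        then show ?thesis by auto
      qed
      then show ?thesis using card(1) by (simp add: L2_set_def real_sqrt_mult)
    qed
    moreover have "(\<Sum>b\<in>?K. \<bar>w \<xi> ?x b\<bar>) \<le> sqrt m * L2_set (w \<xi> ?x) ?K"
      using sum_abs_le_sqrt_card[of ?K "w \<xi> ?x"] card(2) by (simp add: L2_set_def)
    ultimately have "\<bar>D \<xi> ?x\<bar> * (\<Sum>b\<in>?K. \<bar>w \<xi> ?x b\<bar>) \<le> L2_set (\<lambda>a. \<xi> {a, ?x} * D \<xi> ?x) ?I * L2_set (w \<xi> ?x) ?K"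
      using mult_left_mono[of "\<Sum>b\<in>?K. \<bar>w \<xi> ?x b\<bar>" "sqrt m * L2_set (w \<xi> ?x) ?K" "\<bar>D \<xi> ?x\<bar>"] by (simp add: mult_ac)
    also have "\<dots> \<le> op_norm ?I ?K (\<lambda>a b. \<xi> {a, ?x} * D \<xi> ?x * w \<xi> ?x b)"
      by (rule op_norm_rank_one_ge) simp
    also have "\<dots> \<le> sign_avg (V (Spine 1)) (\<lambda>\<epsilon>. N (\<lambda>e. leaf_flip \<epsilon> e * \<xi> e)) (\<lambda>_. 1)"
      unfolding N by (rule op_norm_le_sign_avg_sum) (use X in auto)
    finally show ?thesis .
  qed
  have "sign_avg ?J (\<lambda>\<xi>. \<bar>D \<xi> (X \<xi>)\<bar> * (\<Sum>b\<in>?K. \<bar>w \<xi> (X \<xi>) b\<bar>)) \<xi>0 \<le>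
      sign_avg ?J (\<lambda>\<xi>. sign_avg (V (Spine 1)) (\<lambda>\<epsilon>. N (\<lambda>e. leaf_flip \<epsilon> e * \<xi> e)) (\<lambda>_. 1)) \<xi>0"
    by (intro sign_avg_mono pt)
  also have "\<dots> = sign_avg (V (Spine 1)) (\<lambda>\<epsilon>. sign_avg ?J (\<lambda>\<xi>. N (\<lambda>e. leaf_flip \<epsilon> e * \<xi> e)) \<xi>0) (\<lambda>_. 1)"
    by (rule sign_avg_swap[symmetric])
  also have "\<dots> = sign_avg (V (Spine 1)) (\<lambda>\<epsilon>. sign_avg ?J N \<xi>0) (\<lambda>_. 1)"
    by (intro sign_avg_cong flipN)
  finally have "sign_avg ?J (\<lambda>\<xi>. \<bar>D \<xi> (X \<xi>)\<bar> * (\<Sum>b\<in>?K. \<bar>w \<xi> (X \<xi>) b\<bar>)) \<xi>0 \<le> sign_avg ?J N \<xi>0"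
    by simp
  then show ?thesis unfolding N_def[abs_def] D_def w_def .
qed

text \<open>Different labels of \<open>x\<^sub>1\<close> read disjoint signs, and each has all of
  its leaf sums large with probability at least \<open>\<rho> = (3 / 64) ^ (h * q 1)\<close>. All
  labels fail with probability at most \<open>exp (- 1)\<close> as soon as the number of labels
  times \<rho> reaches 1.\<close>

lemma sign_avg_exists_large_leaf_prod:
  assumes leaf: "\<And>l. l < q 1 \<Longrightarrow> card (V (Leaf 1 l)) = h * b"
    and big: "1 \<le> real (card (V (Spine 1))) * (3 / 64) ^ (h * q 1)"
  shows "1 / 2 \<le> sign_avg (leaf_edges q V 1)
    (\<lambda>\<xi>. of_bool (\<exists>x\<in>V (Spine 1). \<forall>l<q 1. real h * sqrt b / 4 \<le> (\<Sum>z\<in>V (Leaf 1 l). \<xi> {x, z}))) \<xi>"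
proof -
  define t where "t = real h * sqrt b / 4"
  define E where "E x l = (\<lambda>z. {x, z}) ` V (Leaf 1 l)" for x l
  define B where "B x l \<xi> = (of_bool (t \<le> (\<Sum>e\<in>E x l. \<xi> e)) :: real)" for x l \<xi>
  define A where "A x \<xi> = (\<Prod>l<q 1. B x l \<xi>)" for x \<xi>
  define \<rho> :: real where "\<rho> = (3 / 64) ^ (h * q 1)"
  have sums: "(\<Sum>z\<in>V (Leaf 1 l). \<xi> {x, z}) = (\<Sum>e\<in>E x l. \<xi> e)" for x l \<xi>
    unfolding E_def by (rule leaf_factor_image)
  have A01: "A x \<xi> = of_bool (\<forall>l<q 1. t \<le> (\<Sum>z\<in>V (Leaf 1 l). \<xi> {x, z}))" for x \<xi>
    unfolding A_def B_def sums by (induction "q 1") (auto simp: lessThan_Suc less_Suc_eq)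
  have finE: "finite (E x l)" for x l by (simp add: E_def)
  have depB: "depends_on (E x l) (B x l)" for x l
    unfolding depends_on_def B_def by (auto cong: sum.cong)
  have depA: "depends_on (\<Union>l<q 1. E x l) (A x)" for x
    unfolding depends_on_def A_def by (intro allI impI prod.cong refl depends_onD[OF depB]) auto
  have avgA: "\<rho> \<le> sign_avg (\<Union>l<q 1. E x l) (A x) \<xi>" for x
  proof -
    have "sign_avg (\<Union>l<q 1. E x l) (A x) \<xi> = (\<Prod>l<q 1. sign_avg (E x l) (B x l) \<xi>)"
      unfolding A_def
    proof (rule sign_avg_prod)
      fix l l' :: nat assume "l \<noteq> l'"
      then show "E x l \<inter> E x l' = {}" by (auto simp: E_def doubleton_eq_iff dest!: class_eq_The)
    qed (auto intro: finE depB)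
    moreover have "(\<Prod>l<q 1. (3 / 64) ^ h) \<le> (\<Prod>l<q 1. sign_avg (E x l) (B x l) \<xi>)"
    proof (intro prod_mono conjI)
      fix l assume "l \<in> {..<q 1}"
      then have "card (E x l) = h * b"
        using leaf[of l] unfolding E_def by (subst card_image) (auto simp: inj_on_def doubleton_eq_iff)
      then show "(3 / 64) ^ h \<le> sign_avg (E x l) (B x l) \<xi>"
        unfolding B_def t_def by (intro sign_avg_sum_tail_ge finE)
    qed simp
    ultimately show ?thesis by (simp add: \<rho>_def power_mult)
  qed
  have avg1: "sign_avg (\<Union>l<q 1. E x l) (\<lambda>\<xi>. 1 - A x \<xi>) \<xi> \<le> 1 - \<rho>" for x
  proof -
    have "sign_avg (\<Union>l<q 1. E x l) (\<lambda>\<xi>. 1 + (-1) * A x \<xi>) \<xi> = 1 - sign_avg (\<Union>l<q 1. E x l) (A x) \<xi>"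
      unfolding sign_avg_add sign_avg_cmult using finE by simp
    then show ?thesis using avgA[of x] by simp
  qed
  have edges: "leaf_edges q V 1 = (\<Union>x\<in>V (Spine 1). \<Union>l<q 1. E x l)"
    by (simp add: leaf_edges_def E_def)
  have "sign_avg (leaf_edges q V 1) (\<lambda>\<xi>. \<Prod>x\<in>V (Spine 1). 1 - A x \<xi>) \<xi> =
      (\<Prod>x\<in>V (Spine 1). sign_avg (\<Union>l<q 1. E x l) (\<lambda>\<xi>. 1 - A x \<xi>) \<xi>)"
    unfolding edges
  proof (rule sign_avg_prod)
    fix x x' assume x: "x \<in> V (Spine 1)" "x' \<in> V (Spine 1)" "x \<noteq> x'"
    then show "(\<Union>l<q 1. E x l) \<inter> (\<Union>l<q 1. E x' l) = {}"
      by (auto simp: E_def doubleton_eq_iff dest!: class_eq_The)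
  next
    fix x
    show "depends_on (\<Union>l<q 1. E x l) (\<lambda>\<xi>. 1 - A x \<xi>)"
      using depA[of x] unfolding depends_on_def by (metis (no_types, lifting))
  qed (auto intro: finE)
  also have "\<dots> \<le> (\<Prod>x\<in>V (Spine 1). 1 - \<rho>)"
    by (intro prod_mono conjI avg1 sign_avg_nonneg) (simp add: A01)
  also have "\<dots> = (1 - \<rho>) ^ card (V (Spine 1))" by simp
  also have "\<dots> \<le> exp (- \<rho>) ^ card (V (Spine 1))"
    using exp_ge_add_one_self[of "- \<rho>"] by (intro power_mono) (auto simp: \<rho>_def power_le_one)
  also have "\<dots> = exp (- (real (card (V (Spine 1))) * \<rho>))" by (simp flip: exp_of_nat_mult)
  also have "\<dots> \<le> exp (- 1)" using big by (simp add: \<rho>_def)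
  also have "\<dots> \<le> 1 / 2" using exp_ge_add_one_self[of 1] by (simp add: exp_minus field_simps)
  finally have fail: "sign_avg (leaf_edges q V 1) (\<lambda>\<xi>. \<Prod>x\<in>V (Spine 1). 1 - A x \<xi>) \<xi> \<le> 1 / 2" .
  have "sign_avg (leaf_edges q V 1)
    (\<lambda>\<xi>. of_bool (\<exists>x\<in>V (Spine 1). \<forall>l<q 1. t \<le> (\<Sum>z\<in>V (Leaf 1 l). \<xi> {x, z}))) \<xi> =
    sign_avg (leaf_edges q V 1) (\<lambda>\<xi>. 1 + (-1) * (\<Prod>x\<in>V (Spine 1). 1 - A x \<xi>)) \<xi>"
  proof (intro sign_avg_cong)
    fix \<xi> :: "nat set \<Rightarrow> real"
    have "(\<Prod>x\<in>V (Spine 1). 1 - A x \<xi>) = of_bool (\<forall>x\<in>V (Spine 1). A x \<xi> = 0)"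
    proof (cases "\<forall>x\<in>V (Spine 1). A x \<xi> = 0")
      case True
      then show ?thesis by simp
    next
      case False
      then have "\<exists>x\<in>V (Spine 1). 1 - A x \<xi> = 0" by (auto simp: A01)
      then show ?thesis using False by (simp add: prod_zero)
    qed
    then show "of_bool (\<exists>x\<in>V (Spine 1). \<forall>l<q 1. t \<le> (\<Sum>z\<in>V (Leaf 1 l). \<xi> {x, z})) =
        1 + (-1) * (\<Prod>x\<in>V (Spine 1). 1 - A x \<xi>)"
      by (auto simp: A01)
  qed
  also have "\<dots> = 1 - sign_avg (leaf_edges q V 1) (\<lambda>\<xi>. \<Prod>x\<in>V (Spine 1). 1 - A x \<xi>) \<xi>"
    unfolding sign_avg_add sign_avg_cmult by simp
  finally show ?thesis using fail by (simp add: t_def)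
qed

end

context label_classes
begin

text \<open>A label with a large diagonal entry is chosen from the signs of the leaves at
  \<open>x\<^sub>1\<close> alone. The rest of the walk starts there with signs independent of the
  choice, so its lower bound holds conditionally. The chain has \<open>L = Suc k\<close> inner
  vertices.\<close>

lemma sign_avg_op_norm_walk_ge:
  fixes k h b q
  defines "m \<equiv> h * b" and "P \<equiv> (\<Sum>i=1..Suc k. q (1 + i))"
  assumes q1: "1 \<le> q 1" and m: "1 \<le> m"
    and spine: "\<And>i. i \<le> Suc (Suc k) \<Longrightarrow> card (V (Spine i)) = m"
    and leaf: "\<And>i l. 1 \<le> i \<Longrightarrow> i \<le> Suc (Suc k) \<Longrightarrow> l < q i \<Longrightarrow> card (V (Leaf i l)) = m"
    and big: "1 \<le> real m * (3 / 64) ^ (h * q 1)"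
  shows "1 / 2 * (real h * sqrt b / 4) ^ q 1 * (real m * ((9 / 16) ^ Suc k * (9 / 16) ^ P * sqrt m ^ (k + P)))
    \<le> sign_avg (walk_edges q V 0 (Suc (Suc k))) (\<lambda>\<xi>. op_norm (V (Spine 0)) (V (Spine (Suc (Suc k))))
      (\<lambda>a. walk q V 0 \<xi> (\<lambda>y. if a = y then 1 else 0) (Suc (Suc k)))) \<xi>0"
proof -
  let ?J = "walk_edges q V 0 (Suc (Suc k))" and ?W = "walk_edges q V 1 (Suc k)" and ?F = "leaf_edges q V 1"
  let ?K = "V (Spine (Suc (Suc k)))"
  define t where "t = real h * sqrt b / 4"
  have t: "0 \<le> t" by (simp add: t_def)
  define w where "w = (9 / 16) ^ Suc k * (9 / 16) ^ P * sqrt m ^ (k + P)"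
  define A where "A x \<xi> \<longleftrightarrow> (\<forall>l<q 1. t \<le> (\<Sum>z\<in>V (Leaf 1 l). \<xi> {x, z}))" for x and \<xi> :: "nat set \<Rightarrow> real"
  define B where "B \<xi> = (of_bool (\<exists>x\<in>V (Spine 1). A x \<xi>) :: real)" for \<xi>
  \<comment> \<open>If no entry is large the value is an arbitrary label, so that \<open>X\<close>
    always lies in the class; the indicator \<open>B\<close> removes this case from the
    estimate.\<close>
  define X where "X \<xi> = (if \<exists>x\<in>V (Spine 1). A x \<xi> then SOME x. x \<in> V (Spine 1) \<and> A x \<xi>
    else SOME x. x \<in> V (Spine 1))" for \<xi>
  have "V (Spine 1) \<noteq> {}" using spine[of 1] m by auto
  then have some: "(SOME x. x \<in> V (Spine 1)) \<in> V (Spine 1)" by (rule some_in_eq[THEN iffD2])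
  have X_A: "X \<xi> \<in> V (Spine 1) \<and> A (X \<xi>) \<xi>" if "\<exists>x\<in>V (Spine 1). A x \<xi>" for \<xi>
    using someI_ex[of "\<lambda>x. x \<in> V (Spine 1) \<and> A x \<xi>"] that unfolding X_def by auto
  have X: "X \<xi> \<in> V (Spine 1)" for \<xi>
    using X_A[of \<xi>] some by (cases "\<exists>x\<in>V (Spine 1). A x \<xi>") (auto simp: X_def)
  have A_cong: "A x \<xi> = A x \<xi>'" if "\<And>e. e \<in> ?F \<Longrightarrow> \<xi> e = \<xi>' e" "x \<in> V (Spine 1)" for x \<xi> \<xi>'
  proof -
    have "(\<Sum>z\<in>V (Leaf 1 l). \<xi> {x, z}) = (\<Sum>z\<in>V (Leaf 1 l). \<xi>' {x, z})" if "l < q 1" for l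
      using that \<open>x \<in> V (Spine 1)\<close> by (intro sum.cong refl \<open>\<And>e. e \<in> ?F \<Longrightarrow> \<xi> e = \<xi>' e\<close>) (auto simp: leaf_edges_def)
    then show ?thesis by (simp add: A_def)
  qed
  have BX_cong: "B \<xi> = B \<xi>' \<and> X \<xi> = X \<xi>'" if "\<And>e. e \<in> ?F \<Longrightarrow> \<xi> e = \<xi>' e" for \<xi> \<xi>'
  proof -
    have e: "x \<in> V (Spine 1) \<and> A x \<xi> \<longleftrightarrow> x \<in> V (Spine 1) \<and> A x \<xi>'" for x
      using A_cong[where \<xi> = \<xi> and \<xi>' = \<xi>' and x = x, OF that] by blast
    show ?thesis by (simp only: B_def X_def Bex_def e simp_thms)
  qed
  define w' where "w' \<xi> x b = \<bar>walk q V 1 \<xi> (\<lambda>y. if y = x then 1 else 0) (Suc k) b\<bar>" for \<xi> x b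
  define g where "g \<xi> = B \<xi> * (t ^ q 1 * (\<Sum>b\<in>?K. w' \<xi> (X \<xi>) b))" for \<xi>
  have w'_cong: "w' \<xi> x b = w' \<xi>' x b" if "\<And>e. e \<in> ?W \<Longrightarrow> \<xi> e = \<xi>' e" "b \<in> ?K" for \<xi> \<xi>' x b
    unfolding w'_def using that by (intro arg_cong[of _ _ abs] depends_onD[OF depends_on_walk]) auto
  have inner: "B \<xi> * (t ^ q 1 * (real m * w)) \<le> sign_avg ?W g \<xi>" for \<xi>
  proof -
    have "B \<xi> * (t ^ q 1 * (real m * w)) = B \<xi> * (t ^ q 1 * (\<Sum>b\<in>?K. w))"
      using spine by simp
    also have "\<dots> \<le> B \<xi> * (t ^ q 1 * (\<Sum>b\<in>?K. sign_avg ?W (\<lambda>\<xi>'. w' \<xi>' (X \<xi>) b) \<xi>))"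
    proof (intro mult_left_mono sum_mono)
      fix b assume b: "b \<in> ?K"
      show "w \<le> sign_avg ?W (\<lambda>\<xi>'. w' \<xi>' (X \<xi>) b) \<xi>"
        unfolding w_def P_def w'_def
        by (rule sign_avg_abs_walk_ge) (use X b spine leaf m in auto)
    qed (use t in \<open>auto simp: B_def\<close>)
    also have "\<dots> = sign_avg ?W (\<lambda>\<xi>'. B \<xi> * (t ^ q 1 * (\<Sum>b\<in>?K. w' \<xi>' (X \<xi>) b))) \<xi>"
      by (simp only: sign_avg_cmult sign_avg_sum)
    also have "\<dots> = sign_avg ?W g \<xi>"
    proof (rule sign_avg_cong)
      fix \<xi>' assume "agree_off ?W \<xi> \<xi>'"
      then have "B \<xi> = B \<xi>' \<and> X \<xi> = X \<xi>'"
        using walk_leaf_disj_before[of 1 1 q "Suc k"] by (intro BX_cong) (auto simp: agree_off_def)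
      then show "B \<xi> * (t ^ q 1 * (\<Sum>b\<in>?K. w' \<xi>' (X \<xi>) b)) = g \<xi>'" by (simp add: g_def)
    qed
    finally show ?thesis .
  qed
  have "1 / 2 * (t ^ q 1 * (real m * w)) \<le> sign_avg ?F B \<xi>0 * (t ^ q 1 * (real m * w))"
  proof (rule mult_right_mono)
    show "1 / 2 \<le> sign_avg ?F B \<xi>0"
      unfolding B_def[abs_def] A_def t_def
      using leaf spine big unfolding m_def by (intro sign_avg_exists_large_leaf_prod) auto
  qed (use t in \<open>auto simp: w_def\<close>)
  also have "\<dots> = sign_avg ?F (\<lambda>\<xi>. B \<xi> * (t ^ q 1 * (real m * w))) \<xi>0"
    by (rule sign_avg_cmult_right[symmetric])
  also have "\<dots> \<le> sign_avg ?F (sign_avg ?W g) \<xi>0" by (intro sign_avg_mono inner)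
  also have "\<dots> = sign_avg (?F \<union> ?W) g \<xi>0"
    using walk_leaf_disj_before[of 1 1 q "Suc k"] by (intro sign_avg_Un[symmetric]) auto
  \<comment> \<open>The function \<open>g\<close> reads every sign of the chain except those of the
    first spine factor, so passing to the full set of signs changes nothing.\<close>
  also have "\<dots> = sign_avg ?J g \<xi>0"
  proof (rule sign_avg_restrict[symmetric])
    show "depends_on (?F \<union> ?W) g"
      unfolding depends_on_def
    proof (intro allI impI)
      fix \<xi> \<xi>' :: "nat set \<Rightarrow> real"
      assume e: "\<forall>i\<in>?F \<union> ?W. \<xi> i = \<xi>' i"
      then have "B \<xi> = B \<xi>' \<and> X \<xi> = X \<xi>'" by (intro BX_cong) auto
      moreover have "(\<Sum>b\<in>?K. w' \<xi> x b) = (\<Sum>b\<in>?K. w' \<xi>' x b)" for x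
        using e by (intro sum.cong refl w'_cong) auto
      ultimately show "g \<xi> = g \<xi>'" by (simp add: g_def)
    qed
    have "?W \<subseteq> ?J"
    proof -
      have "spine_edges V (1 + i) \<union> leaf_edges q V (Suc (1 + i)) \<subseteq> ?J" if "i < Suc k" for i
        using that unfolding walk_edges_def by (intro subsetI UN_I[of "Suc i"]) auto
      then show ?thesis unfolding walk_edges_def[of q V 1] by blast
    qed
    then show "?F \<union> ?W \<subseteq> ?J" unfolding walk_edges_def[of q V 0] by force
  qed simp
  also have "\<dots> \<le> sign_avg ?J (\<lambda>\<xi>. \<bar>leaf_prod q V 1 \<xi> (X \<xi>)\<bar> * (\<Sum>b\<in>?K. w' \<xi> (X \<xi>) b)) \<xi>0"
  proof (intro sign_avg_mono)
    fix \<xi> :: "nat set \<Rightarrow> real"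
    have "B \<xi> * t ^ q 1 \<le> \<bar>leaf_prod q V 1 \<xi> (X \<xi>)\<bar>"
    proof (cases "\<exists>x\<in>V (Spine 1). A x \<xi>")
      case True
      then have "\<forall>l<q 1. t \<le> (\<Sum>z\<in>V (Leaf 1 l). \<xi> {X \<xi>, z})" using X_A[of \<xi>] by (simp add: A_def)
      then have "(\<Prod>l<q 1. t) \<le> (\<Prod>l<q 1. \<bar>\<Sum>z\<in>V (Leaf 1 l). \<xi> {X \<xi>, z}\<bar>)"
        using t by (intro prod_mono) force
      then show ?thesis using True by (simp add: B_def leaf_prod_def abs_prod)
    qed (simp add: B_def)
    then have "B \<xi> * t ^ q 1 * (\<Sum>b\<in>?K. w' \<xi> (X \<xi>) b) \<le> \<bar>leaf_prod q V 1 \<xi> (X \<xi>)\<bar> * (\<Sum>b\<in>?K. w' \<xi> (X \<xi>) b)"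
      by (intro mult_right_mono) (auto simp: w'_def sum_nonneg)
    then show "g \<xi> \<le> \<bar>leaf_prod q V 1 \<xi> (X \<xi>)\<bar> * (\<Sum>b\<in>?K. w' \<xi> (X \<xi>) b)"
      by (simp add: g_def mult_ac)
  qed
  also have "\<dots> \<le> sign_avg ?J (\<lambda>\<xi>. op_norm (V (Spine 0)) ?K
      (\<lambda>a. walk q V 0 \<xi> (\<lambda>y. if a = y then 1 else 0) (Suc (Suc k)))) \<xi>0"
    unfolding w'_def by (rule sign_avg_op_norm_walk_ge_selected[where q = q and X = X and m = m, OF q1 X]) (use spine in auto)
  finally show ?thesis unfolding w_def t_def by (simp only: mult.assoc)
qed

end

section \<open>The typed graph matrix of a chain\<close>

text \<open>The sum of the injective matrix restricted to maps that send each vertex into its own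
  class. For disjoint classes such maps are automatically injective, and the sum factorises.\<close>

definition typed_matrix ::
  "'a shape \<Rightarrow> ('a \<Rightarrow> nat set) \<Rightarrow> (nat set \<Rightarrow> real) \<Rightarrow> nat \<Rightarrow> nat \<Rightarrow> real" where
  "typed_matrix \<alpha> V \<xi> i j =
    (\<Sum>\<phi> | \<phi> \<in> PiE (verts \<alpha>) V \<and> map \<phi> (left_bd \<alpha>) = [i] \<and> map \<phi> (right_bd \<alpha>) = [j].
      \<Prod>e\<in>edges \<alpha>. \<xi> (\<phi> ` e))"

text \<open>Fubini for extensional functions: a map on a disjoint union is a pair of maps on the two
  parts.\<close>

lemma sum_PiE_Un:
  fixes f :: "('a \<Rightarrow> 'b) \<Rightarrow> 'c :: comm_monoid_add"
  assumes "A \<inter> B = {}"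
  shows "(\<Sum>\<phi>\<in>PiE (A \<union> B) V. f \<phi>) = (\<Sum>\<phi>\<in>PiE A V. \<Sum>\<psi>\<in>PiE B V. f (\<lambda>x. if x \<in> A then \<phi> x else \<psi> x))"
proof -
  have "(\<Sum>\<phi>\<in>PiE A V. \<Sum>\<psi>\<in>PiE B V. f (\<lambda>x. if x \<in> A then \<phi> x else \<psi> x)) =
      (\<Sum>(\<phi>, \<psi>)\<in>PiE A V \<times> PiE B V. f (\<lambda>x. if x \<in> A then \<phi> x else \<psi> x))"
    by (rule sum.cartesian_product)
  also have "\<dots> = (\<Sum>\<phi>\<in>PiE (A \<union> B) V. f \<phi>)"
  proof (rule sum.reindex_bij_witness[of _ "\<lambda>\<phi>. (restrict \<phi> A, restrict \<phi> B)" "\<lambda>(\<phi>, \<psi>) x. if x \<in> A then \<phi> x else \<psi> x"])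
    fix p assume p: "p \<in> PiE A V \<times> PiE B V"
    obtain \<phi> \<psi> where [simp]: "p = (\<phi>, \<psi>)" by (cases p)
    show "(restrict (case p of (\<phi>, \<psi>) \<Rightarrow> \<lambda>x. if x \<in> A then \<phi> x else \<psi> x) A,
        restrict (case p of (\<phi>, \<psi>) \<Rightarrow> \<lambda>x. if x \<in> A then \<phi> x else \<psi> x) B) = p"
      using p assms by (auto simp: fun_eq_iff restrict_def PiE_def extensional_def)
    show "(case p of (\<phi>, \<psi>) \<Rightarrow> \<lambda>x. if x \<in> A then \<phi> x else \<psi> x) \<in> PiE (A \<union> B) V"
      using p by (auto simp: PiE_iff extensional_def)
  next
    fix \<phi> assume p: "\<phi> \<in> PiE (A \<union> B) V"
    then show "(case (restrict \<phi> A, restrict \<phi> B) of (\<phi>, \<psi>) \<Rightarrow> \<lambda>x. if x \<in> A then \<phi> x else \<psi> x) = \<phi>"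
      by (auto simp: fun_eq_iff restrict_def PiE_def extensional_def)
    show "(restrict \<phi> A, restrict \<phi> B) \<in> PiE A V \<times> PiE B V" using p by auto
  qed auto
  finally show ?thesis ..
qed

lemma sum_PiE_singleton: "(\<Sum>\<phi>\<in>PiE {x} V. f (\<phi> x)) = (\<Sum>y\<in>V x. f y)"
  by (rule sum.reindex_bij_witness[of _ "\<lambda>y. \<lambda>x'\<in>{x}. y" "\<lambda>\<phi>. \<phi> x"])
     (auto simp: PiE_iff extensional_def fun_eq_iff)

text \<open>The initial segment of the chain up to \<open>x\<^sub>k\<close>, together with all
  leaves attached so far, those of \<open>x\<^sub>k\<close> included. This is the part covered by
  \<open>k\<close> steps of \<open>walk\<close>; the complete chain is the segment up to
  \<open>Suc L\<close> once \<open>q\<close> vanishes there.\<close>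

definition chain_verts :: "(nat \<Rightarrow> nat) \<Rightarrow> nat \<Rightarrow> chain_vertex set" where
  "chain_verts q k = {Spine i |i. i \<le> k} \<union> {Leaf j l |j l. 1 \<le> j \<and> j \<le> k \<and> l < q j}"

definition chain_edges :: "(nat \<Rightarrow> nat) \<Rightarrow> nat \<Rightarrow> chain_vertex set set" where
  "chain_edges q k = {{Spine i, Spine (i + 1)} |i. i < k} \<union> {{Spine j, Leaf j l} |j l. 1 \<le> j \<and> j \<le> k \<and> l < q j}"

lemma chain_verts_edges:
  assumes "q (Suc L) = 0"
  shows "verts (chain L q) = chain_verts q (Suc L)" "edges (chain L q) = chain_edges q (Suc L)"
  using assms unfolding chain_def chain_verts_def chain_edges_def
  by (auto simp: le_Suc_eq less_Suc_eq_le)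

lemma finite_chain_verts [simp]: "finite (chain_verts q k)"
proof -
  have "chain_verts q k = Spine ` {..k} \<union> (\<Union>j\<in>{1..k}. Leaf j ` {..<q j})"
    by (auto simp: chain_verts_def)
  then show ?thesis by simp
qed

lemma finite_chain_edges [simp]: "finite (chain_edges q k)"
proof -
  have "chain_edges q k = (\<lambda>i. {Spine i, Spine (i + 1)}) ` {..<k} \<union> (\<Union>j\<in>{1..k}. (\<lambda>l. {Spine j, Leaf j l}) ` {..<q j})"
    by (auto simp: chain_edges_def)
  then show ?thesis by simp
qed

text \<open>In the induction, the leaves at the new spine vertex are split off and summed to the
  diagonal entry; then the new spine vertex itself is split off. The fixed endpoints are indicator
  factors, so that the sum ranges over a full product set and Fubini applies.\<close>

lemma sum_typed_maps_eq_walk: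
  assumes fin: "\<And>x. finite (V x)" and b: "b \<in> V (Spine k)"
  shows "(\<Sum>\<phi>\<in>PiE (chain_verts q k) V. of_bool (\<phi> (Spine 0) = a) * of_bool (\<phi> (Spine k) = b) *
      (\<Prod>e\<in>chain_edges q k. \<xi> (\<phi> ` e))) = walk q V 0 \<xi> (\<lambda>y. if a = y then 1 else 0) k b"
  using b
proof (induction k arbitrary: b)
  case 0
  have v: "chain_verts q 0 = {Spine 0}" and e: "chain_edges q 0 = {}"
    by (auto simp: chain_verts_def chain_edges_def)
  have "(\<Sum>\<phi>\<in>PiE {Spine 0} V. of_bool (\<phi> (Spine 0) = a) * of_bool (\<phi> (Spine 0) = b)) =
      (\<Sum>y\<in>V (Spine 0). (of_bool (y = a) * of_bool (y = b) :: real))"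
    by (rule sum_PiE_singleton)
  also have "\<dots> = (\<Sum>y\<in>V (Spine 0). if y = b then of_bool (y = a) else 0)"
    by (intro sum.cong) auto
  also have "\<dots> = of_bool (b = a)" using 0 fin by simp
  finally show ?case by (simp add: v e)
next
  case (Suc k)
  let ?B = "Leaf (Suc k) ` {..<q (Suc k)}"
  let ?E = "(\<lambda>l. {Spine (Suc k), Leaf (Suc k) l}) ` {..<q (Suc k)}"
  let ?P = "\<lambda>\<phi>. \<Prod>e\<in>chain_edges q k. \<xi> (\<phi> ` e)"
  have v: "chain_verts q (Suc k) = (chain_verts q k \<union> {Spine (Suc k)}) \<union> ?B"
    by (auto simp: chain_verts_def le_Suc_eq)
  have e: "chain_edges q (Suc k) = insert {Spine k, Spine (Suc k)} (chain_edges q k) \<union> ?E"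
    by (auto simp: chain_edges_def le_Suc_eq less_Suc_eq)
  have notin: "{Spine k, Spine (Suc k)} \<notin> chain_edges q k"
    by (auto simp: chain_edges_def doubleton_eq_iff)
  have sub: "e \<subseteq> chain_verts q k" if "e \<in> chain_edges q k" for e
    using that by (auto simp: chain_edges_def chain_verts_def)
  have disj: "insert {Spine k, Spine (Suc k)} (chain_edges q k) \<inter> ?E = {}"
  proof (rule equals0I)
    fix e assume e: "e \<in> insert {Spine k, Spine (Suc k)} (chain_edges q k) \<inter> ?E"
    then obtain l where l: "Leaf (Suc k) l \<in> e" by auto
    from e have "e = {Spine k, Spine (Suc k)} \<or> e \<subseteq> chain_verts q k" using sub by auto
    with l show False by (auto simp: chain_verts_def)
  qed
  have prod_E: "(\<Prod>e\<in>chain_edges q (Suc k). \<xi> (\<phi> ` e)) =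
      ?P \<phi> * \<xi> {\<phi> (Spine k), \<phi> (Spine (Suc k))} * (\<Prod>l<q (Suc k). \<xi> {\<phi> (Spine (Suc k)), \<phi> (Leaf (Suc k) l)})" for \<phi>
  proof -
    have "(\<Prod>e\<in>?E. \<xi> (\<phi> ` e)) = (\<Prod>l<q (Suc k). \<xi> {\<phi> (Spine (Suc k)), \<phi> (Leaf (Suc k) l)})"
      by (subst prod.reindex) (auto simp: inj_on_def doubleton_eq_iff)
    then show ?thesis
      unfolding e using disj notin by (subst prod.union_disjoint) (auto simp: mult_ac)
  qed
  let ?merge = "\<lambda>A \<phi> \<psi> x. if x \<in> A then \<phi> x else \<psi> x"
  have leaves: "(\<Sum>\<psi>\<in>PiE ?B V. \<Prod>l<q (Suc k). \<xi> {y, \<psi> (Leaf (Suc k) l)}) = leaf_prod q V (Suc k) \<xi> y" for y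
  proof -
    have inj: "inj_on (Leaf (Suc k)) {..<q (Suc k)}" by (simp add: inj_on_def)
    have "(\<Sum>\<psi>\<in>PiE ?B V. \<Prod>l<q (Suc k). \<xi> {y, \<psi> (Leaf (Suc k) l)}) = (\<Sum>\<psi>\<in>PiE ?B V. \<Prod>x\<in>?B. \<xi> {y, \<psi> x})"
      by (simp add: prod.reindex[OF inj])
    also have "\<dots> = (\<Prod>x\<in>?B. \<Sum>z\<in>V x. \<xi> {y, z})"
      using fin by (intro prod_sum_PiE[symmetric]) auto
    finally show ?thesis by (simp add: leaf_prod_def prod.reindex[OF inj])
  qed
  have "(\<Sum>\<phi>\<in>PiE (chain_verts q (Suc k)) V. of_bool (\<phi> (Spine 0) = a) * of_bool (\<phi> (Spine (Suc k)) = b) *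
      (\<Prod>e\<in>chain_edges q (Suc k). \<xi> (\<phi> ` e))) =
    (\<Sum>\<phi>\<in>PiE (chain_verts q k \<union> {Spine (Suc k)}) V. \<Sum>\<psi>\<in>PiE ?B V.
      of_bool (\<phi> (Spine 0) = a) * of_bool (\<phi> (Spine (Suc k)) = b) *
      (?P \<phi> * \<xi> {\<phi> (Spine k), \<phi> (Spine (Suc k))} * (\<Prod>l<q (Suc k). \<xi> {\<phi> (Spine (Suc k)), \<psi> (Leaf (Suc k) l)})))"
    unfolding v
  proof (subst sum_PiE_Un)
    show "(chain_verts q k \<union> {Spine (Suc k)}) \<inter> ?B = {}" by (auto simp: chain_verts_def)
  next
    have "(\<Prod>e\<in>chain_edges q k. \<xi> (?merge (chain_verts q k \<union> {Spine (Suc k)}) \<phi> \<psi> ` e)) = ?P \<phi>"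
      for \<phi> \<psi> :: "chain_vertex \<Rightarrow> nat"
      using sub by (intro prod.cong refl arg_cong[of _ _ \<xi>] image_cong) auto
    moreover have "Spine k \<in> chain_verts q k" "Spine 0 \<in> chain_verts q k" "Leaf (Suc k) l \<notin> chain_verts q k" for l
      by (auto simp: chain_verts_def)
    ultimately show "(\<Sum>\<phi>\<in>PiE (chain_verts q k \<union> {Spine (Suc k)}) V. \<Sum>\<psi>\<in>PiE ?B V.
        of_bool (?merge (chain_verts q k \<union> {Spine (Suc k)}) \<phi> \<psi> (Spine 0) = a) *
        of_bool (?merge (chain_verts q k \<union> {Spine (Suc k)}) \<phi> \<psi> (Spine (Suc k)) = b) *
        (\<Prod>e\<in>chain_edges q (Suc k). \<xi> (?merge (chain_verts q k \<union> {Spine (Suc k)}) \<phi> \<psi> ` e))) =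
      (\<Sum>\<phi>\<in>PiE (chain_verts q k \<union> {Spine (Suc k)}) V. \<Sum>\<psi>\<in>PiE ?B V.
        of_bool (\<phi> (Spine 0) = a) * of_bool (\<phi> (Spine (Suc k)) = b) *
        (?P \<phi> * \<xi> {\<phi> (Spine k), \<phi> (Spine (Suc k))} * (\<Prod>l<q (Suc k). \<xi> {\<phi> (Spine (Suc k)), \<psi> (Leaf (Suc k) l)})))"
      unfolding prod_E by simp
  qed
  also have "\<dots> = (\<Sum>\<phi>\<in>PiE (chain_verts q k \<union> {Spine (Suc k)}) V.
      of_bool (\<phi> (Spine 0) = a) * of_bool (\<phi> (Spine (Suc k)) = b) *
      (?P \<phi> * \<xi> {\<phi> (Spine k), \<phi> (Spine (Suc k))} * leaf_prod q V (Suc k) \<xi> (\<phi> (Spine (Suc k)))))"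
    by (simp only: sum_distrib_left[symmetric] leaves)
  also have "\<dots> = (\<Sum>\<phi>\<in>PiE (chain_verts q k) V. \<Sum>\<psi>\<in>PiE {Spine (Suc k)} V.
      of_bool (\<phi> (Spine 0) = a) * of_bool (\<psi> (Spine (Suc k)) = b) *
      (?P \<phi> * \<xi> {\<phi> (Spine k), \<psi> (Spine (Suc k))} * leaf_prod q V (Suc k) \<xi> (\<psi> (Spine (Suc k)))))"
  proof (subst sum_PiE_Un)
    show "chain_verts q k \<inter> {Spine (Suc k)} = {}" by (auto simp: chain_verts_def)
  next
    have "(\<Prod>e\<in>chain_edges q k. \<xi> (?merge (chain_verts q k) \<phi> \<psi> ` e)) = ?P \<phi>"
      for \<phi> \<psi> :: "chain_vertex \<Rightarrow> nat"
      using sub by (intro prod.cong refl arg_cong[of _ _ \<xi>] image_cong) auto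
    moreover have "Spine k \<in> chain_verts q k" "Spine 0 \<in> chain_verts q k" "Spine (Suc k) \<notin> chain_verts q k"
      by (auto simp: chain_verts_def)
    ultimately show "(\<Sum>\<phi>\<in>PiE (chain_verts q k) V. \<Sum>\<psi>\<in>PiE {Spine (Suc k)} V.
        of_bool (?merge (chain_verts q k) \<phi> \<psi> (Spine 0) = a) *
        of_bool (?merge (chain_verts q k) \<phi> \<psi> (Spine (Suc k)) = b) *
        ((\<Prod>e\<in>chain_edges q k. \<xi> (?merge (chain_verts q k) \<phi> \<psi> ` e)) *
          \<xi> {?merge (chain_verts q k) \<phi> \<psi> (Spine k), ?merge (chain_verts q k) \<phi> \<psi> (Spine (Suc k))} *
          leaf_prod q V (Suc k) \<xi> (?merge (chain_verts q k) \<phi> \<psi> (Spine (Suc k))))) =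
      (\<Sum>\<phi>\<in>PiE (chain_verts q k) V. \<Sum>\<psi>\<in>PiE {Spine (Suc k)} V.
        of_bool (\<phi> (Spine 0) = a) * of_bool (\<psi> (Spine (Suc k)) = b) *
        (?P \<phi> * \<xi> {\<phi> (Spine k), \<psi> (Spine (Suc k))} * leaf_prod q V (Suc k) \<xi> (\<psi> (Spine (Suc k)))))"
      by simp
  qed
  also have "\<dots> = (\<Sum>\<phi>\<in>PiE (chain_verts q k) V. of_bool (\<phi> (Spine 0) = a) * ?P \<phi> * \<xi> {\<phi> (Spine k), b} * leaf_prod q V (Suc k) \<xi> b)"
  proof (intro sum.cong refl)
    fix \<phi>
    have "(\<Sum>\<psi>\<in>PiE {Spine (Suc k)} V. of_bool (\<phi> (Spine 0) = a) * of_bool (\<psi> (Spine (Suc k)) = b) *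
      (?P \<phi> * \<xi> {\<phi> (Spine k), \<psi> (Spine (Suc k))} * leaf_prod q V (Suc k) \<xi> (\<psi> (Spine (Suc k))))) =
      (\<Sum>y\<in>V (Spine (Suc k)). of_bool (\<phi> (Spine 0) = a) * of_bool (y = b) *
      (?P \<phi> * \<xi> {\<phi> (Spine k), y} * leaf_prod q V (Suc k) \<xi> y))"
      by (rule sum_PiE_singleton)
    also have "\<dots> = (\<Sum>y\<in>V (Spine (Suc k)). if y = b then of_bool (\<phi> (Spine 0) = a) * ?P \<phi> * \<xi> {\<phi> (Spine k), b} * leaf_prod q V (Suc k) \<xi> b else 0)"
      by (intro sum.cong) auto
    finally show "(\<Sum>\<psi>\<in>PiE {Spine (Suc k)} V. of_bool (\<phi> (Spine 0) = a) * of_bool (\<psi> (Spine (Suc k)) = b) *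
      (?P \<phi> * \<xi> {\<phi> (Spine k), \<psi> (Spine (Suc k))} * leaf_prod q V (Suc k) \<xi> (\<psi> (Spine (Suc k))))) =
      of_bool (\<phi> (Spine 0) = a) * ?P \<phi> * \<xi> {\<phi> (Spine k), b} * leaf_prod q V (Suc k) \<xi> b"
      using Suc.prems fin by simp
  qed
  also have "\<dots> = (\<Sum>\<phi>\<in>PiE (chain_verts q k) V. of_bool (\<phi> (Spine 0) = a) * ?P \<phi> * \<xi> {\<phi> (Spine k), b}) * leaf_prod q V (Suc k) \<xi> b"
    by (rule sum_distrib_right[symmetric])
  also have "(\<Sum>\<phi>\<in>PiE (chain_verts q k) V. of_bool (\<phi> (Spine 0) = a) * ?P \<phi> * \<xi> {\<phi> (Spine k), b}) =
      (\<Sum>\<phi>\<in>PiE (chain_verts q k) V. \<Sum>x\<in>V (Spine k). of_bool (\<phi> (Spine 0) = a) * of_bool (\<phi> (Spine k) = x) * ?P \<phi> * \<xi> {x, b})"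
  proof (intro sum.cong refl)
    fix \<phi> assume "\<phi> \<in> PiE (chain_verts q k) V"
    then have "\<phi> (Spine k) \<in> V (Spine k)" by (rule PiE_mem) (simp add: chain_verts_def)
    moreover have "(\<Sum>x\<in>V (Spine k). of_bool (\<phi> (Spine 0) = a) * of_bool (\<phi> (Spine k) = x) * ?P \<phi> * \<xi> {x, b}) =
        (\<Sum>x\<in>V (Spine k). if x = \<phi> (Spine k) then of_bool (\<phi> (Spine 0) = a) * ?P \<phi> * \<xi> {\<phi> (Spine k), b} else 0)"
      by (intro sum.cong) auto
    ultimately show "of_bool (\<phi> (Spine 0) = a) * ?P \<phi> * \<xi> {\<phi> (Spine k), b} =
        (\<Sum>x\<in>V (Spine k). of_bool (\<phi> (Spine 0) = a) * of_bool (\<phi> (Spine k) = x) * ?P \<phi> * \<xi> {x, b})"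
      using fin by simp
  qed
  also have "\<dots> = (\<Sum>x\<in>V (Spine k). (\<Sum>\<phi>\<in>PiE (chain_verts q k) V. of_bool (\<phi> (Spine 0) = a) * of_bool (\<phi> (Spine k) = x) * ?P \<phi>) * \<xi> {x, b})"
    by (subst sum.swap) (simp add: sum_distrib_right)
  also have "\<dots> = (\<Sum>x\<in>V (Spine k). walk q V 0 \<xi> (\<lambda>y. if a = y then 1 else 0) k x * \<xi> {x, b})"
    by (intro sum.cong refl) (simp add: Suc.IH)
  finally show ?case by simp
qed

lemma typed_matrix_chain:
  assumes "q (Suc L) = 0" "\<And>x. finite (V x)" "b \<in> V (Spine (Suc L))"
  shows "typed_matrix (chain L q) V \<xi> a b = walk q V 0 \<xi> (\<lambda>y. if a = y then 1 else 0) (Suc L) b"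
proof -
  have bd: "left_bd (chain L q) = [Spine 0]" "right_bd (chain L q) = [Spine (Suc L)]"
    by (simp_all add: chain_def)
  have fin: "finite (PiE (chain_verts q (Suc L)) V)" using assms(2) by (intro finite_PiE) auto
  have "typed_matrix (chain L q) V \<xi> a b =
      (\<Sum>\<phi>\<in>PiE (chain_verts q (Suc L)) V. of_bool (\<phi> (Spine 0) = a) * of_bool (\<phi> (Spine (Suc L)) = b) *
      (\<Prod>e\<in>chain_edges q (Suc L). \<xi> (\<phi> ` e)))"
    unfolding typed_matrix_def bd chain_verts_edges[of q, OF assms(1)] list.map
    using fin by (intro sum.mono_neutral_cong_left) auto
  then show ?thesis using sum_typed_maps_eq_walk[where V = V and b = b and k = "Suc L" and q = q and a = a and \<xi> = \<xi>] assms by simp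
qed

section \<open>Decoupling\<close>

definition label_pairs :: "nat \<Rightarrow> nat set set" where
  "label_pairs n = {e. e \<subseteq> {1..n} \<and> card e = 2}"

lemma finite_label_pairs [simp]: "finite (label_pairs n)"
  by (rule finite_subset[of _ "Pow {1..n}"]) (auto simp: label_pairs_def)

text \<open>Connects the probability space to finite averages. The base point 0 is the default value
  of the product measure off the label pairs.\<close>

lemma expected_norm_eq_sign_avg:
  "expected_norm \<alpha> n =
    sign_avg (label_pairs n) (\<lambda>\<xi>. op_norm {1..n} {1..n} (graph_matrix \<alpha> n \<xi>)) (\<lambda>_. 0)"
proof -
  let ?J = "label_pairs n"
  let ?S = "PiE_dflt ?J 0 (\<lambda>_. {-1, 1 :: real})"
  let ?f = "\<lambda>\<xi>. op_norm {1..n} {1..n} (graph_matrix \<alpha> n \<xi>)"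
  have pmf: "random_signs n = pmf_of_set ?S"
    unfolding random_signs_def label_pairs_def[symmetric] by (rule Pi_pmf_of_set) auto
  have fin: "finite ?S" by (intro finite_PiE_dflt) auto
  have card: "card ?S = 2 ^ card ?J"
    by (subst card_PiE_dflt) (simp_all add: numeral_2_eq_2)
  have ne: "?S \<noteq> {}" by simp
  have "expected_norm \<alpha> n = (\<Sum>\<xi>\<in>?S. ?f \<xi>) / 2 ^ card ?J"
    unfolding expected_norm_def pmf using integral_pmf_of_set[OF ne fin, of ?f] card by simp
  also have "(\<Sum>\<xi>\<in>?S. f \<xi>) = (\<Sum>A\<in>Pow ?J. f (\<lambda>i. if i \<in> ?J then (if i \<in> A then 1 else -1) else 0))" for f :: "(nat set \<Rightarrow> real) \<Rightarrow> real"
    by (rule sum.reindex_bij_witness[of _ "\<lambda>A i. if i \<in> ?J then (if i \<in> A then 1 else -1) else 0" "\<lambda>\<xi>. {i \<in> ?J. \<xi> i = 1}"])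
       (auto simp: PiE_dflt_def fun_eq_iff intro!: arg_cong[of _ _ f], metis)
  finally show ?thesis by (simp add: sign_avg_def)
qed

section \<open>Upper bound by averaging over colourings\<close>

definition colour_class :: "nat \<Rightarrow> (nat \<Rightarrow> 'a) \<Rightarrow> 'a \<Rightarrow> nat set" where
  "colour_class n c x = {i \<in> {1..n}. c i = x}"

text \<open>The colours of the labels in the image of \<phi> are forced and all other labels are
  free. The count does not depend on \<phi>, so a sum over all colourings reproduces the injective
  matrix exactly.\<close>

lemma card_colourings:
  assumes fin: "finite W" and \<phi>: "\<phi> \<in> W \<rightarrow>\<^sub>E {1..n}" "inj_on \<phi> W"
  shows "card {c \<in> {1..n} \<rightarrow>\<^sub>E W. \<phi> \<in> PiE W (colour_class n c)} = card W ^ (n - card W)"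
proof -
  define B where "B i = (if i \<in> \<phi> ` W then {the_inv_into W \<phi> i} else W)" for i
  have "{c \<in> {1..n} \<rightarrow>\<^sub>E W. \<phi> \<in> PiE W (colour_class n c)} = PiE {1..n} B"
  proof (intro equalityI subsetI)
    fix c assume c: "c \<in> {c \<in> {1..n} \<rightarrow>\<^sub>E W. \<phi> \<in> PiE W (colour_class n c)}"
    then have "c (\<phi> x) = x" if "x \<in> W" for x using that by (auto simp: PiE_iff colour_class_def)
    then have "c i \<in> B i" if "i \<in> {1..n}" for i
      using c that \<phi> by (auto simp: B_def the_inv_into_f_f)
    then show "c \<in> PiE {1..n} B" using c by (auto simp: PiE_iff)
  next
    fix c assume c: "c \<in> PiE {1..n} B"
    have "c (\<phi> x) = x" if x: "x \<in> W" for x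
    proof -
      have "\<phi> x \<in> {1..n}" using \<phi> x by auto
      then have "c (\<phi> x) \<in> B (\<phi> x)" using c by (auto simp: PiE_iff)
      then show ?thesis using x \<phi> by (auto simp: B_def the_inv_into_f_f)
    qed
    moreover have "c i \<in> W" if "i \<in> {1..n}" for i
    proof -
      have "c i \<in> B i" using c that by (auto simp: PiE_iff)
      then show ?thesis using \<phi> by (auto simp: B_def the_inv_into_f_f split: if_splits)
    qed
    ultimately show "c \<in> {c \<in> {1..n} \<rightarrow>\<^sub>E W. \<phi> \<in> PiE W (colour_class n c)}"
      using c \<phi> by (auto simp: PiE_iff colour_class_def)
  qed
  also have "card \<dots> = (\<Prod>i\<in>{1..n}. if i \<in> \<phi> ` W then 1 else card W)"
    by (subst card_PiE) (auto simp: B_def intro!: prod.cong)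
  also have "\<dots> = (\<Prod>i\<in>{1..n} - \<phi> ` W. card W)"
    by (rule prod.mono_neutral_cong_right) auto
  also have "\<dots> = card W ^ (n - card W)"
  proof -
    have "\<phi> ` W \<subseteq> {1..n}" using \<phi> by auto
    then have "card ({1..n} - \<phi> ` W) = n - card W"
      using fin \<phi>(2) by (simp add: card_Diff_subset card_image)
    then show ?thesis by simp
  qed
  finally show ?thesis .
qed

lemma inj_on_typed_map:
  assumes "\<phi> \<in> PiE W V" "\<And>x y. x \<in> W \<Longrightarrow> y \<in> W \<Longrightarrow> x \<noteq> y \<Longrightarrow> V x \<inter> V y = {}"
  shows "inj_on \<phi> W"
  using assms unfolding inj_on_def by (metis PiE_mem disjoint_iff)

lemma sum_typed_matrix_colourings:
  assumes fin: "finite (verts \<alpha>)"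
  shows "(\<Sum>c\<in>{1..n} \<rightarrow>\<^sub>E verts \<alpha>. typed_matrix \<alpha> (colour_class n c) \<xi> i j) =
    real (card (verts \<alpha>) ^ (n - card (verts \<alpha>))) * graph_matrix \<alpha> n \<xi> i j"
proof -
  let ?W = "verts \<alpha>" and ?C = "{1..n} \<rightarrow>\<^sub>E verts \<alpha>"
  define \<Phi> where "\<Phi> = {\<phi> \<in> ?W \<rightarrow>\<^sub>E {1..n}. inj_on \<phi> ?W \<and> map \<phi> (left_bd \<alpha>) = [i] \<and> map \<phi> (right_bd \<alpha>) = [j]}"
  define w where "w \<phi> = (\<Prod>e\<in>edges \<alpha>. \<xi> (\<phi> ` e))" for \<phi>
  have fin\<Phi>: "finite \<Phi>" unfolding \<Phi>_def using fin by (intro finite_subset[OF _ finite_PiE[of ?W "\<lambda>_. {1..n}"]]) auto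
  have finC: "finite ?C" using fin by (intro finite_PiE) auto
  have typed: "typed_matrix \<alpha> (colour_class n c) \<xi> i j = (\<Sum>\<phi>\<in>\<Phi>. of_bool (\<phi> \<in> PiE ?W (colour_class n c)) * w \<phi>)" for c
  proof -
    have "\<phi> \<in> ?W \<rightarrow>\<^sub>E {1..n}" "inj_on \<phi> ?W" if "\<phi> \<in> PiE ?W (colour_class n c)" for \<phi>
    proof -
      show "\<phi> \<in> ?W \<rightarrow>\<^sub>E {1..n}" using that by (auto simp: PiE_iff colour_class_def)
      show "inj_on \<phi> ?W" by (rule inj_on_typed_map[OF that]) (auto simp: colour_class_def)
    qed
    then show ?thesis unfolding typed_matrix_def w_def[symmetric]
      using fin\<Phi> by (intro sum.mono_neutral_cong_left) (auto simp: \<Phi>_def)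
  qed
  have "(\<Sum>c\<in>?C. typed_matrix \<alpha> (colour_class n c) \<xi> i j) = (\<Sum>\<phi>\<in>\<Phi>. (\<Sum>c\<in>?C. of_bool (\<phi> \<in> PiE ?W (colour_class n c))) * w \<phi>)"
    unfolding typed by (subst sum.swap) (simp add: sum_distrib_right)
  also have "\<dots> = (\<Sum>\<phi>\<in>\<Phi>. real (card ?W ^ (n - card ?W)) * w \<phi>)"
  proof (intro sum.cong refl)
    fix \<phi> assume "\<phi> \<in> \<Phi>"
    then have "card {c \<in> ?C. \<phi> \<in> PiE ?W (colour_class n c)} = card ?W ^ (n - card ?W)"
      by (intro card_colourings fin) (auto simp: \<Phi>_def)
    then show "(\<Sum>c\<in>?C. of_bool (\<phi> \<in> PiE ?W (colour_class n c))) * w \<phi> = real (card ?W ^ (n - card ?W)) * w \<phi>"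
      using finC by (simp add: of_bool_def sum.If_cases Int_def del: of_nat_power)
  qed
  also have "\<dots> = real (card ?W ^ (n - card ?W)) * graph_matrix \<alpha> n \<xi> i j"
    unfolding graph_matrix_def \<Phi>_def w_def sum_distrib_left by simp
  finally show ?thesis .
qed

text \<open>With \<open>v\<close> vertices there are \<open>v ^ n\<close> colourings, and each
  injective map is typed for \<open>v ^ (n - v)\<close> of them; the triangle inequality therefore
  loses only the factor \<open>v ^ v\<close>, which does not grow with \<open>n\<close>.\<close>

lemma expected_norm_le_typed:
  assumes fin: "finite (verts \<alpha>)" and n: "card (verts \<alpha>) \<le> n" and W: "verts \<alpha> \<noteq> {}"
    and B: "\<And>V. (\<And>x. V x \<subseteq> {1..n}) \<Longrightarrow> (\<And>x y. x \<noteq> y \<Longrightarrow> V x \<inter> V y = {}) \<Longrightarrow>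
      sign_avg (label_pairs n) (\<lambda>\<xi>. op_norm {1..n} {1..n} (typed_matrix \<alpha> V \<xi>)) (\<lambda>_. 0) \<le> B"
  shows "expected_norm \<alpha> n \<le> real (card (verts \<alpha>)) ^ card (verts \<alpha>) * B"
proof -
  let ?W = "verts \<alpha>" and ?C = "{1..n} \<rightarrow>\<^sub>E verts \<alpha>" and ?I = "{1..n}"
  define v where "v = card ?W"
  define N where "N = real (v ^ (n - v))"
  have v: "0 < v" using W fin by (simp add: v_def card_gt_0_iff)
  have N: "0 < N" using v by (simp add: N_def)
  have pt: "op_norm ?I ?I (graph_matrix \<alpha> n \<xi>) \<le> 1 / N * (\<Sum>c\<in>?C. op_norm ?I ?I (typed_matrix \<alpha> (colour_class n c) \<xi>))" for \<xi>
  proof -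
    have "op_norm ?I ?I (graph_matrix \<alpha> n \<xi>) =
        op_norm ?I ?I (\<lambda>i j. 1 / N * (\<Sum>c\<in>?C. typed_matrix \<alpha> (colour_class n c) \<xi> i j))"
      using N unfolding sum_typed_matrix_colourings[OF fin] v_def[symmetric] N_def[symmetric]
      by (intro op_norm_cong) simp
    also have "\<dots> \<le> \<bar>1 / N\<bar> * op_norm ?I ?I (\<lambda>i j. \<Sum>c\<in>?C. typed_matrix \<alpha> (colour_class n c) \<xi> i j)"
      by (rule op_norm_cmult_le) simp
    also have "\<dots> \<le> \<bar>1 / N\<bar> * (\<Sum>c\<in>?C. op_norm ?I ?I (typed_matrix \<alpha> (colour_class n c) \<xi>))"
      by (intro mult_left_mono op_norm_sum_le) auto
    finally show ?thesis using N by simp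
  qed
  have "expected_norm \<alpha> n \<le> sign_avg (label_pairs n)
      (\<lambda>\<xi>. 1 / N * (\<Sum>c\<in>?C. op_norm ?I ?I (typed_matrix \<alpha> (colour_class n c) \<xi>))) (\<lambda>_. 0)"
    unfolding expected_norm_eq_sign_avg by (intro sign_avg_mono pt)
  also have "\<dots> = 1 / N * (\<Sum>c\<in>?C. sign_avg (label_pairs n) (\<lambda>\<xi>. op_norm ?I ?I (typed_matrix \<alpha> (colour_class n c) \<xi>)) (\<lambda>_. 0))"
    by (simp only: sign_avg_cmult sign_avg_sum)
  also have "\<dots> \<le> 1 / N * (\<Sum>c\<in>?C. B)"
    using N by (intro mult_left_mono sum_mono B) (auto simp: colour_class_def)
  also have "\<dots> = real (v ^ n) / N * B" by (simp add: card_PiE v_def)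
  also have "real (v ^ n) / N = real v ^ v"
  proof -
    have "v ^ n = v ^ v * v ^ (n - v)" using n by (simp add: v_def flip: power_add)
    then show ?thesis using N v by (simp add: N_def)
  qed
  finally show ?thesis by (simp add: v_def)
qed

section \<open>Lower bound by projection onto typed maps\<close>

lemma op_norm_sign_avg_le:
  assumes "finite J"
  shows "op_norm I J (\<lambda>i j. sign_avg X (\<lambda>\<eta>. B \<eta> i j) \<eta>0) \<le> sign_avg X (\<lambda>\<eta>. op_norm I J (B \<eta>)) \<eta>0"
proof -
  let ?\<eta> = "\<lambda>A t. if t \<in> X then (if t \<in> A then 1 else -1) else \<eta>0 t"
  have "op_norm I J (\<lambda>i j. sign_avg X (\<lambda>\<eta>. B \<eta> i j) \<eta>0) =
      op_norm I J (\<lambda>i j. 1 / 2 ^ card X * (\<Sum>A\<in>Pow X. B (?\<eta> A) i j))"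
    by (simp add: sign_avg_def)
  also have "\<dots> \<le> \<bar>1 / 2 ^ card X\<bar> * op_norm I J (\<lambda>i j. \<Sum>A\<in>Pow X. B (?\<eta> A) i j)"
    by (rule op_norm_cmult_le[OF assms])
  also have "\<dots> \<le> \<bar>1 / 2 ^ card X\<bar> * (\<Sum>A\<in>Pow X. op_norm I J (B (?\<eta> A)))"
    using assms by (intro mult_left_mono op_norm_sum_le) auto
  finally show ?thesis by (simp add: sign_avg_def)
qed

text \<open>Orthogonality of the characters of the sign group.\<close>

lemma sign_avg_prod_powers:
  assumes "finite E"
  shows "sign_avg E (\<lambda>\<eta>. \<Prod>t\<in>E. \<eta> t ^ N t) \<eta>0 = of_bool (\<forall>t\<in>E. even (N t))"
proof -
  have "sign_avg (\<Union>t\<in>E. {t}) (\<lambda>\<eta>. \<Prod>t\<in>E. \<eta> t ^ N t) \<eta>0 = (\<Prod>t\<in>E. sign_avg {t} (\<lambda>\<eta>. \<eta> t ^ N t) \<eta>0)"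
    by (rule sign_avg_prod) (use assms in \<open>auto simp: depends_on_def\<close>)
  also have "\<dots> = (\<Prod>t\<in>E. of_bool (even (N t)))"
  proof (intro prod.cong refl)
    fix t
    show "sign_avg {t} (\<lambda>\<eta>. \<eta> t ^ N t) \<eta>0 = of_bool (even (N t))"
      by (subst sign_avg_insert) (auto simp: uminus_power_if)
  qed
  also have "\<dots> = of_bool (\<forall>t\<in>E. even (N t))"
    using assms by (induction E rule: finite_induct) auto
  finally show ?thesis by simp
qed

text \<open>The pair of labels \<open>f\<close> has the pair of colours \<open>t\<close>. The
  condition is phrased through intersections because a label need not belong to any class.\<close>

definition hits :: "('a \<Rightarrow> nat set) \<Rightarrow> nat set \<Rightarrow> 'a set \<Rightarrow> bool" where
  "hits V f t \<longleftrightarrow> (\<forall>x\<in>t. f \<inter> V x \<noteq> {})"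

lemma hits_unique:
  assumes disj: "\<And>x y. x \<noteq> y \<Longrightarrow> V x \<inter> V y = {}"
    and f: "card f = 2" and t: "card t = 2" "hits V f t"
  shows "t = {x. f \<inter> V x \<noteq> {}}" "\<forall>a\<in>f. \<exists>x\<in>t. a \<in> V x"
proof -
  obtain x y where xy: "t = {x, y}" "x \<noteq> y" using t(1) by (auto simp: card_2_iff)
  obtain a b where ab: "a \<in> f" "a \<in> V x" "b \<in> f" "b \<in> V y" using t(2) by (auto simp: hits_def xy)
  have "a \<noteq> b" using ab xy disj by blast
  moreover have "finite f" using f card.infinite by fastforce
  ultimately have f': "f = {a, b}" using f ab card_seteq[of f "{a, b}"] by auto
  show "t = {x. f \<inter> V x \<noteq> {}}" using xy ab disj by (auto simp: f')
  show "\<forall>a\<in>f. \<exists>x\<in>t. a \<in> V x" using xy ab by (auto simp: f')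
qed

text \<open>Random signs on the colour pairs of edges project the injective graph matrix onto the maps whose
  edges use every colour pair exactly once. Such a map is a typed one up to an automorphism of the
  shape.\<close>

lemma typed_le_expected_norm:
  fixes \<alpha> :: "'a shape"
  assumes fin: "finite (verts \<alpha>)"
    and edges: "\<And>e. e \<in> edges \<alpha> \<Longrightarrow> e \<subseteq> verts \<alpha> \<and> card e = 2" and cover: "\<Union>(edges \<alpha>) = verts \<alpha>"
    and bd: "left_bd \<alpha> = [u]" "right_bd \<alpha> = [w]" "u \<in> verts \<alpha>" "w \<in> verts \<alpha>"
    and V: "\<And>x. V x \<subseteq> {1..n}" "\<And>x y. x \<noteq> y \<Longrightarrow> V x \<inter> V y = {}"
  shows "sign_avg (label_pairs n) (\<lambda>\<xi>. op_norm (V u) (V w) (typed_matrix \<alpha> V \<xi>)) (\<lambda>_. 0) \<le> expected_norm \<alpha> n"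
proof -
  let ?W = "verts \<alpha>" and ?E = "edges \<alpha>" and ?J = "label_pairs n"
  have finE: "finite ?E" using fin edges by (intro finite_subset[of ?E "Pow ?W"]) auto
  define s where "s \<eta> f = (\<Prod>t\<in>?E. if f \<in> ?J \<and> hits V f t then \<eta> t else 1)" for \<eta> :: "'a set \<Rightarrow> real" and f
  \<comment> \<open>Multiplied by the character of all edges and averaged over \<eta>, a map
    survives exactly if every colour pair of an edge occurs an odd number of times among its
    images.\<close>
  define good where "good \<phi> \<longleftrightarrow> (\<forall>t\<in>?E. odd (card {e \<in> ?E. hits V (\<phi> ` e) t}))" for \<phi>
  \<comment> \<open>Automorphisms of the shape that fix the two boundary vertices, given by their
    action on the edges. Bijectivity on the vertices follows because the edges cover them.\<close>
  define \<Psi> where "\<Psi> = {\<psi> \<in> ?W \<rightarrow>\<^sub>E ?W. bij_betw ((`) \<psi>) ?E ?E \<and> \<psi> u = u \<and> \<psi> w = w}"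
  define \<Phi> where "\<Phi> i j = {\<phi> \<in> ?W \<rightarrow>\<^sub>E {1..n}. inj_on \<phi> ?W \<and> \<phi> u = i \<and> \<phi> w = j}" for i j
  define T where "T \<psi> i j = {\<phi> \<in> PiE ?W (\<lambda>x. V (\<psi> x)). \<phi> u = i \<and> \<phi> w = j}" for \<psi> i j
  define wt where "wt \<xi> \<phi> = (\<Prod>e\<in>?E. \<xi> (\<phi> ` e) :: real)" for \<xi> and \<phi> :: "'a \<Rightarrow> nat"
  have fin\<Phi>: "finite (\<Phi> i j)" for i j
    unfolding \<Phi>_def using fin by (intro finite_subset[OF _ finite_PiE[of ?W "\<lambda>_. {1..n}"]]) auto
  have finV: "finite (V x)" for x using V(1) by (rule finite_subset) simp
  have pair: "\<phi> ` e \<in> ?J" if "\<phi> \<in> ?W \<rightarrow>\<^sub>E {1..n}" "inj_on \<phi> ?W" "e \<in> ?E" for \<phi> e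
    using that edges[of e] by (auto simp: label_pairs_def card_image inj_on_subset)
  have \<psi>_bij: "bij_betw \<psi> ?W ?W" if "\<psi> \<in> \<Psi>" for \<psi>
  proof -
    have "\<psi> ` ?W = \<Union>((`) \<psi> ` ?E)" unfolding cover[symmetric] by blast
    also have "(`) \<psi> ` ?E = ?E" using that by (auto simp: \<Psi>_def bij_betw_def)
    finally have "\<psi> ` ?W = ?W" by (simp add: cover)
    then show ?thesis using fin by (simp add: bij_betw_def eq_card_imp_inj_on)
  qed
  have T_good: "\<phi> \<in> \<Phi> i j \<and> good \<phi>" if \<psi>: "\<psi> \<in> \<Psi>" and \<phi>: "\<phi> \<in> T \<psi> i j" for \<psi> \<phi> i j
  proof -
    have PiE: "\<phi> \<in> PiE ?W (\<lambda>x. V (\<psi> x))" using \<phi> by (simp add: T_def)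
    have inj: "inj_on \<phi> ?W"
      by (rule inj_on_typed_map[OF PiE]) (use \<psi>_bij[OF \<psi>] V(2) in \<open>auto simp: bij_betw_def inj_on_def\<close>)
    have mem: "\<phi> \<in> ?W \<rightarrow>\<^sub>E {1..n}" using PiE V(1) unfolding PiE_iff by blast
    have "{e \<in> ?E. hits V (\<phi> ` e) t} = {e \<in> ?E. \<psi> ` e = t}" if t: "t \<in> ?E" for t
    proof (intro Collect_cong conj_cong refl)
      fix e assume e: "e \<in> ?E"
      have h: "hits V (\<phi> ` e) (\<psi> ` e)"
        unfolding hits_def using PiE edges[OF e] by (auto simp: PiE_iff)
      have card: "card (\<phi> ` e) = 2" using pair[OF mem inj e] by (simp add: label_pairs_def)
      have "\<psi> ` e \<in> ?E" using \<psi> e by (auto simp: \<Psi>_def bij_betw_def)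
      then have "\<psi> ` e = {x. \<phi> ` e \<inter> V x \<noteq> {}}"
        using hits_unique(1)[OF V(2) card _ h] edges by blast
      moreover have "t = {x. \<phi> ` e \<inter> V x \<noteq> {}}" if "hits V (\<phi> ` e) t"
        using hits_unique(1)[OF V(2) card _ that] edges[OF t] by blast
      ultimately show "hits V (\<phi> ` e) t \<longleftrightarrow> \<psi> ` e = t" using h by metis
    qed
    moreover have "\<exists>e. {e \<in> ?E. \<psi> ` e = t} = {e}" if t: "t \<in> ?E" for t
    proof -
      have bij: "bij_betw ((`) \<psi>) ?E ?E" using \<psi> by (simp add: \<Psi>_def)
      then have "t \<in> (`) \<psi> ` ?E" using t by (simp add: bij_betw_def)
      then obtain e where "e \<in> ?E" "\<psi> ` e = t" by blast
      then have "{e \<in> ?E. \<psi> ` e = t} = {e}" using bij by (auto simp: bij_betw_def inj_on_def)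
      then show ?thesis by blast
    qed
    ultimately have "card {e \<in> ?E. hits V (\<phi> ` e) t} = 1" if "t \<in> ?E" for t
      using that by fastforce
    then have "good \<phi>" by (simp add: good_def)
    then show ?thesis using inj mem \<phi> by (simp add: \<Phi>_def T_def)
  qed
  have good_T: "\<exists>\<psi>\<in>\<Psi>. \<phi> \<in> T \<psi> i j"
    if \<phi>: "\<phi> \<in> \<Phi> i j" and g: "good \<phi>" and i: "i \<in> V u" and j: "j \<in> V w" for \<phi> i j
  proof -
    have mem: "\<phi> \<in> ?W \<rightarrow>\<^sub>E {1..n}" and inj: "inj_on \<phi> ?W" using \<phi> by (auto simp: \<Phi>_def)
    have card: "card (\<phi> ` e) = 2" if "e \<in> ?E" for e using pair[OF mem inj that] by (simp add: label_pairs_def)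
    define \<tau> where "\<tau> e = {x. \<phi> ` e \<inter> V x \<noteq> {}}" for e
    have hit\<tau>: "t = \<tau> e" "\<forall>a\<in>\<phi> ` e. \<exists>x\<in>t. a \<in> V x" if "e \<in> ?E" "t \<in> ?E" "hits V (\<phi> ` e) t" for e t
      using hits_unique[OF V(2) card[OF that(1)] _ that(3)] edges[OF that(2)] by (auto simp: \<tau>_def)
    have "\<exists>e\<in>?E. hits V (\<phi> ` e) t" if "t \<in> ?E" for t
    proof -
      have "odd (card {e \<in> ?E. hits V (\<phi> ` e) t})" using g that by (simp add: good_def)
      then have "{e \<in> ?E. hits V (\<phi> ` e) t} \<noteq> {}" by (metis card.empty even_zero)
      then show ?thesis by blast
    qed
    then obtain h where h: "\<And>t. t \<in> ?E \<Longrightarrow> h t \<in> ?E \<and> hits V (\<phi> ` h t) t" by metis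
    have \<tau>h: "\<tau> (h t) = t" if "t \<in> ?E" for t using hit\<tau>(1)[of "h t" t] h that by simp
    have "inj_on h ?E" by (rule inj_on_inverseI[of _ \<tau>]) (rule \<tau>h)
    moreover have "h ` ?E \<subseteq> ?E" using h by auto
    \<comment> \<open>Oddness only says that each colour pair occurs. There are as many edges as
      colour pairs, so each occurs exactly once and every image of an edge has the colours of an
      edge.\<close>
    ultimately have hE: "h ` ?E = ?E" by (rule endo_inj_surj[OF finE, rotated])
    have \<tau>E: "\<tau> e \<in> ?E" "\<forall>a\<in>\<phi> ` e. \<exists>x\<in>\<tau> e. a \<in> V x" if "e \<in> ?E" for e
    proof -
      obtain t where t: "t \<in> ?E" "e = h t" using hE \<open>e \<in> ?E\<close> by (metis imageE)
      then show "\<tau> e \<in> ?E" "\<forall>a\<in>\<phi> ` e. \<exists>x\<in>\<tau> e. a \<in> V x" using \<tau>h h hit\<tau>[of e t] by auto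
    qed
    have ex: "\<exists>y\<in>?W. \<phi> x \<in> V y" if x: "x \<in> ?W" for x
    proof -
      obtain e where e: "e \<in> ?E" "x \<in> e" using x cover by blast
      then show ?thesis using \<tau>E[OF e(1)] edges[of "\<tau> e"] by blast
    qed
    define \<psi> where "\<psi> = (\<lambda>x\<in>?W. SOME y. y \<in> ?W \<and> \<phi> x \<in> V y)"
    have \<psi>: "\<psi> x \<in> ?W" "\<phi> x \<in> V (\<psi> x)" if "x \<in> ?W" for x
      using someI_ex[of "\<lambda>y. y \<in> ?W \<and> \<phi> x \<in> V y"] ex[OF that] that by (auto simp: \<psi>_def)
    have \<psi>_eq: "\<psi> x = y" if "x \<in> ?W" "\<phi> x \<in> V y" for x y using \<psi>(2)[OF that(1)] that(2) V(2) by blast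
    have \<psi>\<tau>: "\<psi> ` e = \<tau> e" if e: "e \<in> ?E" for e
    proof -
      have sub: "e \<subseteq> ?W" using edges[OF e] by simp
      then have "\<psi> ` e \<subseteq> \<tau> e" using \<psi> by (fastforce simp: \<tau>_def)
      moreover have "\<tau> e \<subseteq> \<psi> ` e" using sub \<psi>_eq by (fastforce simp: \<tau>_def)
      ultimately show ?thesis by blast
    qed
    have "(`) \<psi> ` ?E = ?E"
    proof (intro equalityI subsetI)
      fix t assume "t \<in> ?E"
      then show "t \<in> (`) \<psi> ` ?E" using \<tau>h[of t] h[of t] \<psi>\<tau>[of "h t"] by (metis imageI)
    qed (use \<psi>\<tau> \<tau>E in auto)
    then have "bij_betw ((`) \<psi>) ?E ?E" using finE by (simp add: bij_betw_def eq_card_imp_inj_on)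
    moreover have "\<psi> u = u" "\<psi> w = w" using \<psi>_eq[of u u] \<psi>_eq[of w w] bd i j \<phi> by (auto simp: \<Phi>_def)
    moreover have "\<psi> \<in> ?W \<rightarrow>\<^sub>E ?W" using \<psi> by (auto simp: \<psi>_def)
    ultimately have "\<psi> \<in> \<Psi>" by (simp add: \<Psi>_def)
    moreover have "\<phi> \<in> T \<psi> i j" using \<psi> mem \<phi> by (auto simp: T_def \<Phi>_def PiE_iff)
    ultimately show ?thesis by blast
  qed
  have T_disj: "T \<psi> i j \<inter> T \<psi>' i j = {}" if "\<psi> \<in> \<Psi>" "\<psi>' \<in> \<Psi>" "\<psi> \<noteq> \<psi>'" for \<psi> \<psi>' i j
  proof (rule ccontr)
    assume "T \<psi> i j \<inter> T \<psi>' i j \<noteq> {}"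
    then obtain \<phi> where "\<phi> \<in> PiE ?W (\<lambda>x. V (\<psi> x))" "\<phi> \<in> PiE ?W (\<lambda>x. V (\<psi>' x))" by (auto simp: T_def)
    then have "\<psi> x = \<psi>' x" if "x \<in> ?W" for x using that V(2)[of "\<psi> x" "\<psi>' x"] by (auto simp: PiE_iff)
    then have "\<psi> = \<psi>'" using that by (intro PiE_ext[of \<psi> ?W "\<lambda>_. ?W" \<psi>']) (auto simp: \<Psi>_def)
    then show False using that by simp
  qed
  have fin\<Psi>: "finite \<Psi>" unfolding \<Psi>_def using fin by (intro finite_subset[OF _ finite_PiE[of ?W "\<lambda>_. ?W"]]) auto
  have finT: "finite (T \<psi> i j)" for \<psi> i j
    unfolding T_def using fin finV by (intro finite_subset[OF _ finite_PiE[of ?W "\<lambda>x. V (\<psi> x)"]]) auto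
  \<comment> \<open>Relabelling by an automorphism permutes the edges, so each automorphism
    contributes the same typed entry with the same sign and nothing cancels.\<close>
  have T_sum: "(\<Sum>\<phi>\<in>T \<psi> i j. wt \<xi> \<phi>) = typed_matrix \<alpha> V \<xi> i j" if \<psi>: "\<psi> \<in> \<Psi>" for \<psi> \<xi> i j
  proof -
    note bij = \<psi>_bij[OF \<psi>]
    define \<rho> where "\<rho> = the_inv_into ?W \<psi>"
    have \<rho>: "\<rho> x \<in> ?W" "\<psi> (\<rho> x) = x" "\<rho> (\<psi> x) = x" "\<psi> x \<in> ?W" if "x \<in> ?W" for x
      using that bij the_inv_into_into[of \<psi> ?W x ?W] f_the_inv_into_f[of \<psi> ?W x] the_inv_into_f_f[of \<psi> ?W x]
      by (auto simp: \<rho>_def bij_betw_def)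
    have ends: "\<psi> u = u" "\<psi> w = w" "\<rho> u = u" "\<rho> w = w"
      using \<psi> \<rho>(3)[of u] \<rho>(3)[of w] bd by (auto simp: \<Psi>_def)
    have eb: "bij_betw ((`) \<psi>) ?E ?E" using \<psi> by (simp add: \<Psi>_def)
    have "typed_matrix \<alpha> V \<xi> i j = (\<Sum>\<phi>\<in>{\<phi> \<in> PiE ?W V. \<phi> u = i \<and> \<phi> w = j}. wt \<xi> \<phi>)"
      by (simp add: typed_matrix_def bd wt_def)
    also have "\<dots> = (\<Sum>\<phi>\<in>T \<psi> i j. wt \<xi> \<phi>)"
    proof (rule sum.reindex_bij_witness[of _ "\<lambda>\<phi>. \<lambda>x\<in>?W. \<phi> (\<rho> x)" "\<lambda>\<phi>. \<lambda>x\<in>?W. \<phi> (\<psi> x)"])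
      fix \<phi> assume \<phi>: "\<phi> \<in> {\<phi> \<in> PiE ?W V. \<phi> u = i \<and> \<phi> w = j}"
      then show "(\<lambda>x\<in>?W. (\<lambda>x\<in>?W. \<phi> (\<psi> x)) (\<rho> x)) = \<phi>"
        using \<rho> by (auto simp: fun_eq_iff PiE_iff extensional_def)
      show "(\<lambda>x\<in>?W. \<phi> (\<psi> x)) \<in> T \<psi> i j"
        using \<phi> \<rho> ends bd by (auto simp: T_def PiE_iff)
      have "wt \<xi> (\<lambda>x\<in>?W. \<phi> (\<psi> x)) = (\<Prod>e\<in>?E. \<xi> (\<phi> ` (\<psi> ` e)))"
        unfolding wt_def
      proof (intro prod.cong refl arg_cong[of _ _ \<xi>])
        fix e assume "e \<in> ?E"
        then have "e \<subseteq> ?W" using edges by blast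
        then show "(\<lambda>x\<in>?W. \<phi> (\<psi> x)) ` e = \<phi> ` \<psi> ` e" by (auto simp: image_image subset_iff intro!: image_cong)
      qed
      also have "\<dots> = wt \<xi> \<phi>"
        unfolding wt_def by (rule prod.reindex_bij_betw[OF eb, of "\<lambda>e. \<xi> (\<phi> ` e)"])
      finally show "wt \<xi> (\<lambda>x\<in>?W. \<phi> (\<psi> x)) = wt \<xi> \<phi>" .
    next
      fix \<phi> assume \<phi>: "\<phi> \<in> T \<psi> i j"
      then show "(\<lambda>x\<in>?W. (\<lambda>x\<in>?W. \<phi> (\<rho> x)) (\<psi> x)) = \<phi>"
        using \<rho> by (auto simp: fun_eq_iff T_def PiE_iff extensional_def)
      have "\<phi> (\<rho> x) \<in> V x" if "x \<in> ?W" for x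
        using \<phi> \<rho>[OF that] by (auto simp: T_def PiE_iff)
      then show "(\<lambda>x\<in>?W. \<phi> (\<rho> x)) \<in> {\<phi> \<in> PiE ?W V. \<phi> u = i \<and> \<phi> w = j}"
        using \<phi> ends bd by (auto simp: T_def)
    qed
    finally show ?thesis ..
  qed
  have proj: "sign_avg ?E (\<lambda>\<eta>. (\<Prod>t\<in>?E. \<eta> t) * graph_matrix \<alpha> n (\<lambda>f. s \<eta> f * \<xi> f) i j) (\<lambda>_. 1) =
      real (card \<Psi>) * typed_matrix \<alpha> V \<xi> i j" if ij: "i \<in> V u" "j \<in> V w" for \<xi> i j
  proof -
    have gm: "graph_matrix \<alpha> n \<xi>' i j = (\<Sum>\<phi>\<in>\<Phi> i j. wt \<xi>' \<phi>)" for \<xi>'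
      by (simp add: graph_matrix_def \<Phi>_def bd wt_def)
    define N where "N \<phi> t = card {e \<in> ?E. hits V (\<phi> ` e) t}" for \<phi> t
    have wts: "(\<Prod>t\<in>?E. \<eta> t) * wt (\<lambda>f. s \<eta> f * \<xi> f) \<phi> = (\<Prod>t\<in>?E. \<eta> t ^ Suc (N \<phi> t)) * wt \<xi> \<phi>"
      if "\<phi> \<in> \<Phi> i j" for \<phi> \<eta>
    proof -
      have "(\<Prod>e\<in>?E. s \<eta> (\<phi> ` e)) = (\<Prod>e\<in>?E. \<Prod>t\<in>?E. if hits V (\<phi> ` e) t then \<eta> t else 1)"
        unfolding s_def using that pair by (intro prod.cong refl) (auto simp: \<Phi>_def)
      also have "\<dots> = (\<Prod>t\<in>?E. \<Prod>e\<in>?E. if hits V (\<phi> ` e) t then \<eta> t else 1)" by (rule prod.swap)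
      also have "\<dots> = (\<Prod>t\<in>?E. \<eta> t ^ N \<phi> t)"
        using finE by (intro prod.cong refl) (simp add: prod.If_cases N_def Int_def)
      finally show ?thesis
        by (simp add: wt_def prod.distrib mult_ac)
    qed
    have "sign_avg ?E (\<lambda>\<eta>. (\<Prod>t\<in>?E. \<eta> t) * graph_matrix \<alpha> n (\<lambda>f. s \<eta> f * \<xi> f) i j) (\<lambda>_. 1) =
        sign_avg ?E (\<lambda>\<eta>. \<Sum>\<phi>\<in>\<Phi> i j. (\<Prod>t\<in>?E. \<eta> t ^ Suc (N \<phi> t)) * wt \<xi> \<phi>) (\<lambda>_. 1)"
      unfolding gm sum_distrib_left by (simp add: wts cong: sum.cong)
    also have "\<dots> = (\<Sum>\<phi>\<in>\<Phi> i j. of_bool (good \<phi>) * wt \<xi> \<phi>)"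
      unfolding sign_avg_sum sign_avg_cmult_right sign_avg_prod_powers[OF finE]
      by (intro sum.cong refl) (simp add: good_def N_def)
    also have "\<dots> = (\<Sum>\<phi>\<in>{\<phi> \<in> \<Phi> i j. good \<phi>}. wt \<xi> \<phi>)"
      using fin\<Phi> by (intro sum.mono_neutral_cong_right) auto
    also have "{\<phi> \<in> \<Phi> i j. good \<phi>} = (\<Union>\<psi>\<in>\<Psi>. T \<psi> i j)"
    proof (intro equalityI subsetI)
      fix \<phi> assume "\<phi> \<in> {\<phi> \<in> \<Phi> i j. good \<phi>}"
      then show "\<phi> \<in> (\<Union>\<psi>\<in>\<Psi>. T \<psi> i j)" using good_T[of \<phi> i j] ij by simp
    next
      fix \<phi> assume "\<phi> \<in> (\<Union>\<psi>\<in>\<Psi>. T \<psi> i j)"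
      then obtain \<psi> where "\<psi> \<in> \<Psi>" "\<phi> \<in> T \<psi> i j" by blast
      then show "\<phi> \<in> {\<phi> \<in> \<Phi> i j. good \<phi>}" using T_good[of \<psi> \<phi> i j] by simp
    qed
    also have "(\<Sum>\<phi>\<in>(\<Union>\<psi>\<in>\<Psi>. T \<psi> i j). wt \<xi> \<phi>) = (\<Sum>\<psi>\<in>\<Psi>. \<Sum>\<phi>\<in>T \<psi> i j. wt \<xi> \<phi>)"
      using fin\<Psi> finT T_disj by (intro sum.UNION_disjoint) auto
    also have "\<dots> = real (card \<Psi>) * typed_matrix \<alpha> V \<xi> i j" by (simp add: T_sum)
    finally show ?thesis .
  qed
  \<comment> \<open>The identity belongs to \<Psi>, so the division by its cardinality does not
    enlarge the bound.\<close>
  have "(\<lambda>x\<in>?W. x) \<in> \<Psi>"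
  proof -
    have "(\<lambda>x\<in>?W. x) ` e = e" if "e \<in> ?E" for e using edges[OF that] by (auto simp: image_def)
    then show ?thesis using bd by (auto simp: \<Psi>_def bij_betw_def inj_on_def)
  qed
  then have c1: "1 \<le> real (card \<Psi>)" using fin\<Psi> by (metis One_nat_def Suc_leI card_gt_0_iff empty_iff of_nat_1 of_nat_le_iff)
  define N where "N \<xi> = op_norm {1..n} {1..n} (graph_matrix \<alpha> n \<xi>)" for \<xi>
  have pt: "op_norm (V u) (V w) (typed_matrix \<alpha> V \<xi>) \<le> sign_avg ?E (\<lambda>\<eta>. N (\<lambda>f. s \<eta> f * \<xi> f)) (\<lambda>_. 1)" for \<xi>
  proof -
    have "op_norm (V u) (V w) (typed_matrix \<alpha> V \<xi>) = op_norm (V u) (V w) (\<lambda>i j. 1 / real (card \<Psi>) *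
        sign_avg ?E (\<lambda>\<eta>. (\<Prod>t\<in>?E. \<eta> t) * graph_matrix \<alpha> n (\<lambda>f. s \<eta> f * \<xi> f) i j) (\<lambda>_. 1))"
      using c1 by (intro op_norm_cong) (simp add: proj)
    also have "\<dots> \<le> \<bar>1 / real (card \<Psi>)\<bar> * op_norm (V u) (V w) (\<lambda>i j.
        sign_avg ?E (\<lambda>\<eta>. (\<Prod>t\<in>?E. \<eta> t) * graph_matrix \<alpha> n (\<lambda>f. s \<eta> f * \<xi> f) i j) (\<lambda>_. 1))"
      by (rule op_norm_cmult_le[OF finV])
    also have "\<dots> \<le> 1 * op_norm (V u) (V w) (\<lambda>i j.
        sign_avg ?E (\<lambda>\<eta>. (\<Prod>t\<in>?E. \<eta> t) * graph_matrix \<alpha> n (\<lambda>f. s \<eta> f * \<xi> f) i j) (\<lambda>_. 1))"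
      using c1 by (intro mult_right_mono) auto
    also have "\<dots> \<le> sign_avg ?E (\<lambda>\<eta>. op_norm (V u) (V w) (\<lambda>i j. (\<Prod>t\<in>?E. \<eta> t) * graph_matrix \<alpha> n (\<lambda>f. s \<eta> f * \<xi> f) i j)) (\<lambda>_. 1)"
      using op_norm_sign_avg_le[OF finV] by simp
    also have "\<dots> \<le> sign_avg ?E (\<lambda>\<eta>. N (\<lambda>f. s \<eta> f * \<xi> f)) (\<lambda>_. 1)"
    proof (intro sign_avg_mono)
      fix \<eta> :: "'a set \<Rightarrow> real" assume \<eta>: "is_sign ?E \<eta>"
      have "\<bar>\<Prod>t\<in>?E. \<eta> t\<bar> = 1" unfolding abs_prod using \<eta> by (intro prod.neutral) (auto simp: is_sign_def)
      then have "op_norm (V u) (V w) (\<lambda>i j. (\<Prod>t\<in>?E. \<eta> t) * graph_matrix \<alpha> n (\<lambda>f. s \<eta> f * \<xi> f) i j) \<le>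
          op_norm (V u) (V w) (graph_matrix \<alpha> n (\<lambda>f. s \<eta> f * \<xi> f))"
        using op_norm_cmult_le[OF finV, of "V u" w "\<Prod>t\<in>?E. \<eta> t" "graph_matrix \<alpha> n (\<lambda>f. s \<eta> f * \<xi> f)"] by simp
      also have "\<dots> \<le> N (\<lambda>f. s \<eta> f * \<xi> f)"
        unfolding N_def using V(1) by (intro op_norm_submatrix_le) auto
      finally show "op_norm (V u) (V w) (\<lambda>i j. (\<Prod>t\<in>?E. \<eta> t) * graph_matrix \<alpha> n (\<lambda>f. s \<eta> f * \<xi> f) i j)
          \<le> N (\<lambda>f. s \<eta> f * \<xi> f)" .
    qed
    finally show ?thesis .
  qed
  have flip: "sign_avg ?J (\<lambda>\<xi>. N (\<lambda>f. s \<eta> f * \<xi> f)) (\<lambda>_. 0) = sign_avg ?J N (\<lambda>_. 0)" if \<eta>: "is_sign ?E \<eta>" for \<eta>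
  proof (rule sign_avg_flip)
    fix f
    have "(\<Prod>t\<in>X. if f \<in> ?J \<and> hits V f t then \<eta> t else 1) = 1 \<or> (\<Prod>t\<in>X. if f \<in> ?J \<and> hits V f t then \<eta> t else 1) = -1"
      if "X \<subseteq> ?E" for X
      using finite_subset[OF that finE] that
    proof (induction X rule: finite_induct)
      case (insert t X)
      then have "(if f \<in> ?J \<and> hits V f t then \<eta> t else 1) = 1 \<or> (if f \<in> ?J \<and> hits V f t then \<eta> t else 1) = -1"
        using \<eta> by (auto simp: is_sign_def)
      then show ?case using insert by auto
    qed simp
    then show "s \<eta> f = 1 \<or> s \<eta> f = -1" by (simp add: s_def)
    show "f \<notin> ?J \<Longrightarrow> s \<eta> f = 1" by (simp add: s_def)
  qed simp
  have "sign_avg ?J (\<lambda>\<xi>. op_norm (V u) (V w) (typed_matrix \<alpha> V \<xi>)) (\<lambda>_. 0) \<le>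
      sign_avg ?J (\<lambda>\<xi>. sign_avg ?E (\<lambda>\<eta>. N (\<lambda>f. s \<eta> f * \<xi> f)) (\<lambda>_. 1)) (\<lambda>_. 0)"
    by (intro sign_avg_mono pt)
  also have "\<dots> = sign_avg ?E (\<lambda>\<eta>. sign_avg ?J (\<lambda>\<xi>. N (\<lambda>f. s \<eta> f * \<xi> f)) (\<lambda>_. 0)) (\<lambda>_. 1)"
    by (rule sign_avg_swap[symmetric])
  also have "\<dots> = sign_avg ?E (\<lambda>\<eta>. sign_avg ?J N (\<lambda>_. 0)) (\<lambda>_. 1)"
    by (intro sign_avg_cong flip)
  also have "\<dots> = expected_norm \<alpha> n"
    using finE by (simp add: expected_norm_eq_sign_avg N_def[abs_def])
  finally show ?thesis .
qed

section \<open>Expected norms of leaf-decorated chains\<close>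

lemma left_bd_chain [simp]: "left_bd (chain L q) = [Spine 0]"
  and right_bd_chain [simp]: "right_bd (chain L q) = [Spine (Suc L)]"
  by (simp_all add: chain_def)

lemma chain_cong:
  assumes "\<And>j. 1 \<le> j \<Longrightarrow> j \<le> L \<Longrightarrow> q j = q' j"
  shows "chain L q = chain L q'"
proof -
  have "1 \<le> j \<and> j \<le> L \<and> k < q j \<longleftrightarrow> 1 \<le> j \<and> j \<le> L \<and> k < q' j" for j k
    using assms[of j] by auto
  then show ?thesis unfolding chain_def by (simp only:)
qed

lemma chain_edges_verts: "e \<in> edges (chain L q) \<Longrightarrow> e \<subseteq> verts (chain L q) \<and> card e = 2"
  by (auto simp: chain_def)

lemma Union_chain_edges: "\<Union>(edges (chain L q)) = verts (chain L q)"
proof (intro equalityI)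
  show "verts (chain L q) \<subseteq> \<Union>(edges (chain L q))"
  proof
    fix x assume x: "x \<in> verts (chain L q)"
    show "x \<in> \<Union>(edges (chain L q))"
    proof (cases x)
      case (Spine i)
      show ?thesis
      proof (cases "i \<le> L")
        case True
        then have "{Spine i, Spine (i + 1)} \<in> edges (chain L q)" by (auto simp: chain_def)
        then show ?thesis using Spine by blast
      next
        case False
        then have "i = L + 1" using x Spine by (auto simp: chain_def)
        moreover have "{Spine L, Spine (L + 1)} \<in> edges (chain L q)" by (auto simp: chain_def)
        ultimately show ?thesis using Spine by blast
      qed
    next
      case (Leaf j l)
      then have "{Spine j, Leaf j l} \<in> edges (chain L q)" using x by (auto simp: chain_def)
      then show ?thesis using Leaf by blast
    qed
  qed
qed (use chain_edges_verts in blast)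

lemma finite_verts_chain [simp]: "finite (verts (chain L q))"
  using card_verts_chain[of L q] by (intro card_ge_0_finite) simp

lemma (in label_classes) sign_avg_typed_matrix_chain:
  assumes "q (Suc L) = 0"
  shows "sign_avg (label_pairs n) (\<lambda>\<xi>. op_norm (V (Spine 0)) (V (Spine (Suc L))) (typed_matrix (chain L q) V \<xi>)) \<xi>0 =
    sign_avg (walk_edges q V 0 (Suc L)) (\<lambda>\<xi>. op_norm (V (Spine 0)) (V (Spine (Suc L)))
      (\<lambda>a. walk q V 0 \<xi> (\<lambda>y. if a = y then 1 else 0) (Suc L))) \<xi>0"
proof -
  have "op_norm (V (Spine 0)) (V (Spine (Suc L))) (typed_matrix (chain L q) V \<xi>) =
      op_norm (V (Spine 0)) (V (Spine (Suc L))) (\<lambda>a. walk q V 0 \<xi> (\<lambda>y. if a = y then 1 else 0) (Suc L))" for \<xi>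
    by (intro op_norm_cong typed_matrix_chain assms) simp_all
  moreover have "depends_on (walk_edges q V 0 (Suc L)) (\<lambda>\<xi>. op_norm (V (Spine 0)) (V (Spine (Suc L)))
      (\<lambda>a. walk q V 0 \<xi> (\<lambda>y. if a = y then 1 else 0) (Suc L)))"
    unfolding depends_on_def
    by (intro allI impI op_norm_cong, rule depends_onD[OF depends_on_walk]) auto
  ultimately show ?thesis
    using walk_edges_sub[of q 0 "Suc L"] by (simp only: label_pairs_def[symmetric] sign_avg_restrict finite_label_pairs)
qed

lemma expected_norm_chain_upper:
  assumes q: "q (Suc L) = 0" and m: "\<And>i. 1 \<le> i \<Longrightarrow> i \<le> L \<Longrightarrow> q i \<le> m"
  shows "\<exists>C\<ge>0. \<forall>n. 3 \<le> n \<longrightarrow> card (verts (chain L q)) \<le> n \<longrightarrow>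
    expected_norm (chain L q) n \<le> C * (sqrt n ^ (L + 1 + (\<Sum>i=1..L. q i)) * sqrt (ln n) ^ m)"
proof -
  let ?\<alpha> = "chain L q"
  define v where "v = card (verts ?\<alpha>)"
  have "q i \<le> m" if "1 \<le> i" "i \<le> Suc L" for i using that q m[of i] by (cases "i = Suc L") auto
  then obtain C where C: "C \<ge> 0" "\<And>n V \<xi>. label_classes n V \<Longrightarrow> 3 \<le> n \<Longrightarrow>
    sign_avg (walk_edges q V 0 (Suc L)) (\<lambda>\<xi>. op_norm (V (Spine 0)) (V (Spine (Suc L)))
      (\<lambda>a. walk q V 0 \<xi> (\<lambda>y. if a = y then 1 else 0) (Suc L))) \<xi>
    \<le> C * sqrt n ^ (Suc L + (\<Sum>i=1..Suc L. q i)) * sqrt (ln n) ^ m"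
    using walk_norm_bound[of "Suc L" q m] by blast
  show ?thesis
  proof (intro exI[of _ "real v ^ v * C"] conjI allI impI)
    show "0 \<le> real v ^ v * C" using C by simp
    fix n :: nat assume n: "3 \<le> n" and vn: "card (verts ?\<alpha>) \<le> n"
    have "expected_norm ?\<alpha> n \<le> real v ^ v * (C * sqrt n ^ (Suc L + (\<Sum>i=1..Suc L. q i)) * sqrt (ln n) ^ m)"
      unfolding v_def
    proof (rule expected_norm_le_typed[OF _ vn])
      show "verts ?\<alpha> \<noteq> {}" using card_verts_chain[of L q] by force
      fix V :: "chain_vertex \<Rightarrow> nat set"
      assume V: "\<And>x. V x \<subseteq> {1..n}" "\<And>x y. x \<noteq> y \<Longrightarrow> V x \<inter> V y = {}"
      then interpret label_classes n V by unfold_locales auto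
      have "op_norm {1..n} {1..n} (typed_matrix ?\<alpha> V \<xi>) \<le> op_norm (V (Spine 0)) (V (Spine (Suc L))) (typed_matrix ?\<alpha> V \<xi>)" for \<xi>
      proof (rule op_norm_extend_le)
        fix i j assume ij: "i \<notin> V (Spine 0) \<or> j \<notin> V (Spine (Suc L))"
        have "Spine 0 \<in> verts ?\<alpha>" "Spine (Suc L) \<in> verts ?\<alpha>" by (auto simp: chain_def)
        then have empty: "{\<phi>. \<phi> \<in> PiE (verts ?\<alpha>) V \<and> map \<phi> (left_bd ?\<alpha>) = [i] \<and> map \<phi> (right_bd ?\<alpha>) = [j]} = {}"
          using ij by (auto dest: PiE_mem)
        show "typed_matrix ?\<alpha> V \<xi> i j = 0" unfolding typed_matrix_def empty by (rule sum.empty)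
      qed (use V in auto)
      then have "sign_avg (label_pairs n) (\<lambda>\<xi>. op_norm {1..n} {1..n} (typed_matrix ?\<alpha> V \<xi>)) (\<lambda>_. 0) \<le>
          sign_avg (label_pairs n) (\<lambda>\<xi>. op_norm (V (Spine 0)) (V (Spine (Suc L))) (typed_matrix ?\<alpha> V \<xi>)) (\<lambda>_. 0)"
        by (intro sign_avg_mono)
      also have "\<dots> \<le> C * sqrt n ^ (Suc L + (\<Sum>i=1..Suc L. q i)) * sqrt (ln n) ^ m"
        unfolding sign_avg_typed_matrix_chain[of q, OF q] by (rule C(2)[OF label_classes_axioms n])
      finally show "sign_avg (label_pairs n) (\<lambda>\<xi>. op_norm {1..n} {1..n} (typed_matrix ?\<alpha> V \<xi>)) (\<lambda>_. 0)
        \<le> C * sqrt n ^ (Suc L + (\<Sum>i=1..Suc L. q i)) * sqrt (ln n) ^ m" .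
    qed simp
    then show "expected_norm ?\<alpha> n \<le> real v ^ v * C * (sqrt n ^ (L + 1 + (\<Sum>i=1..L. q i)) * sqrt (ln n) ^ m)"
      using q by (simp add: mult_ac)
  qed
qed

section \<open>Lower bound for a chain, with the choice of the parameters\<close>

lemma ex_label_classes:
  assumes "finite W" "card W * m \<le> n"
  obtains V :: "'a \<Rightarrow> nat set"
  where "\<And>x. V x \<subseteq> {1..n}" "\<And>x y. x \<noteq> y \<Longrightarrow> V x \<inter> V y = {}" "\<And>x. x \<in> W \<Longrightarrow> card (V x) = m"
proof -
  obtain f where f: "bij_betw f W {0..<card W}" using ex_bij_betw_finite_nat[OF assms(1)] by blast
  define V where "V x = (if x \<in> W then {f x * m + 1..f x * m + m} else {})" for x
  show thesis
  proof (rule that[of V])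
    show "V x \<subseteq> {1..n}" for x
    proof (cases "x \<in> W")
      case True
      then have "Suc (f x) \<le> card W" using bij_betwE[OF f] by fastforce
      then have "Suc (f x) * m \<le> n" using assms(2) mult_le_mono1 order_trans by blast
      then show ?thesis using True by (auto simp: V_def)
    qed (simp add: V_def)
    show "V x \<inter> V y = {}" if "x \<noteq> y" for x y
    proof (cases "x \<in> W \<and> y \<in> W")
      case True
      then have "f x \<noteq> f y" using f that by (auto simp: bij_betw_def inj_on_def)
      then have "Suc (f x) * m \<le> f y * m \<or> Suc (f y) * m \<le> f x * m"
        by (metis Suc_leI linorder_neqE_nat mult_le_mono1)
      then show ?thesis using True by (auto simp: V_def)
    qed (auto simp: V_def)
  qed (simp add: V_def)
qed

lemma expected_norm_chain_ge:
  fixes k h b q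
  defines "m \<equiv> h * b" and "P \<equiv> (\<Sum>i=1..Suc k. q (1 + i))"
  assumes q: "q (Suc (Suc k)) = 0" "1 \<le> q 1" and m: "1 \<le> m"
    and n: "card (verts (chain (Suc k) q)) * m \<le> n"
    and big: "1 \<le> real m * (3 / 64) ^ (h * q 1)"
  shows "1 / 2 * (real h * sqrt b / 4) ^ q 1 * (real m * ((9 / 16) ^ Suc k * (9 / 16) ^ P * sqrt m ^ (k + P)))
    \<le> expected_norm (chain (Suc k) q) n"
proof -
  let ?\<alpha> = "chain (Suc k) q"
  obtain V where V: "\<And>x. V x \<subseteq> {1..n}" "\<And>x y. x \<noteq> y \<Longrightarrow> V x \<inter> V y = {}" "\<And>x. x \<in> verts ?\<alpha> \<Longrightarrow> card (V x) = m"
    using ex_label_classes[OF finite_verts_chain n] by metis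
  interpret label_classes n V by unfold_locales (use V in auto)
  have "1 / 2 * (real h * sqrt b / 4) ^ q 1 * (real m * ((9 / 16) ^ Suc k * (9 / 16) ^ P * sqrt m ^ (k + P))) \<le>
      sign_avg (walk_edges q V 0 (Suc (Suc k))) (\<lambda>\<xi>. op_norm (V (Spine 0)) (V (Spine (Suc (Suc k))))
      (\<lambda>a. walk q V 0 \<xi> (\<lambda>y. if a = y then 1 else 0) (Suc (Suc k)))) (\<lambda>_. 0)"
    unfolding m_def P_def
  proof (rule sign_avg_op_norm_walk_ge)
    show "card (V (Spine i)) = h * b" if "i \<le> Suc (Suc k)" for i
      using that V(3)[of "Spine i"] by (auto simp: chain_def m_def)
    show "card (V (Leaf i l)) = h * b" if "1 \<le> i" "i \<le> Suc (Suc k)" "l < q i" for i l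
    proof -
      have "i \<noteq> Suc (Suc k)" using that q by auto
      then show ?thesis using that V(3)[of "Leaf i l"] by (auto simp: chain_def m_def)
    qed
  qed (use q m big in \<open>auto simp: m_def\<close>)
  also have "\<dots> = sign_avg (label_pairs n) (\<lambda>\<xi>. op_norm (V (Spine 0)) (V (Spine (Suc (Suc k)))) (typed_matrix ?\<alpha> V \<xi>)) (\<lambda>_. 0)"
    using sign_avg_typed_matrix_chain[of q, OF q(1)] by simp
  also have "\<dots> \<le> expected_norm ?\<alpha> n"
    by (rule typed_le_expected_norm[OF finite_verts_chain chain_edges_verts Union_chain_edges])
       (use V in \<open>auto simp: chain_def\<close>)
  finally show ?thesis .
qed

text \<open>Each class receives \<open>m = h * b\<close> labels. As
  \<open>h * sqrt b = sqrt (h * m)\<close>, taking \<open>h\<close> of order \<open>ln n\<close> and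
  \<open>m\<close> of order \<open>n\<close> makes a leaf sum of order
  \<open>sqrt (n * ln n)\<close>. The constant in front of \<open>ln n\<close> must be small enough
  for the tail probability to exceed \<open>1 / m\<close>.\<close>

lemma expected_norm_chain_lower:
  assumes q: "q (Suc L) = 0" "1 \<le> q 1" and L: "1 \<le> L"
  shows "\<exists>c>0. eventually (\<lambda>n. c * (sqrt n ^ (L + 1 + (\<Sum>i=1..L. q i)) * sqrt (ln n) ^ q 1)
    \<le> expected_norm (chain L q) n) sequentially"
proof -
  obtain k where k: "L = Suc k" using L by (cases L) auto
  define v where "v = card (verts (chain L q))"
  have v: "1 \<le> v" by (simp add: v_def card_verts_chain)
  define P where "P = (\<Sum>i=1..Suc k. q (1 + i))"
  have PQ: "(\<Sum>i=1..L. q i) = q 1 + P"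
  proof -
    have "(\<Sum>i=1..L. q i) = (\<Sum>i=1..Suc L. q i)" using q by simp
    also have "\<dots> = q 1 + (\<Sum>i=2..Suc L. q i)" using L by (simp add: sum.atLeast_Suc_atMost numeral_2_eq_2)
    also have "(\<Sum>i=2..Suc L. q i) = P"
      unfolding P_def k using sum.shift_bounds_cl_Suc_ivl[of q 1 "Suc k"] by (simp add: numeral_2_eq_2)
    finally show ?thesis .
  qed
  \<comment> \<open>Lower constants for \<open>h\<close> and \<open>m\<close>:
    \<open>a * ln n \<le> h\<close> and \<open>u * n \<le> m\<close>. Rounding
    \<open>ln n / (16 * q 1)\<close> down loses at most a factor 2, whence 32; splitting
    \<open>n\<close> labels among \<open>v\<close> classes of a size divisible by \<open>h\<close>
    loses at most another factor 2, since \<open>h\<close> is at most \<open>u * n\<close>.\<close>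
  define a where "a = 1 / (32 * real (q 1))"
  define u where "u = 1 / (2 * real v)"
  have au: "0 < a" "0 < u" using q v by (auto simp: a_def u_def)
  define c where "c = 1 / 2 * (sqrt (a * u) / 4) ^ q 1 * (u * ((9 / 16) ^ Suc k * (9 / 16) ^ P * sqrt u ^ (k + P)))"
  have c0: "0 < c" using au by (simp add: c_def)
  have "eventually (\<lambda>n::nat. 32 * real (q 1) \<le> ln n) sequentially" by real_asymp
  moreover have "eventually (\<lambda>n::nat. ln n \<le> sqrt n) sequentially" by real_asymp
  moreover have "eventually (\<lambda>n::nat. 2 * real v \<le> sqrt n) sequentially" by real_asymp
  ultimately have "eventually (\<lambda>n. c * (sqrt n ^ (L + 1 + (\<Sum>i=1..L. q i)) * sqrt (ln n) ^ q 1)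
    \<le> expected_norm (chain L q) n) sequentially"
  proof eventually_elim
    case (elim n)
    have ln1: "1 \<le> ln (real n)" using elim(1) q by linarith
    define s l where "s = sqrt (real n)" and "l = ln (real n)"
    have n0: "0 < real n" using ln1 by (cases "n = 0") auto
    have s: "0 < s" "s * s = real n" "2 * real v \<le> s" "l \<le> s" using n0 elim by (auto simp: s_def l_def)
    define h where "h = nat \<lfloor>l / (16 * real (q 1))\<rfloor>"
    define b where "b = n div (v * h)"
    define m where "m = h * b"
    have x2: "2 \<le> l / (16 * real (q 1))" using elim(1) q by (simp add: l_def field_simps)
    have h: "1 \<le> h" "real h \<le> l / (16 * real (q 1))" "a * l \<le> real h"
    proof -
      have "real h = of_int \<lfloor>l / (16 * real (q 1))\<rfloor>" unfolding h_def using x2 by simp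
      then show h2: "real h \<le> l / (16 * real (q 1))" and "1 \<le> h" using x2 by linarith+
      have "x / 2 \<le> of_int \<lfloor>x\<rfloor>" if "2 \<le> x" for x :: real using that by linarith
      from this[OF x2] have "l / (16 * real (q 1)) / 2 \<le> real h" using \<open>real h = _\<close> by simp
      then show "a * l \<le> real h" by (simp add: a_def)
    qed
    have hl: "real h \<le> s"
    proof -
      have "l / (16 * real (q 1)) \<le> l / 1" using q ln1 by (intro divide_left_mono) (auto simp: l_def)
      then show ?thesis using h(2) s by simp
    qed
    have us: "s \<le> u * real n"
    proof -
      have "2 * real v * s \<le> s * s" using s by (intro mult_right_mono) auto
      then show ?thesis using v s(2) by (simp add: u_def field_simps)
    qed
    have um: "u * real n \<le> real m"
    proof -
      have "real n < real (v * h) * (real b + 1)"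
      proof -
        have "n < v * h * (b + 1)"
          unfolding b_def using v h dividend_less_times_div[of "v * h" n] by simp
        then show ?thesis by (metis of_nat_1 of_nat_add of_nat_less_iff of_nat_mult)
      qed
      also have "\<dots> = real v * (real m + real h)" by (simp add: m_def algebra_simps)
      finally have "real n / real v < real m + real h" using v by (simp add: field_simps)
      moreover have "real n / real v = 2 * (u * real n)" by (simp add: u_def)
      ultimately show ?thesis using us hl by linarith
    qed
    have m1: "1 \<le> m"
    proof -
      have "0 < u * real n" using au n0 by simp
      then show ?thesis using um by simp
    qed
    have vm: "card (verts (chain (Suc k) q)) * m \<le> n"
    proof -
      have "v * h * b \<le> n" by (simp add: b_def)
      then show ?thesis by (simp add: m_def v_def k mult.assoc)
    qed
    have big: "1 \<le> real m * (3 / 64) ^ (h * q 1)"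
    proof -
      \<comment> \<open>The crude bound 64/3 \<le> exp 8, together with
        \<open>h * q 1 \<le> ln n / 16\<close>, bounds the reciprocal tail probability by
        \<open>sqrt n\<close>, which is below the number of labels in a class.\<close>
      have "(64 / 3) ^ (h * q 1) \<le> (exp 8 :: real) ^ (h * q 1)"
      proof (rule power_mono)
        have "(2::real) ^ 8 \<le> exp 1 ^ 8" using exp_ge_add_one_self[of 1] by (intro power_mono) auto
        then show "64 / 3 \<le> (exp 8 :: real)" by (simp flip: exp_of_nat_mult)
      qed simp
      also have "\<dots> = exp (8 * (real h * real (q 1)))" by (simp flip: exp_of_nat_mult add: mult_ac)
      also have "\<dots> \<le> exp (l / 2)"
      proof (subst exp_le_cancel_iff)
        have "real h * real (q 1) \<le> l / (16 * real (q 1)) * real (q 1)" using h by (intro mult_right_mono) auto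
        then show "8 * (real h * real (q 1)) \<le> l / 2" using q by simp
      qed
      also have "\<dots> = s" using n0 by (simp add: s_def l_def ln_sqrt[symmetric])
      also have "\<dots> \<le> real m" using us um by simp
      finally have "(64 / 3) ^ (h * q 1) * (3 / 64) ^ (h * q 1) \<le> real m * (3 / 64) ^ (h * q 1)"
        by (intro mult_right_mono) auto
      then show ?thesis by (simp flip: power_mult_distrib)
    qed
    have hb: "sqrt (a * u) * (sqrt l * s) \<le> real h * sqrt b"
    proof -
      have "sqrt (a * u) * (sqrt l * s) = sqrt ((a * l) * (u * real n))"
        by (simp add: real_sqrt_mult s_def mult_ac)
      also have "\<dots> \<le> sqrt (real h * real m)"
        using h um au ln1 by (intro real_sqrt_le_mono mult_mono) (auto simp: l_def)
      also have "\<dots> = real h * sqrt b" by (simp add: m_def real_sqrt_mult)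
      finally show ?thesis .
    qed
    have sm: "sqrt u * s \<le> sqrt m"
      using um by (simp add: s_def flip: real_sqrt_mult)
    have "c * (s ^ (L + 1 + (\<Sum>i=1..L. q i)) * sqrt l ^ q 1) =
      1 / 2 * ((sqrt (a * u) * (sqrt l * s)) / 4) ^ q 1 *
      ((u * real n) * ((9 / 16) ^ Suc k * (9 / 16) ^ P * (sqrt u * s) ^ (k + P)))"
      unfolding PQ unfolding k s(2)[symmetric] c_def power_mult_distrib power_divide by (simp add: power_add power_mult_distrib mult_ac)
    also have "\<dots> \<le> 1 / 2 * (real h * sqrt b / 4) ^ q 1 *
      (real m * ((9 / 16) ^ Suc k * (9 / 16) ^ P * sqrt m ^ (k + P)))"
    proof -
      have p1: "(sqrt (a * u) * (sqrt l * s) / 4) ^ q 1 \<le> (real h * sqrt b / 4) ^ q 1"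
        using hb au s ln1 by (intro power_mono divide_right_mono) (auto simp: l_def)
      have p2: "(sqrt u * s) ^ (k + P) \<le> sqrt m ^ (k + P)"
        using sm au s by (intro power_mono) auto
      show ?thesis
        by (rule mult_mono[OF mult_left_mono[OF p1] mult_mono[OF um mult_left_mono[OF p2]]])
           (use au s ln1 in \<open>auto simp: l_def\<close>)
    qed
    also have "\<dots> \<le> expected_norm (chain L q) n"
      unfolding k P_def m_def
      by (rule expected_norm_chain_ge) (use q m1 vm big in \<open>auto simp: k m_def\<close>)
    finally show ?case by (simp add: s_def l_def)
  qed
  then show ?thesis using c0 by blast
qed

theorem expected_norm_chain_bigtheta:
  assumes L: "1 \<le> L" and q1: "1 \<le> q 1" and max: "\<And>i. 1 \<le> i \<Longrightarrow> i \<le> L \<Longrightarrow> q i \<le> q 1"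
  shows "expected_norm (chain L q) \<in> \<Theta>(\<lambda>n. sqrt n ^ (L + 1 + (\<Sum>i=1..L. q i)) * sqrt (ln n) ^ q 1)"
proof -
  \<comment> \<open>The walk attaches the leaves of every vertex it reaches, the endpoint included.
    Since the shape only uses the decoration at the inner vertices, the values beyond
    \<open>L\<close> are set to 0.\<close>
  define q' where "q' i = (if i \<le> L then q i else 0)" for i
  have eq: "chain L q = chain L q'" by (rule chain_cong) (simp add: q'_def)
  have q': "q' (Suc L) = 0" "1 \<le> q' 1" "q' 1 = q 1" "(\<Sum>i=1..L. q' i) = (\<Sum>i=1..L. q i)"
    using L q1 by (simp_all add: q'_def)
  have "q' i \<le> q 1" if "1 \<le> i" "i \<le> L" for i using max that by (simp add: q'_def)
  then obtain C where C: "C \<ge> 0" "\<And>n. 3 \<le> n \<Longrightarrow> card (verts (chain L q')) \<le> n \<Longrightarrow>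
    expected_norm (chain L q') n \<le> C * (sqrt n ^ (L + 1 + (\<Sum>i=1..L. q i)) * sqrt (ln n) ^ q 1)"
    using expected_norm_chain_upper[of q', OF q'(1), where m = "q 1"] unfolding q' by blast
  obtain c where c: "c > 0" "eventually (\<lambda>n. c * (sqrt n ^ (L + 1 + (\<Sum>i=1..L. q i)) * sqrt (ln n) ^ q 1)
    \<le> expected_norm (chain L q') n) sequentially"
    using expected_norm_chain_lower[of q', OF q'(1,2) L] unfolding q' by blast
  have nonneg: "0 \<le> expected_norm (chain L q') n" for n
    unfolding expected_norm_eq_sign_avg by (intro sign_avg_nonneg) simp
  have ev: "eventually (\<lambda>n::nat. 3 \<le> n \<and> card (verts (chain L q')) \<le> n) sequentially"
    by (intro eventually_conj eventually_ge_at_top)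
  have pos: "0 \<le> sqrt (real n) ^ (L + 1 + (\<Sum>i=1..L. q i)) * sqrt (ln (real n)) ^ q 1" if "3 \<le> n" for n :: nat
    using that by (intro mult_nonneg_nonneg zero_le_power) auto
  show ?thesis unfolding eq
  proof (rule bigthetaI)
    show "expected_norm (chain L q') \<in> O(\<lambda>n. sqrt n ^ (L + 1 + (\<Sum>i=1..L. q i)) * sqrt (ln n) ^ q 1)"
    proof (rule bigoI[of _ C], use ev in eventually_elim)
      case (elim n)
      then show ?case using C(2)[of n] nonneg[of n] pos[of n] by simp
    qed
    show "expected_norm (chain L q') \<in> \<Omega>(\<lambda>n. sqrt n ^ (L + 1 + (\<Sum>i=1..L. q i)) * sqrt (ln n) ^ q 1)"
    proof (rule landau_omega.bigI[OF c(1)], use ev c(2) in eventually_elim)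
      case (elim n)
      then show ?case using nonneg[of n] pos[of n] by simp
    qed
  qed
qed

section \<open>Combinatorics of leaf-decorated chains\<close>

text \<open>Connectedness as an induction principle: a set that contains \<open>x\<^sub>0\<close>
  and is closed under edges contains every vertex.\<close>

lemma chain_connected:
  assumes S: "\<And>e. e \<in> edges (chain L q) \<Longrightarrow> e \<inter> S \<noteq> {} \<Longrightarrow> e \<subseteq> S" and "Spine 0 \<in> S"
  shows "verts (chain L q) \<subseteq> S"
proof -
  have spine: "Spine i \<in> S" if "i \<le> L + 1" for i
    using that
  proof (induction i)
    case (Suc i)
    then have "{Spine i, Spine (i + 1)} \<in> edges (chain L q)" by (auto simp: chain_def)
    then show ?case using S[of "{Spine i, Spine (i + 1)}"] Suc by auto
  qed (use assms(2) in simp)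
  have "Leaf j k \<in> S" if "1 \<le> j" "j \<le> L" "k < q j" for j k
  proof -
    have "{Spine j, Leaf j k} \<in> edges (chain L q)" using that by (auto simp: chain_def)
    then show ?thesis using S[of "{Spine j, Leaf j k}"] spine[of j] that by auto
  qed
  then show ?thesis using spine by (auto simp: chain_def)
qed

lemma chain_edge_Leaf: "{Leaf j k, x} \<in> edges (chain L q) \<Longrightarrow> x = Spine j"
  by (auto simp: chain_def doubleton_eq_iff)

lemma chain_edge_Spine: "{Spine i, Spine j} \<in> edges (chain L q) \<Longrightarrow> j = i + 1 \<or> i = j + 1"
  by (auto simp: chain_def doubleton_eq_iff)

text \<open>The cyclic successor and predecessor; they differ because the length is at least
  3.\<close>

lemma cycle_two_neighbours:
  assumes len: "3 \<le> length c" and dist: "distinct c"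
    and succ: "successively (\<lambda>x y. {x, y} \<in> E) c" "{last c, hd c} \<in> E" and x: "x \<in> set c"
  obtains y z where "y \<in> set c" "z \<in> set c" "y \<noteq> z" "{x, y} \<in> E" "{x, z} \<in> E"
proof -
  define m where "m = length c"
  obtain i where i: "i < m" "x = c ! i" using x by (auto simp: in_set_conv_nth m_def)
  have next_edge: "{c ! i, c ! Suc i} \<in> E" if "Suc i < m" for i
    using succ(1) that by (auto simp: successively_conv_nth m_def)
  have wrap: "{c ! (m - 1), c ! 0} \<in> E"
  proof -
    have "c \<noteq> []" using len by auto
    then show ?thesis using succ(2) by (simp add: m_def last_conv_nth hd_conv_nth)
  qed
  define y z where "y = (if Suc i < m then c ! Suc i else c ! 0)" and "z = (if i = 0 then c ! (m - 1) else c ! (i - 1))"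
  show thesis
  proof
    show "y \<in> set c" "z \<in> set c" using i len by (auto simp: y_def z_def m_def intro!: nth_mem)
    show "y \<noteq> z"
    proof -
      define iy iz where "iy = (if Suc i < m then Suc i else 0)" and "iz = (if i = 0 then m - 1 else i - 1)"
      have "y = c ! iy" "z = c ! iz" by (simp_all add: y_def z_def iy_def iz_def)
      moreover have "iy < m" "iz < m" "iy \<noteq> iz" using i len by (auto simp: iy_def iz_def m_def)
      ultimately show ?thesis using nth_eq_iff_index_eq[OF dist, of iy iz] by (simp add: m_def)
    qed
    show "{x, y} \<in> E"
    proof (cases "Suc i < m")
      case False
      then have "i = m - 1" using i by simp
      then show ?thesis using wrap False i by (simp add: y_def)
    qed (use next_edge i in \<open>simp add: y_def\<close>)
    show "{x, z} \<in> E"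
    proof (cases "i = 0")
      case False
      then show ?thesis using next_edge[of "i - 1"] i by (simp add: z_def insert_commute)
    qed (use wrap i in \<open>simp add: z_def insert_commute\<close>)
  qed
qed

text \<open>A cycle contains no leaf, since a leaf has only one neighbour. On a cycle of spine
  vertices, the one of largest index would need two distinct neighbours of smaller index.\<close>

lemma is_tree_chain: "is_tree (chain L q)"
  unfolding is_tree_def
proof (intro conjI ballI notI)
  fix x y assume x: "x \<in> verts (chain L q)" and y: "y \<in> verts (chain L q)"
  let ?r = "{(a, b). {a, b} \<in> edges (chain L q)}"
  have sym: "sym (?r\<^sup>*)" by (intro sym_rtrancl) (auto simp: sym_def insert_commute)
  have "verts (chain L q) \<subseteq> {z. (Spine 0, z) \<in> ?r\<^sup>*}"
  proof (rule chain_connected)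
    fix e assume e: "e \<in> edges (chain L q)" "e \<inter> {z. (Spine 0, z) \<in> ?r\<^sup>*} \<noteq> {}"
    then obtain a where a: "a \<in> e" "(Spine 0, a) \<in> ?r\<^sup>*" by blast
    have "(Spine 0, b) \<in> ?r\<^sup>*" if b: "b \<in> e" for b
    proof (cases "b = a")
      case False
      have "card e = 2" using chain_edges_verts[OF e(1)] by simp
      then have "e = {a, b}" using a(1) b False by (auto simp: card_2_iff)
      then show ?thesis using a(2) e(1) by (auto intro: rtrancl_into_rtrancl)
    qed (use a in simp)
    then show "e \<subseteq> {z. (Spine 0, z) \<in> ?r\<^sup>*}" by blast
  qed simp
  then have "(Spine 0, x) \<in> ?r\<^sup>*" "(Spine 0, y) \<in> ?r\<^sup>*" using x y by auto
  then show "(x, y) \<in> ?r\<^sup>*" using sym by (meson rtrancl_trans symD)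
next
  assume "\<exists>c. 3 \<le> length c \<and> distinct c \<and> successively (\<lambda>x y. {x, y} \<in> edges (chain L q)) c \<and> {last c, hd c} \<in> edges (chain L q)"
  then obtain c where c: "3 \<le> length c" "distinct c"
    "successively (\<lambda>x y. {x, y} \<in> edges (chain L q)) c" "{last c, hd c} \<in> edges (chain L q)" by blast
  note nb = cycle_two_neighbours[OF c]
  have no_leaf: "Leaf j k \<notin> set c" for j k
  proof
    assume "Leaf j k \<in> set c"
    then obtain y z where "y \<noteq> z" "{Leaf j k, y} \<in> edges (chain L q)" "{Leaf j k, z} \<in> edges (chain L q)"
      by (rule nb)
    then show False using chain_edge_Leaf by blast
  qed
  define I where "I = {i. Spine i \<in> set c}"
  have "finite I" unfolding I_def by (rule finite_vimageI[of "set c" Spine, unfolded vimage_def]) (auto simp: inj_def)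
  moreover have "I \<noteq> {}"
  proof -
    obtain x where "x \<in> set c" using c(1) by (cases c) auto
    then have "\<exists>i. x = Spine i" using no_leaf chain_vertex.exhaust[of x] by metis
    then show ?thesis using \<open>x \<in> set c\<close> by (auto simp: I_def)
  qed
  ultimately have max: "Max I \<in> I" "\<And>i. i \<in> I \<Longrightarrow> i \<le> Max I" by auto
  then have "Spine (Max I) \<in> set c" by (simp add: I_def)
  then obtain y z where yz: "y \<in> set c" "z \<in> set c" "y \<noteq> z"
    "{Spine (Max I), y} \<in> edges (chain L q)" "{Spine (Max I), z} \<in> edges (chain L q)"
    by (rule nb)
  have "\<exists>a. y = Spine a" "\<exists>b. z = Spine b"
    using yz(1,2) no_leaf chain_vertex.exhaust[of y] chain_vertex.exhaust[of z] by metis+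
  then obtain a b where ab: "y = Spine a" "z = Spine b" by blast
  then have "a \<in> I" "b \<in> I" "a \<noteq> b" using yz by (auto simp: I_def)
  then show False
    using max(2)[of a] max(2)[of b] chain_edge_Spine[of "Max I" a L q] chain_edge_Spine[of "Max I" b L q] yz ab by auto
qed

lemma num_isolated_chain: "num_isolated (chain L q) = 0"
proof -
  have "\<exists>e\<in>edges (chain L q). x \<in> e" if "x \<in> verts (chain L q)" for x
    using that unfolding Union_chain_edges[symmetric] by blast
  then show ?thesis unfolding num_isolated_def by (auto simp: card_eq_0_iff)
qed

text \<open>The spine is a boundary path, so the empty set does not separate; the single vertex
  \<open>x\<^sub>0\<close> does.\<close>

lemma min_separator_chain: "min_separator (chain L q) = 1"
  unfolding min_separator_def
proof (rule Min_eqI)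
  let ?A = "{S. S \<subseteq> verts (chain L q) \<and> (\<forall>p. boundary_path (chain L q) p \<longrightarrow> set p \<inter> S \<noteq> {})}"
  have fin: "finite ?A" by (rule finite_subset[of _ "Pow (verts (chain L q))"]) auto
  then show "finite (card ` ?A)" by simp
  have path: "boundary_path (chain L q) (map Spine [0..<N])" if N: "N = L + 2" for N
  proof -
    have "hd (map Spine [0..<N]) = Spine 0" "last (map Spine [0..<N]) = Spine (L + 1)"
      using N by (auto simp: hd_map last_map simp del: upt_Suc)
    then show ?thesis unfolding boundary_path_def using N
      by (auto simp: chain_def distinct_map inj_on_def successively_conv_nth simp del: upt_Suc)
  qed
  have "S \<noteq> {} \<and> finite S" if "S \<in> ?A" for S
    using that path[OF refl] finite_subset[OF _ finite_verts_chain[of L q]] by auto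
  then show "1 \<le> y" if "y \<in> card ` ?A" for y
    using that by (auto simp: Suc_le_eq card_gt_0_iff)
  have "set p \<inter> {Spine 0} \<noteq> {}" if "boundary_path (chain L q) p" for p
    using that hd_in_set[of p] by (auto simp: boundary_path_def chain_def)
  then have "{Spine 0} \<in> ?A" by (auto simp: chain_def)
  then show "1 \<in> card ` ?A" by (rule rev_image_eqI) simp
qed

section \<open>Flattenings of the coefficient tensor\<close>

lemma op_norm_ge_block:
  assumes fin: "finite I" "finite J" and sub: "A \<subseteq> I" "B \<subseteq> J"
    and one: "\<And>i j. i \<in> A \<Longrightarrow> j \<in> B \<Longrightarrow> M i j = 1"
  shows "sqrt (card A * card B) \<le> op_norm I J M"
proof -
  have finAB: "finite A" "finite B" using fin sub finite_subset by auto
  have "sqrt (card A * card B) = L2_set (\<lambda>_. 1) A * L2_set (\<lambda>_. 1) B"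
    by (simp add: L2_set_def real_sqrt_mult)
  also have "\<dots> \<le> op_norm A B (\<lambda>i j. 1 * 1)" by (rule op_norm_rank_one_ge[OF finAB(2)])
  also have "\<dots> = op_norm A B M" using one by (intro op_norm_cong) simp
  also have "\<dots> \<le> op_norm I J M" by (rule op_norm_submatrix_le[OF fin(2,1) sub])
  finally show ?thesis .
qed

text \<open>Each entry is split into two square roots, and Cauchy-Schwarz is applied row by
  row.\<close>

lemma op_norm_schur_test:
  assumes fin: "finite I" "finite J" and M: "\<And>i j. i \<in> I \<Longrightarrow> j \<in> J \<Longrightarrow> 0 \<le> M i j"
    and row: "\<And>i. i \<in> I \<Longrightarrow> (\<Sum>j\<in>J. M i j) \<le> r" and col: "\<And>j. j \<in> J \<Longrightarrow> (\<Sum>i\<in>I. M i j) \<le> c"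
    and rc: "0 \<le> r" "0 \<le> c"
  shows "op_norm I J M \<le> sqrt (r * c)"
proof (rule op_norm_leI)
  fix x :: "_ \<Rightarrow> real"
  have "(\<Sum>i\<in>I. (\<Sum>j\<in>J. M i j * x j)\<^sup>2) \<le> (\<Sum>i\<in>I. r * (\<Sum>j\<in>J. M i j * (x j)\<^sup>2))"
  proof (intro sum_mono)
    fix i assume i: "i \<in> I"
    have "\<bar>\<Sum>j\<in>J. sqrt (M i j) * (sqrt (M i j) * x j)\<bar> \<le> L2_set (\<lambda>j. sqrt (M i j)) J * L2_set (\<lambda>j. sqrt (M i j) * x j) J"
      by (rule abs_sum_mult_le_L2)
    moreover have "(\<Sum>j\<in>J. sqrt (M i j) * (sqrt (M i j) * x j)) = (\<Sum>j\<in>J. M i j * x j)"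
      using M[OF i] by (intro sum.cong refl) (simp flip: mult.assoc)
    ultimately have "(\<Sum>j\<in>J. M i j * x j)\<^sup>2 \<le> (L2_set (\<lambda>j. sqrt (M i j)) J * L2_set (\<lambda>j. sqrt (M i j) * x j) J)\<^sup>2"
      by (simp add: abs_le_square_iff[symmetric])
    also have "\<dots> = (\<Sum>j\<in>J. M i j) * (\<Sum>j\<in>J. M i j * (x j)\<^sup>2)"
      using M[OF i] by (simp add: power_mult_distrib L2_set_power2 cong: sum.cong)
    also have "\<dots> \<le> r * (\<Sum>j\<in>J. M i j * (x j)\<^sup>2)"
      using row[OF i] M[OF i] by (intro mult_right_mono sum_nonneg) auto
    finally show "(\<Sum>j\<in>J. M i j * x j)\<^sup>2 \<le> r * (\<Sum>j\<in>J. M i j * (x j)\<^sup>2)" .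
  qed
  also have "\<dots> = r * (\<Sum>j\<in>J. (\<Sum>i\<in>I. M i j) * (x j)\<^sup>2)"
    unfolding sum_distrib_left[symmetric] by (subst sum.swap) (simp add: sum_distrib_right)
  also have "\<dots> \<le> r * (\<Sum>j\<in>J. c * (x j)\<^sup>2)"
    using col rc by (intro mult_left_mono sum_mono mult_right_mono) auto
  also have "\<dots> = r * c * (L2_set x J)\<^sup>2" by (simp add: L2_set_power2 sum_distrib_left mult_ac)
  finally have "L2_set (\<lambda>i. \<Sum>j\<in>J. M i j * x j) I \<le> sqrt (r * c * (L2_set x J)\<^sup>2)"
    unfolding L2_set_def[of _ I] by (rule real_sqrt_le_mono)
  then show "L2_set (\<lambda>i. \<Sum>j\<in>J. M i j * x j) I \<le> sqrt (r * c) * L2_set x J"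
    by (simp add: real_sqrt_mult)
qed (use rc in simp)

text \<open>The vertices whose labels appear on one side of the flattening. A vertex touched by both
  sides must carry the same label on both, so these vertices decide the block structure.\<close>

definition touched :: "'a shape \<Rightarrow> 'a axis set \<Rightarrow> 'a set" where
  "touched \<alpha> R = (\<Union>a\<in>R. axis_verts \<alpha> a)"

lemma coeff_tensor_01: "coeff_tensor \<alpha> \<iota> = 0 \<or> coeff_tensor \<alpha> \<iota> = 1"
  by (simp add: coeff_tensor_def)

lemma coeff_tensorD:
  assumes "coeff_tensor \<alpha> \<iota> \<noteq> 0" "a \<in> axes \<alpha>" "b \<in> axes \<alpha>" "x \<in> axis_verts \<alpha> a" "x \<in> axis_verts \<alpha> b"
  shows "\<iota> a x = \<iota> b x"
proof (rule ccontr)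
  assume "\<iota> a x \<noteq> \<iota> b x"
  then have "\<not> (\<forall>a\<in>axes \<alpha>. \<forall>b\<in>axes \<alpha>. \<forall>x\<in>axis_verts \<alpha> a \<inter> axis_verts \<alpha> b. \<iota> a x = \<iota> b x)"
    using assms(2-) by blast
  then have "coeff_tensor \<alpha> \<iota> = 0" unfolding coeff_tensor_def by (rule if_not_P)
  then show False using assms(1) by simp
qed

text \<open>A row or column sum counts compatible indices. Once the other side is fixed, the labels
  of all vertices it touches are forced, and an index is determined by the labels of the vertices
  touched by \<open>S\<close> alone.\<close>

lemma sum_coeff_tensor_le:
  assumes S: "S \<subseteq> axes \<alpha>" and fin: "finite (touched \<alpha> S)"
    and idx: "finite (PiE S (axis_index \<alpha> n))"
  shows "(\<Sum>\<gamma>\<in>PiE S (axis_index \<alpha> n). coeff_tensor \<alpha> (\<lambda>a. if a \<in> S then \<gamma> a else \<rho> a))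
    \<le> real n ^ card (touched \<alpha> S - touched \<alpha> (axes \<alpha> - S))"
proof -
  let ?X = "touched \<alpha> S - touched \<alpha> (axes \<alpha> - S)"
  define ct where "ct \<gamma> = coeff_tensor \<alpha> (\<lambda>a. if a \<in> S then \<gamma> a else \<rho> a)" for \<gamma>
  define G where "G = {\<gamma> \<in> PiE S (axis_index \<alpha> n). ct \<gamma> \<noteq> 0}"
  have "\<exists>a. a \<in> S \<and> x \<in> axis_verts \<alpha> a" if "x \<in> ?X" for x using that by (auto simp: touched_def)
  \<comment> \<open>Chooses for each free vertex one axis that displays its label; consistency makes
    the other axes agree with it.\<close>
  then obtain A where A: "\<And>x. x \<in> ?X \<Longrightarrow> A x \<in> S \<and> x \<in> axis_verts \<alpha> (A x)" by metis
  have "card G \<le> card (?X \<rightarrow>\<^sub>E {1..n})"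
  proof (rule card_inj_on_le[of "\<lambda>\<gamma>. \<lambda>x\<in>?X. \<gamma> (A x) x"])
    show "finite (?X \<rightarrow>\<^sub>E {1..n})" using fin by (intro finite_PiE) auto
    show "(\<lambda>\<gamma>. \<lambda>x\<in>?X. \<gamma> (A x) x) ` G \<subseteq> ?X \<rightarrow>\<^sub>E {1..n}"
    proof
      fix f assume "f \<in> (\<lambda>\<gamma>. \<lambda>x\<in>?X. \<gamma> (A x) x) ` G"
      then obtain \<gamma> where \<gamma>: "\<gamma> \<in> PiE S (axis_index \<alpha> n)" "f = (\<lambda>x\<in>?X. \<gamma> (A x) x)" by (auto simp: G_def)
      have "\<gamma> (A x) x \<in> {1..n}" if "x \<in> ?X" for x
      proof -
        have "\<gamma> (A x) \<in> axis_index \<alpha> n (A x)" using \<gamma>(1) A[OF that] by (auto dest: PiE_mem)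
        then show ?thesis using A[OF that] unfolding axis_index_def by (auto dest: PiE_mem)
      qed
      then show "f \<in> ?X \<rightarrow>\<^sub>E {1..n}" unfolding \<gamma>(2) by (intro restrict_PiE_iff[THEN iffD2] ballI)
    qed
    show "inj_on (\<lambda>\<gamma>. \<lambda>x\<in>?X. \<gamma> (A x) x) G"
    proof (rule inj_onI)
      fix \<gamma> \<gamma>' assume g: "\<gamma> \<in> G" "\<gamma>' \<in> G" and eq: "(\<lambda>x\<in>?X. \<gamma> (A x) x) = (\<lambda>x\<in>?X. \<gamma>' (A x) x)"
      have PiE: "\<gamma> \<in> PiE S (axis_index \<alpha> n)" "\<gamma>' \<in> PiE S (axis_index \<alpha> n)" and ct: "ct \<gamma> \<noteq> 0" "ct \<gamma>' \<noteq> 0"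
        using g by (auto simp: G_def)
      have pt: "\<gamma> a x = \<gamma>' a x" if a: "a \<in> S" and x: "x \<in> axis_verts \<alpha> a" for a x
      proof (cases "x \<in> ?X")
        case True
        have "\<gamma> a x = \<gamma> (A x) x" "\<gamma>' a x = \<gamma>' (A x) x"
          using coeff_tensorD[OF ct(1)[unfolded ct_def], of a "A x" x] coeff_tensorD[OF ct(2)[unfolded ct_def], of a "A x" x]
            A[OF True] a x S by auto
        moreover have "\<gamma> (A x) x = \<gamma>' (A x) x" using fun_cong[OF eq, of x] True by simp
        ultimately show ?thesis by simp
      next
        case False
        moreover have "x \<in> touched \<alpha> S" using a x by (auto simp: touched_def)
        ultimately obtain b where b: "b \<in> axes \<alpha>" "b \<notin> S" "x \<in> axis_verts \<alpha> b" by (auto simp: touched_def)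
        have "\<gamma> a x = \<rho> b x" "\<gamma>' a x = \<rho> b x"
          using coeff_tensorD[OF ct(1)[unfolded ct_def], of a b x] coeff_tensorD[OF ct(2)[unfolded ct_def], of a b x] a x b S
          by auto
        then show ?thesis by simp
      qed
      show "\<gamma> = \<gamma>'"
      proof (rule PiE_ext[OF PiE])
        fix a assume a: "a \<in> S"
        have "\<gamma> a \<in> axis_verts \<alpha> a \<rightarrow>\<^sub>E {1..n}" "\<gamma>' a \<in> axis_verts \<alpha> a \<rightarrow>\<^sub>E {1..n}"
          using PiE a unfolding axis_index_def by (auto dest: PiE_mem)
        then show "\<gamma> a = \<gamma>' a" by (rule PiE_ext) (rule pt[OF a])
      qed
    qed
  qed
  also have "\<dots> = n ^ card ?X" using fin by (subst card_PiE) auto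
  finally have card: "real (card G) \<le> real n ^ card ?X" by (metis of_nat_le_iff of_nat_power)
  have "(\<Sum>\<gamma>\<in>PiE S (axis_index \<alpha> n). ct \<gamma>) = (\<Sum>\<gamma>\<in>G. 1)"
    using idx coeff_tensor_01 by (intro sum.mono_neutral_cong_right) (auto simp: G_def ct_def)
  then show ?thesis using card by (simp add: ct_def)
qed

context
  fixes \<alpha> :: "'a shape" and u w
  assumes fin: "finite (verts \<alpha>)"
    and edges_sub: "\<And>e. e \<in> edges \<alpha> \<Longrightarrow> e \<subseteq> verts \<alpha> \<and> e \<noteq> {}" and cover: "\<Union>(edges \<alpha>) = verts \<alpha>"
    and bd: "left_bd \<alpha> = [u]" "right_bd \<alpha> = [w]" "u \<in> verts \<alpha>" "w \<in> verts \<alpha>"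
    and two: "2 \<le> card (verts \<alpha>)"
begin

lemma axis_verts_sub: "a \<in> axes \<alpha> \<Longrightarrow> axis_verts \<alpha> a \<subseteq> verts \<alpha> \<and> axis_verts \<alpha> a \<noteq> {}"
proof -
  assume "a \<in> axes \<alpha>"
  then consider e where "e \<in> edges \<alpha>" "a = Noise e" | "a = Row_Axis" | "a = Col_Axis"
    by (auto simp: axes_def)
  then show ?thesis using edges_sub bd by cases auto
qed

lemma finite_axes: "finite (axes \<alpha>)"
proof -
  have "finite (edges \<alpha>)" by (rule finite_subset[of _ "Pow (verts \<alpha>)"]) (use fin edges_sub in auto)
  then show ?thesis by (simp add: axes_def)
qed

lemma finite_axis_indices: "R \<subseteq> axes \<alpha> \<Longrightarrow> finite (PiE R (axis_index \<alpha> n))"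
proof (rule finite_PiE)
  assume R: "R \<subseteq> axes \<alpha>"
  then show "finite R" using finite_axes finite_subset by blast
  show "finite (axis_index \<alpha> n a)" if "a \<in> R" for a
  proof -
    have "axis_verts \<alpha> a \<subseteq> verts \<alpha>" using axis_verts_sub that R by blast
    then have "finite (axis_verts \<alpha> a)" using fin finite_subset by blast
    then show ?thesis unfolding axis_index_def by (intro finite_PiE) auto
  qed
qed

lemma touched_sub: "R \<subseteq> axes \<alpha> \<Longrightarrow> touched \<alpha> R \<subseteq> verts \<alpha>"
  using axis_verts_sub by (fastforce simp: touched_def)

lemma touched_Un: "R \<subseteq> axes \<alpha> \<Longrightarrow> touched \<alpha> R \<union> touched \<alpha> (axes \<alpha> - R) = verts \<alpha>"
proof (intro equalityI)
  assume R: "R \<subseteq> axes \<alpha>"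
  show "touched \<alpha> R \<union> touched \<alpha> (axes \<alpha> - R) \<subseteq> verts \<alpha>" using touched_sub R by auto
  have "touched \<alpha> (axes \<alpha>) = touched \<alpha> R \<union> touched \<alpha> (axes \<alpha> - R)" using R by (auto simp: touched_def)
  moreover have "verts \<alpha> \<subseteq> touched \<alpha> (axes \<alpha>)"
    unfolding cover[symmetric] touched_def axes_def by force
  ultimately show "verts \<alpha> \<subseteq> touched \<alpha> R \<union> touched \<alpha> (axes \<alpha> - R)" by simp
qed

text \<open>Row and column sums are \<open>n\<close> to the number of vertices touched by one side
  only. The two exponents add up to the number of vertices minus the number of shared ones, hence to
  at most \<open>v - 1\<close>.\<close>

lemma flattening_norm_le:
  assumes R: "R \<subseteq> axes \<alpha>" and ne: "R \<noteq> {}" and mixed: "touched \<alpha> R \<inter> touched \<alpha> (axes \<alpha> - R) \<noteq> {}"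
  shows "flattening_norm \<alpha> n R \<le> sqrt (real n ^ (card (verts \<alpha>) - 1))"
proof (cases "n = 0")
  case True
  obtain a where a: "a \<in> R" using ne by blast
  then have "axis_index \<alpha> n a = {}"
    using axis_verts_sub[of a] R True by (auto simp: axis_index_def PiE_eq_empty_iff)
  then have "PiE R (axis_index \<alpha> n) = {}" using a by (auto simp: PiE_eq_empty_iff)
  then have "flattening_norm \<alpha> n R \<le> 0"
    unfolding flattening_norm_def using op_norm_le_frob[of "{}"] by (simp add: frob2_def)
  then show ?thesis by (rule order_trans) simp
next
  case False
  let ?X = "touched \<alpha> R" and ?Y = "touched \<alpha> (axes \<alpha> - R)"
  have finXY: "finite ?X" "finite ?Y" using touched_sub[of R] touched_sub[of "axes \<alpha> - R"] R fin finite_subset by auto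
  have "flattening_norm \<alpha> n R \<le> sqrt (real n ^ card (?Y - ?X) * real n ^ card (?X - ?Y))"
    unfolding flattening_norm_def
  proof (rule op_norm_schur_test)
    fix \<rho> assume "\<rho> \<in> PiE R (axis_index \<alpha> n)"
    have "(\<Sum>\<gamma>\<in>PiE (axes \<alpha> - R) (axis_index \<alpha> n). coeff_tensor \<alpha> (\<lambda>a. if a \<in> axes \<alpha> - R then \<gamma> a else \<rho> a))
        \<le> real n ^ card (?Y - touched \<alpha> (axes \<alpha> - (axes \<alpha> - R)))"
      using finXY by (intro sum_coeff_tensor_le finite_axis_indices) auto
    moreover have "axes \<alpha> - (axes \<alpha> - R) = R" using R by blast
    moreover have "coeff_tensor \<alpha> (\<lambda>a. if a \<in> axes \<alpha> - R then \<gamma> a else \<rho> a) = coeff_tensor \<alpha> (\<lambda>a. if a \<in> R then \<rho> a else \<gamma> a)" for \<gamma>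
      unfolding coeff_tensor_def by (intro if_cong refl ball_cong) auto
    ultimately show "(\<Sum>\<gamma>\<in>PiE (axes \<alpha> - R) (axis_index \<alpha> n). coeff_tensor \<alpha> (\<lambda>a. if a \<in> R then \<rho> a else \<gamma> a)) \<le> real n ^ card (?Y - ?X)"
      by simp
  next
    fix \<gamma>
    show "(\<Sum>\<rho>\<in>PiE R (axis_index \<alpha> n). coeff_tensor \<alpha> (\<lambda>a. if a \<in> R then \<rho> a else \<gamma> a)) \<le> real n ^ card (?X - ?Y)"
      using finXY R by (intro sum_coeff_tensor_le finite_axis_indices) auto
  next
    fix \<rho> \<gamma>
    show "0 \<le> coeff_tensor \<alpha> (\<lambda>a. if a \<in> R then \<rho> a else \<gamma> a)"
      using coeff_tensor_01[of \<alpha> "\<lambda>a. if a \<in> R then \<rho> a else \<gamma> a"] by auto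
  qed (use R finite_axis_indices in auto)
  also have "\<dots> \<le> sqrt (real n ^ (card (verts \<alpha>) - 1))"
  proof (rule real_sqrt_le_mono)
    have "card (?Y - ?X) + card (?X - ?Y) = card ((?Y - ?X) \<union> (?X - ?Y))"
      using finXY by (intro card_Un_disjoint[symmetric]) auto
    also have "(?Y - ?X) \<union> (?X - ?Y) = verts \<alpha> - ?X \<inter> ?Y" using touched_Un[OF R] by blast
    also have "card (verts \<alpha> - ?X \<inter> ?Y) \<le> card (verts \<alpha>) - 1"
    proof -
      have sub: "?X \<inter> ?Y \<subseteq> verts \<alpha>" using touched_sub[OF R] by blast
      have "1 \<le> card (?X \<inter> ?Y)" using mixed finXY by (simp add: Suc_le_eq card_gt_0_iff)
      then show ?thesis using sub finXY by (simp add: card_Diff_subset)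
    qed
    finally have "real n ^ (card (?Y - ?X) + card (?X - ?Y)) \<le> real n ^ (card (verts \<alpha>) - 1)"
      using False by (intro power_increasing) auto
    then show "real n ^ card (?Y - ?X) * real n ^ card (?X - ?Y) \<le> real n ^ (card (verts \<alpha>) - 1)"
      by (simp add: power_add)
  qed
  finally show ?thesis .
qed

text \<open>If exactly one vertex is shared, fixing its label to 1 makes all remaining labels of the
  two sides compatible. This is a block of ones whose side lengths multiply to
  \<open>n ^ (v - 1)\<close>.\<close>

lemma flattening_norm_ge:
  assumes R: "R \<subseteq> axes \<alpha>" and single: "touched \<alpha> R \<inter> touched \<alpha> (axes \<alpha> - R) = {x0}"
  shows "sqrt (real n ^ (card (verts \<alpha>) - 1)) \<le> flattening_norm \<alpha> n R"
proof (cases "n = 0")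
  case True
  then show ?thesis using two by (simp add: flattening_norm_def power_0_left)
next
  case False
  let ?X = "touched \<alpha> R" and ?Y = "touched \<alpha> (axes \<alpha> - R)"
  define \<Phi> where "\<Phi> X = PiE X (\<lambda>x. if x = x0 then {1} else {1..n})" for X
  define row where "row S \<phi> = (\<lambda>a\<in>S. restrict \<phi> (axis_verts \<alpha> a))" for S and \<phi> :: "'a \<Rightarrow> nat"
  have finXY: "finite ?X" "finite ?Y" using touched_sub[of R] touched_sub[of "axes \<alpha> - R"] R fin finite_subset by auto
  have card: "card (row S ` \<Phi> (touched \<alpha> S)) = n ^ (card (touched \<alpha> S) - 1)"
    if S: "finite (touched \<alpha> S)" "x0 \<in> touched \<alpha> S" for S
  proof -
    have "inj_on (row S) (\<Phi> (touched \<alpha> S))"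
    proof (rule inj_onI)
      fix \<phi> \<phi>' assume p: "\<phi> \<in> \<Phi> (touched \<alpha> S)" "\<phi>' \<in> \<Phi> (touched \<alpha> S)" and eq: "row S \<phi> = row S \<phi>'"
      have "\<phi> x = \<phi>' x" if x: "x \<in> touched \<alpha> S" for x
      proof -
        obtain a where a: "a \<in> S" "x \<in> axis_verts \<alpha> a" using x by (auto simp: touched_def)
        have "row S \<phi> a x = row S \<phi>' a x" using eq by simp
        then show ?thesis using a by (simp add: row_def)
      qed
      then show "\<phi> = \<phi>'" using p unfolding \<Phi>_def by (rule PiE_ext[rotated 2])
    qed
    then have "card (row S ` \<Phi> (touched \<alpha> S)) = (\<Prod>x\<in>touched \<alpha> S. card (if x = x0 then {1} else {1..n}))"
      unfolding \<Phi>_def using S by (simp add: card_image card_PiE)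
    also have "\<dots> = (\<Prod>x\<in>touched \<alpha> S - {x0}. n)"
      using S by (intro prod.mono_neutral_cong_right) auto
    finally show ?thesis using S by simp
  qed
  have sub: "row S ` \<Phi> (touched \<alpha> S) \<subseteq> PiE S (axis_index \<alpha> n)" for S
  proof
    fix \<rho> assume "\<rho> \<in> row S ` \<Phi> (touched \<alpha> S)"
    then obtain \<phi> where \<phi>: "\<phi> \<in> \<Phi> (touched \<alpha> S)" "\<rho> = row S \<phi>" by blast
    have "\<phi> x \<in> {1..n}" if "x \<in> touched \<alpha> S" for x
      using PiE_mem[OF \<phi>(1)[unfolded \<Phi>_def] that] False by (auto split: if_splits)
    then have "restrict \<phi> (axis_verts \<alpha> a) \<in> axis_index \<alpha> n a" if "a \<in> S" for a
      unfolding axis_index_def using that by (intro restrict_PiE_iff[THEN iffD2]) (auto simp: touched_def)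
    then show "\<rho> \<in> PiE S (axis_index \<alpha> n)" unfolding \<phi>(2) row_def by (intro restrict_PiE_iff[THEN iffD2] ballI)
  qed
  have "sqrt (card (row R ` \<Phi> ?X) * card (row (axes \<alpha> - R) ` \<Phi> ?Y)) \<le> flattening_norm \<alpha> n R"
    unfolding flattening_norm_def
  proof (rule op_norm_ge_block[OF finite_axis_indices[OF R] finite_axis_indices sub sub])
    fix \<rho> \<gamma> assume "\<rho> \<in> row R ` \<Phi> ?X" "\<gamma> \<in> row (axes \<alpha> - R) ` \<Phi> ?Y"
    then obtain \<phi> \<psi> where \<phi>: "\<phi> \<in> \<Phi> ?X" "\<rho> = row R \<phi>" and \<psi>: "\<psi> \<in> \<Phi> ?Y" "\<gamma> = row (axes \<alpha> - R) \<psi>" by blast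
    have "x0 \<in> ?X" "x0 \<in> ?Y" using single by auto
    then have x0: "\<phi> x0 = \<psi> x0"
      using PiE_mem[OF \<phi>(1)[unfolded \<Phi>_def], of x0] PiE_mem[OF \<psi>(1)[unfolded \<Phi>_def], of x0] by auto
    define \<kappa> where "\<kappa> x = (if x \<in> ?X then \<phi> x else \<psi> x)" for x
    have "(if a \<in> R then \<rho> a else \<gamma> a) x = \<kappa> x" if a: "a \<in> axes \<alpha>" "x \<in> axis_verts \<alpha> a" for a x
    proof (cases "a \<in> R")
      case True
      then show ?thesis using a by (auto simp: \<phi>(2) row_def \<kappa>_def touched_def)
    next
      case False
      then have "x \<in> ?Y" using a by (auto simp: touched_def)
      then have "x \<in> ?X \<Longrightarrow> x = x0" using single by blast
      then show ?thesis using a False x0 by (auto simp: \<psi>(2) row_def \<kappa>_def)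
    qed
    then have "\<forall>a\<in>axes \<alpha>. \<forall>b\<in>axes \<alpha>. \<forall>x\<in>axis_verts \<alpha> a \<inter> axis_verts \<alpha> b.
        (if a \<in> R then \<rho> a else \<gamma> a) x = (if b \<in> R then \<rho> b else \<gamma> b) x" by simp
    then show "coeff_tensor \<alpha> (\<lambda>a. if a \<in> R then \<rho> a else \<gamma> a) = 1"
      unfolding coeff_tensor_def by (rule if_P)
  qed auto
  also have "card (row R ` \<Phi> ?X) * card (row (axes \<alpha> - R) ` \<Phi> ?Y) = n ^ (card (verts \<alpha>) - 1)"
  proof -
    have x0: "x0 \<in> ?X" "x0 \<in> ?Y" using single by auto
    have "card ?X + card ?Y = card (verts \<alpha>) + 1"
      using card_Un_Int[OF finXY] single touched_Un[OF R] by simp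
    moreover have "1 \<le> card ?X" "1 \<le> card ?Y" using x0 finXY by (auto simp: Suc_le_eq card_gt_0_iff)
    ultimately have "card ?X - 1 + (card ?Y - 1) = card (verts \<alpha>) - 1" by linarith
    then show ?thesis using card[OF finXY(1) x0(1)] card[OF finXY(2) x0(2)] by (simp flip: power_add)
  qed
  finally show ?thesis by simp
qed

end

section \<open>The parameters \<sigma> and \<nu> of a chain\<close>

lemma chain_flattening_assms:
  "e \<in> edges (chain L q) \<Longrightarrow> e \<subseteq> verts (chain L q) \<and> e \<noteq> {}"
  "Spine 0 \<in> verts (chain L q)" "Spine (Suc L) \<in> verts (chain L q)"
  "2 \<le> card (verts (chain L q))"
proof -
  show "e \<in> edges (chain L q) \<Longrightarrow> e \<subseteq> verts (chain L q) \<and> e \<noteq> {}"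
    using chain_edges_verts[of e L q] by auto
qed (auto simp: chain_def, simp add: card_verts_chain[unfolded chain_def, simplified])

lemmas chain_flattening = finite_verts_chain chain_flattening_assms(1) Union_chain_edges
  left_bd_chain right_bd_chain chain_flattening_assms(2-)

text \<open>Without a shared vertex every edge would lie entirely on one side. The side of
  \<open>x\<^sub>0\<close> would then contain all vertices by connectedness, while the other side
  touches at least one.\<close>

lemma chain_mixed:
  assumes R: "R \<subseteq> axes (chain L q)" "R \<noteq> {}" "R \<noteq> axes (chain L q)"
  shows "touched (chain L q) R \<inter> touched (chain L q) (axes (chain L q) - R) \<noteq> {}"
proof
  let ?\<alpha> = "chain L q"
  let ?X = "touched ?\<alpha> R" and ?Y = "touched ?\<alpha> (axes ?\<alpha> - R)"
  assume disj: "?X \<inter> ?Y = {}"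
  have Un: "?X \<union> ?Y = verts ?\<alpha>" by (rule touched_Un[OF chain_flattening R(1)])
  have ne: "?X \<noteq> {}" "?Y \<noteq> {}"
  proof -
    have "touched ?\<alpha> S \<noteq> {}" if S: "S \<subseteq> axes ?\<alpha>" "S \<noteq> {}" for S
    proof -
      obtain a where a: "a \<in> S" using S by blast
      then have "axis_verts ?\<alpha> a \<noteq> {}" using axis_verts_sub[OF chain_flattening, where a = a] S by auto
      then show ?thesis using a by (auto simp: touched_def)
    qed
    then show "?X \<noteq> {}" "?Y \<noteq> {}" using R by auto
  qed
  have split: "e \<subseteq> ?X \<or> e \<subseteq> ?Y" if e: "e \<in> edges ?\<alpha>" for e
  proof -
    have "Noise e \<in> axes ?\<alpha>" using e by (simp add: axes_def)
    then show ?thesis by (cases "Noise e \<in> R") (force simp: touched_def)+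
  qed
  have "Spine 0 \<in> ?X \<union> ?Y" using Un by (simp add: chain_def)
  then show False
  proof
    assume "Spine 0 \<in> ?X"
    then have "verts ?\<alpha> \<subseteq> ?X" using split disj by (intro chain_connected) blast+
    then show False using Un disj ne by blast
  next
    assume "Spine 0 \<in> ?Y"
    then have "verts ?\<alpha> \<subseteq> ?Y" using split disj by (intro chain_connected) blast+
    then show False using Un disj ne by blast
  qed
qed

text \<open>The maximum is attained by the flattening with only the row axis on the row side: it
  touches \<open>x\<^sub>0\<close> alone, which it shares with the first spine edge.\<close>

lemma tensor_sigma_chain:
  "tensor_sigma (chain L q) n = sqrt (real n ^ (card (verts (chain L q)) - 1))"
  unfolding tensor_sigma_def
proof (rule Max_eqI)
  let ?\<alpha> = "chain L q"
  let ?A = "{R. R \<subseteq> axes ?\<alpha> \<and> (Row_Axis \<in> R \<longleftrightarrow> Col_Axis \<notin> R)}"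
  have "finite ?A" by (rule finite_subset[of _ "Pow (axes ?\<alpha>)"]) (use finite_axes[OF chain_flattening] in auto)
  then show "finite (flattening_norm ?\<alpha> n ` ?A)" by simp
  have axes: "Row_Axis \<in> axes ?\<alpha>" "Col_Axis \<in> axes ?\<alpha>" by (auto simp: axes_def)
  show "y \<le> sqrt (real n ^ (card (verts ?\<alpha>) - 1))" if "y \<in> flattening_norm ?\<alpha> n ` ?A" for y
  proof -
    obtain R where R: "R \<subseteq> axes ?\<alpha>" "Row_Axis \<in> R \<longleftrightarrow> Col_Axis \<notin> R" "y = flattening_norm ?\<alpha> n R"
      using \<open>y \<in> _\<close> by blast
    then have "R \<noteq> {}" "R \<noteq> axes ?\<alpha>" using axes by auto
    then show ?thesis unfolding R(3) using R(1)
      by (intro flattening_norm_le[OF chain_flattening] chain_mixed)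
  qed
  have "touched ?\<alpha> {Row_Axis} \<inter> touched ?\<alpha> (axes ?\<alpha> - {Row_Axis}) = {Spine 0}"
  proof -
    have "{Spine 0, Spine 1} \<in> edges ?\<alpha>" by (auto simp: chain_def)
    then have "Noise {Spine 0, Spine 1} \<in> axes ?\<alpha> - {Row_Axis}" by (simp add: axes_def)
    then have "Spine 0 \<in> touched ?\<alpha> (axes ?\<alpha> - {Row_Axis})" unfolding touched_def by (rule UN_I) simp
    then show ?thesis by (auto simp: touched_def)
  qed
  then have "sqrt (real n ^ (card (verts ?\<alpha>) - 1)) \<le> flattening_norm ?\<alpha> n {Row_Axis}"
    using axes by (intro flattening_norm_ge[OF chain_flattening]) auto
  moreover have "flattening_norm ?\<alpha> n {Row_Axis} \<le> sqrt (real n ^ (card (verts ?\<alpha>) - 1))"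
    using axes by (intro flattening_norm_le[OF chain_flattening] chain_mixed) auto
  ultimately show "sqrt (real n ^ (card (verts ?\<alpha>) - 1)) \<in> flattening_norm ?\<alpha> n ` ?A"
    using axes by (intro image_eqI[of _ _ "{Row_Axis}"] antisym) auto
qed

text \<open>The maximum is attained by a single leaf edge at \<open>x\<^sub>1\<close> on the row
  side. Its leaf is touched by no other axis, so \<open>x\<^sub>1\<close> is the only shared
  vertex.\<close>

lemma tensor_nu_chain:
  assumes "1 \<le> L" "1 \<le> q 1"
  shows "tensor_nu (chain L q) n = sqrt (real n ^ (card (verts (chain L q)) - 1))"
  unfolding tensor_nu_def
proof (rule Max_eqI)
  let ?\<alpha> = "chain L q"
  let ?A = "{R. R \<subseteq> axes ?\<alpha> \<and> Row_Axis \<notin> R \<and> Col_Axis \<notin> R \<and> R \<noteq> {}}"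
  let ?e = "{Spine 1, Leaf 1 0}"
  have "finite ?A" by (rule finite_subset[of _ "Pow (axes ?\<alpha>)"]) (use finite_axes[OF chain_flattening] in auto)
  then show "finite (flattening_norm ?\<alpha> n ` ?A)" by simp
  have axes: "Row_Axis \<in> axes ?\<alpha>" by (auto simp: axes_def)
  show "y \<le> sqrt (real n ^ (card (verts ?\<alpha>) - 1))" if "y \<in> flattening_norm ?\<alpha> n ` ?A" for y
  proof -
    obtain R where R: "R \<subseteq> axes ?\<alpha>" "Row_Axis \<notin> R" "R \<noteq> {}" "y = flattening_norm ?\<alpha> n R"
      using \<open>y \<in> _\<close> by blast
    then have "R \<noteq> axes ?\<alpha>" using axes by auto
    then show ?thesis unfolding R(4) using R(1,3)
      by (intro flattening_norm_le[OF chain_flattening] chain_mixed)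
  qed
  have "?e \<in> {{Spine j, Leaf j k} |j k. 1 \<le> j \<and> j \<le> L \<and> k < q j}" using assms by fastforce
  then have "?e \<in> edges ?\<alpha>" by (simp only: chain_def shape.simps Un_iff simp_thms)
  then have Ne: "Noise ?e \<in> axes ?\<alpha>" by (simp add: axes_def)
  have "touched ?\<alpha> {Noise ?e} \<inter> touched ?\<alpha> (axes ?\<alpha> - {Noise ?e}) = {Spine 1}"
  proof -
    have "{Spine 0, Spine 1} \<in> edges ?\<alpha>" by (auto simp: chain_def)
    then have "Noise {Spine 0, Spine 1} \<in> axes ?\<alpha> - {Noise ?e}" by (auto simp: axes_def doubleton_eq_iff)
    then have "Spine 1 \<in> touched ?\<alpha> (axes ?\<alpha> - {Noise ?e})" unfolding touched_def by (rule UN_I) simp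
    moreover have "Leaf 1 0 \<notin> touched ?\<alpha> (axes ?\<alpha> - {Noise ?e})"
      by (auto simp: touched_def axes_def chain_def insert_commute)
    ultimately show ?thesis by (auto simp: touched_def)
  qed
  then have "sqrt (real n ^ (card (verts ?\<alpha>) - 1)) \<le> flattening_norm ?\<alpha> n {Noise ?e}"
    using Ne by (intro flattening_norm_ge[OF chain_flattening]) auto
  moreover have "flattening_norm ?\<alpha> n {Noise ?e} \<le> sqrt (real n ^ (card (verts ?\<alpha>) - 1))"
    using Ne axes by (intro flattening_norm_le[OF chain_flattening] chain_mixed) auto
  ultimately show "sqrt (real n ^ (card (verts ?\<alpha>) - 1)) \<in> flattening_norm ?\<alpha> n ` ?A"
    using Ne by (intro image_eqI[of _ _ "{Noise ?e}"] antisym) auto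
qed

section \<open>Concentrated and balanced decorations\<close>

lemma sum_concentrated: "1 \<le> L \<Longrightarrow> (\<Sum>i=1..L. concentrated L r i) = L * r"
  by (simp add: concentrated_def)

lemma sum_balanced: "(\<Sum>i=1..L. balanced r i) = L * r"
  by (simp add: balanced_def)

lemma expected_norm_concentrated:
  assumes "1 \<le> L" "1 \<le> r"
  shows "expected_norm (chain L (concentrated L r)) \<in>
    \<Theta>(\<lambda>n. sqrt n ^ (L + 1 + L * r) * sqrt (ln n) ^ (L * r))"
  using expected_norm_chain_bigtheta[of L "concentrated L r"] assms sum_concentrated[of L r]
  by (simp add: concentrated_def)

lemma expected_norm_balanced:
  assumes "1 \<le> L" "1 \<le> r"
  shows "expected_norm (chain L (balanced r)) \<in> \<Theta>(\<lambda>n. sqrt n ^ (L + 1 + L * r) * sqrt (ln n) ^ r)"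
  using expected_norm_chain_bigtheta[of L "balanced r"] assms by (simp add: balanced_def)

theorem corollary2p9:
  fixes L r :: nat
  assumes "L \<ge> 2" and "r \<ge> 1"
  shows
    "card (verts (chain L (concentrated L r))) = card (verts (chain L (balanced r))) \<and>
     card (edges (chain L (concentrated L r))) = card (edges (chain L (balanced r))) \<and>
     length (left_bd (chain L (concentrated L r))) = length (left_bd (chain L (balanced r))) \<and>
     length (right_bd (chain L (concentrated L r))) = length (right_bd (chain L (balanced r))) \<and>
     min_separator (chain L (concentrated L r)) = min_separator (chain L (balanced r)) \<and>
     num_isolated (chain L (concentrated L r)) = num_isolated (chain L (balanced r)) \<and>
     (\<forall>n. tensor_sigma (chain L (concentrated L r)) n = tensor_sigma (chain L (balanced r)) n) \<and>
     (\<forall>n. tensor_nu (chain L (concentrated L r)) n = tensor_nu (chain L (balanced r)) n) \<and>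
     (\<lambda>n. expected_norm (chain L (concentrated L r)) n / expected_norm (chain L (balanced r)) n)
       \<in> \<Theta>(\<lambda>n. ln (real n) powr (real ((L - 1) * r) / 2)) \<and>
     is_tree (chain 2 (concentrated 2 1)) \<and>
     is_tree (chain 2 (balanced 1)) \<and>
     card (verts (chain 2 (concentrated 2 1))) = 6 \<and>
     card (edges (chain 2 (concentrated 2 1))) = 5 \<and>
     card (verts (chain 2 (balanced 1))) = 6 \<and>
     card (edges (chain 2 (balanced 1))) = 5 \<and>
     expected_norm (chain 2 (concentrated 2 1))
       \<in> \<Theta>(\<lambda>n. real n powr (5 / 2) * ln (real n)) \<and>
     expected_norm (chain 2 (balanced 1))
       \<in> \<Theta>(\<lambda>n. real n powr (5 / 2) * sqrt (ln (real n)))"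
proof -
  have L: "1 \<le> L" using assms by simp
  have V: "card (verts (chain L (concentrated L r))) = card (verts (chain L (balanced r)))"
    using L by (simp only: card_verts_chain sum_concentrated sum_balanced)
  have E: "card (edges (chain L (concentrated L r))) = card (edges (chain L (balanced r)))"
    using L by (simp only: card_edges_chain sum_concentrated sum_balanced)
  have nu: "tensor_nu (chain L (concentrated L r)) n = tensor_nu (chain L (balanced r)) n" for n
    using L assms by (subst (1 2) tensor_nu_chain) (simp_all add: V, simp_all add: concentrated_def balanced_def)
  have sqrt_power: "sqrt x ^ k = x powr (real k / 2)" if "0 < x" for x :: real and k
    using that by (simp add: powr_half_sqrt[symmetric] powr_powr flip: powr_realpow)
  have "(\<lambda>n. expected_norm (chain L (concentrated L r)) n / expected_norm (chain L (balanced r)) n)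
      \<in> \<Theta>(\<lambda>n. (sqrt n ^ (L + 1 + L * r) * sqrt (ln n) ^ (L * r)) / (sqrt n ^ (L + 1 + L * r) * sqrt (ln n) ^ r))"
    by (intro bigtheta_divide expected_norm_concentrated expected_norm_balanced L assms)
  also have "(\<lambda>n. (sqrt n ^ (L + 1 + L * r) * sqrt (ln n) ^ (L * r)) / (sqrt n ^ (L + 1 + L * r) * sqrt (ln n) ^ r))
      \<in> \<Theta>(\<lambda>n. ln (real n) powr (real ((L - 1) * r) / 2))"
  proof (rule bigthetaI_cong)
    have "eventually (\<lambda>n::nat. 2 \<le> n) sequentially" by (rule eventually_ge_at_top)
    then show "eventually (\<lambda>n::nat. (sqrt n ^ (L + 1 + L * r) * sqrt (ln n) ^ (L * r)) / (sqrt n ^ (L + 1 + L * r) * sqrt (ln n) ^ r)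
        = ln (real n) powr (real ((L - 1) * r) / 2)) sequentially"
    proof eventually_elim
      case (elim n)
      then have pos: "0 < sqrt n" "0 < ln n" by auto
      \<comment> \<open>The exponent of the concentrated norm splits as \<open>r\<close> plus the
        surplus \<open>(L - 1) * r\<close>; the first part cancels against the balanced
        norm.\<close>
      have "L * r = r + (L - 1) * r" using L by (cases L) auto
      then have "sqrt (ln n) ^ (L * r) = sqrt (ln n) ^ r * sqrt (ln n) ^ ((L - 1) * r)"
        by (simp only: power_add)
      then show ?case using pos by (simp add: sqrt_power del: of_nat_mult)
    qed
  qed
  finally have ratio: "(\<lambda>n. expected_norm (chain L (concentrated L r)) n / expected_norm (chain L (balanced r)) n)
      \<in> \<Theta>(\<lambda>n. ln (real n) powr (real ((L - 1) * r) / 2))" .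
  have c2: "expected_norm (chain 2 (concentrated 2 1)) \<in> \<Theta>(\<lambda>n. real n powr (5 / 2) * ln (real n))"
  proof -
    have "expected_norm (chain 2 (concentrated 2 1)) \<in> \<Theta>(\<lambda>n. sqrt n ^ 5 * sqrt (ln n) ^ 2)"
      using expected_norm_concentrated[of 2 1] by simp
    also have "(\<lambda>n. sqrt n ^ 5 * sqrt (ln n) ^ 2) \<in> \<Theta>(\<lambda>n. real n powr (5 / 2) * ln (real n))"
    proof (rule bigthetaI_cong)
      have "eventually (\<lambda>n::nat. 2 \<le> n) sequentially" by (rule eventually_ge_at_top)
      then show "eventually (\<lambda>n. sqrt (real n) ^ 5 * sqrt (ln (real n)) ^ 2 = real n powr (5 / 2) * ln (real n)) sequentially"
        by eventually_elim (use sqrt_power[of _ 5] in simp)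
    qed
    finally show ?thesis .
  qed
  have b2: "expected_norm (chain 2 (balanced 1)) \<in> \<Theta>(\<lambda>n. real n powr (5 / 2) * sqrt (ln (real n)))"
  proof -
    have "expected_norm (chain 2 (balanced 1)) \<in> \<Theta>(\<lambda>n. sqrt n ^ 5 * sqrt (ln n) ^ 1)"
      using expected_norm_balanced[of 2 1] by simp
    also have "(\<lambda>n. sqrt n ^ 5 * sqrt (ln n) ^ 1) \<in> \<Theta>(\<lambda>n. real n powr (5 / 2) * sqrt (ln (real n)))"
    proof (rule bigthetaI_cong)
      have "eventually (\<lambda>n::nat. 2 \<le> n) sequentially" by (rule eventually_ge_at_top)
      then show "eventually (\<lambda>n. sqrt (real n) ^ 5 * sqrt (ln (real n)) ^ 1 = real n powr (5 / 2) * sqrt (ln (real n))) sequentially"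
        by eventually_elim (use sqrt_power[of _ 5] in simp)
    qed
    finally show ?thesis .
  qed
  have cards: "card (verts (chain 2 (concentrated 2 1))) = 6" "card (edges (chain 2 (concentrated 2 1))) = 5"
    "card (verts (chain 2 (balanced 1))) = 6" "card (edges (chain 2 (balanced 1))) = 5"
    using sum_concentrated[of 2 1] sum_balanced[of 1 2] by (simp_all add: card_verts_chain card_edges_chain)
  show ?thesis
    using V E nu ratio c2 b2 cards
    by (simp add: min_separator_chain num_isolated_chain tensor_sigma_chain is_tree_chain)
qed

end
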